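(* Let $P : B(\mathcal{H}) \to B(\mathcal{H})$ be a non-zero linear $\mathcal{D}$-bimodule map that is idempotent and w*-continuous, let $\mathcal{M} = P(B(\mathcal{H}))$ denote the range of $P$, and assume that $\|P\| < 2/\sqrt{3}$. Then: (1) $\Gamma(P) = \chi_E$ (marginally almost everywhere), where $E = \bigcup_m I_m \times J_m$, with $\{I_m\}$ and $\{J_m\}$ countable collections of pairwise disjoint Borel subsets of $X$ (the $I_m$ are pairwise disjoint, and the $J_m$ are pairwise disjoint); (2) $\mathcal{M} = \sum_m \chi_{I_m} B(L^2(X,\mu)) \chi_{J_m}$ and $\mathcal{M}\mathcal{M}^*\mathcal{M} \subseteq \mathcal{M}$; (3) $\|P\| = 1$.
   Context: $\mathcal{D}\subseteq B(\mathcal{H})$ is a masa (maximal abelian selfadjoint subalgebra) on a separable Hilbert space, represented as the algebra $L^\infty(X,\mu)$ of multiplication operators $M_f$ on $\mathcal{H}=L^2(X,\mu)$, where $(X,\mu)$ is a standard finite Borel measure space. A linear map $\Phi$ on $B(\mathcal{H})$ is a $\mathcal{D}$-bimodule map if $\Phi(D_1TD_2)=D_1\Phi(T)D_2$ for all $T\in B(\mathcal{H})$, $D_1,D_2\in\mathcal{D}$. A set $R\subseteq X\times X$ is marginally null if $R\subseteq (N\times X)\cup(X\times N)$ for some $\mu$-null set $N$; two functions on $X\times X$ are equal marginally almost everywhere (m.a.e.) if the set where they differ is marginally null. Symbol: every w*-continuous $\mathcal{D}$-bimodule map $\Phi:B(\mathcal{H})\to B(\mathcal{H})$ can be written (Haagerup)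 as $\Phi(T)=\sum_{n=1}^\infty M_{f_n}TM_{g_n}$ (w*-convergent) with Borel functions $f_n,g_n:X\to\mathbb{C}$ such that $\sum_n|f_n(s)|^2$ and $\sum_n|g_n(s)|^2$ converge for all $s\in X$ and are bounded in $s$. The symbol $\Gamma(\Phi)$ is the m.a.e. equivalence class of the Borel function $\phi(s,t)=\sum_n f_n(s)g_n(t)$ on $X\times X$; it does not depend on the chosen representation. For a Borel set $I\subseteq X$, the operator $\chi_I$ is multiplication by the indicator function of $I$. The sum $\sum_m \chi_{I_m} B(L^2(X,\mu)) \chi_{J_m}$ is understood as the w*-closed sum, i.e. the w*-closed linear span of these subspaces. $\mathcal{M}\mathcal{M}^*\mathcal{M} \subseteq \mathcal{M}$ means $m_1m_2^*m_3\in\mathcal{M}$ for all $m_1,m_2,m_3\in\mathcal{M}$. *)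

theory Defs
  imports "HOL-Analysis.Analysis"
begin

definition standard_borel :: "'a measure \<Rightarrow> bool" where
  "standard_borel M \<longleftrightarrow>
     (\<exists>T. completely_metrizable_space T \<and> second_countable T \<and> topspace T = space M \<and>
          sets M = sigma_sets (space M) {U. openin T U})"


section \<open>The Hilbert space of square-integrable functions\<close>

definition square_integrable :: "'a measure \<Rightarrow> ('a \<Rightarrow> complex) set" where
  "square_integrable M =
     {f \<in> borel_measurable M. integrable M (\<lambda>x. (cmod (f x))\<^sup>2)}"

definition ae_class :: "'a measure \<Rightarrow> ('a \<Rightarrow> complex) \<Rightarrow> ('a \<Rightarrow> complex) set" where
  "ae_class M f = {g \<in> borel_measurable M. AE x in M. g x = f x}"

definition rep :: "('a \<Rightarrow> complex) set \<Rightarrow> 'a \<Rightarrow> complex" where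
  "rep \<xi> = (SOME f. f \<in> \<xi>)"

text \<open>Vectors are almost-everywhere classes; \<open>rep\<close> only ever occurs where the value does not
  depend on the chosen representative.\<close>

type_synonym 'a vec_class = "('a \<Rightarrow> complex) set"
type_synonym 'a oper = "'a vec_class \<Rightarrow> 'a vec_class"

definition L2 :: "'a measure \<Rightarrow> 'a vec_class set" where
  "L2 M = ae_class M ` square_integrable M"

definition vec_add :: "'a measure \<Rightarrow> 'a vec_class \<Rightarrow> 'a vec_class \<Rightarrow> 'a vec_class" where
  "vec_add M \<xi> \<eta> = ae_class M (\<lambda>x. rep \<xi> x + rep \<eta> x)"

definition vec_scale :: "'a measure \<Rightarrow> complex \<Rightarrow> 'a vec_class \<Rightarrow> 'a vec_class" where
  "vec_scale M c \<xi> = ae_class M (\<lambda>x. c * rep \<xi> x)"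

definition vec_inner :: "'a measure \<Rightarrow> 'a vec_class \<Rightarrow> 'a vec_class \<Rightarrow> complex" where
  "vec_inner M \<xi> \<eta> = (\<integral>x. rep \<xi> x * cnj (rep \<eta> x) \<partial>M)"

definition vec_norm :: "'a measure \<Rightarrow> 'a vec_class \<Rightarrow> real" where
  "vec_norm M \<xi> = sqrt (\<integral>x. (cmod (rep \<xi> x))\<^sup>2 \<partial>M)"


section \<open>Bounded operators\<close>

text \<open>Operators are \<open>undefined\<close> outside \<open>L2 M\<close>, so that equality of operators is equality of
  functions.\<close>

definition BH :: "'a measure \<Rightarrow> 'a oper set" where
  "BH M = {T \<in> L2 M \<rightarrow>\<^sub>E L2 M.
     (\<forall>\<xi>\<in>L2 M. \<forall>\<eta>\<in>L2 M. T (vec_add M \<xi> \<eta>) = vec_add M (T \<xi>) (T \<eta>)) \<and>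
     (\<forall>c. \<forall>\<xi>\<in>L2 M. T (vec_scale M c \<xi>) = vec_scale M c (T \<xi>)) \<and>
     (\<exists>C. \<forall>\<xi>\<in>L2 M. vec_norm M (T \<xi>) \<le> C * vec_norm M \<xi>)}"

definition op_zero :: "'a measure \<Rightarrow> 'a oper" where
  "op_zero M = (\<lambda>\<xi>\<in>L2 M. ae_class M (\<lambda>x. 0))"

definition op_add :: "'a measure \<Rightarrow> 'a oper \<Rightarrow> 'a oper \<Rightarrow> 'a oper" where
  "op_add M S T = (\<lambda>\<xi>\<in>L2 M. vec_add M (S \<xi>) (T \<xi>))"

definition op_scale :: "'a measure \<Rightarrow> complex \<Rightarrow> 'a oper \<Rightarrow> 'a oper" where
  "op_scale M c T = (\<lambda>\<xi>\<in>L2 M. vec_scale M c (T \<xi>))"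

primrec op_sum :: "'a measure \<Rightarrow> (nat \<Rightarrow> 'a oper) \<Rightarrow> nat \<Rightarrow> 'a oper" where
  "op_sum M S 0 = op_zero M"
| "op_sum M S (Suc n) = op_add M (op_sum M S n) (S n)"

definition op_mult :: "'a measure \<Rightarrow> 'a oper \<Rightarrow> 'a oper \<Rightarrow> 'a oper" where
  "op_mult M S T = compose (L2 M) S T"

definition op_adjoint :: "'a measure \<Rightarrow> 'a oper \<Rightarrow> 'a oper" where
  "op_adjoint M T = (THE S. S \<in> BH M \<and>
     (\<forall>\<xi>\<in>L2 M. \<forall>\<eta>\<in>L2 M. vec_inner M (T \<xi>) \<eta> = vec_inner M \<xi> (S \<eta>)))"

definition op_norm :: "'a measure \<Rightarrow> 'a oper \<Rightarrow> real" where
  "op_norm M T = (SUP \<xi>\<in>{\<xi>\<in>L2 M. vec_norm M \<xi> \<le> 1}. vec_norm M (T \<xi>))"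

definition op_subspace :: "'a measure \<Rightarrow> 'a oper set \<Rightarrow> bool" where
  "op_subspace M V \<longleftrightarrow> V \<subseteq> BH M \<and> op_zero M \<in> V \<and>
     (\<forall>S\<in>V. \<forall>T\<in>V. op_add M S T \<in> V) \<and> (\<forall>c. \<forall>T\<in>V. op_scale M c T \<in> V)"

definition op_span :: "'a measure \<Rightarrow> 'a oper set \<Rightarrow> 'a oper set" where
  "op_span M A = op_subspace M hull A"

text \<open>The w*-topology of \<open>B(H)\<close> as the dual of the trace class: the trace-class operators are the
  sums of rank-one operators \<open>\<xi> n \<otimes> (\<eta> n)\<^sup>*\<close> with square-summable \<open>\<xi>\<close> and \<open>\<eta>\<close>.\<close>

definition normal_functionals :: "'a measure \<Rightarrow> ('a oper \<Rightarrow> complex) set" where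
  "normal_functionals M =
     {(\<lambda>T. \<Sum>n. vec_inner M (T (\<xi> n)) (\<eta> n)) | \<xi> \<eta>.
        range \<xi> \<subseteq> L2 M \<and> range \<eta> \<subseteq> L2 M \<and>
        summable (\<lambda>n. (vec_norm M (\<xi> n))\<^sup>2) \<and> summable (\<lambda>n. (vec_norm M (\<eta> n))\<^sup>2)}"

definition wstar_topology :: "'a measure \<Rightarrow> 'a oper topology" where
  "wstar_topology M =
     topology_generated_by {{T \<in> BH M. \<omega> T \<in> U} | \<omega> U. \<omega> \<in> normal_functionals M \<and> open U}"


section \<open>Multiplication operators and bimodule maps\<close>

definition Linfty :: "'a measure \<Rightarrow> ('a \<Rightarrow> complex) set" where
  "Linfty M = {f \<in> borel_measurable M. \<exists>C. AE x in M. cmod (f x) \<le> C}"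

definition mult_op :: "'a measure \<Rightarrow> ('a \<Rightarrow> complex) \<Rightarrow> 'a oper" where
  "mult_op M f = (\<lambda>\<xi>\<in>L2 M. ae_class M (\<lambda>x. f x * rep \<xi> x))"

definition mult_algebra :: "'a measure \<Rightarrow> 'a oper set" where
  "mult_algebra M = mult_op M ` Linfty M"

definition linear_map :: "'a measure \<Rightarrow> ('a oper \<Rightarrow> 'a oper) \<Rightarrow> bool" where
  "linear_map M \<Phi> \<longleftrightarrow> \<Phi> \<in> BH M \<rightarrow> BH M \<and>
     (\<forall>S\<in>BH M. \<forall>T\<in>BH M. \<Phi> (op_add M S T) = op_add M (\<Phi> S) (\<Phi> T)) \<and>
     (\<forall>c. \<forall>T\<in>BH M. \<Phi> (op_scale M c T) = op_scale M c (\<Phi> T))"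

definition bimodule_map :: "'a measure \<Rightarrow> ('a oper \<Rightarrow> 'a oper) \<Rightarrow> bool" where
  "bimodule_map M \<Phi> \<longleftrightarrow>
     (\<forall>T\<in>BH M. \<forall>D\<^sub>1\<in>mult_algebra M. \<forall>D\<^sub>2\<in>mult_algebra M.
        \<Phi> (op_mult M D\<^sub>1 (op_mult M T D\<^sub>2)) = op_mult M D\<^sub>1 (op_mult M (\<Phi> T) D\<^sub>2))"

definition wstar_continuous :: "'a measure \<Rightarrow> ('a oper \<Rightarrow> 'a oper) \<Rightarrow> bool" where
  "wstar_continuous M \<Phi> \<longleftrightarrow> continuous_map (wstar_topology M) (wstar_topology M) \<Phi>"

text \<open>Extended-real valued, so that a bound on \<open>map_norm M \<Phi>\<close> means that \<open>\<Phi>\<close> is bounded.\<close>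

definition map_norm :: "'a measure \<Rightarrow> ('a oper \<Rightarrow> 'a oper) \<Rightarrow> ereal" where
  "map_norm M \<Phi> = (SUP T\<in>{T\<in>BH M. op_norm M T \<le> 1}. ereal (op_norm M (\<Phi> T)))"

definition corner :: "'a measure \<Rightarrow> 'a set \<Rightarrow> 'a set \<Rightarrow> 'a oper set" where
  "corner M I J =
     (\<lambda>T. op_mult M (mult_op M (indicator I)) (op_mult M T (mult_op M (indicator J)))) ` BH M"


section \<open>The symbol of a bimodule map\<close>

definition marginally_null :: "'a measure \<Rightarrow> ('a \<times> 'a) set \<Rightarrow> bool" where
  "marginally_null M R \<longleftrightarrow> (\<exists>N\<in>null_sets M. R \<subseteq> N \<times> space M \<union> space M \<times> N)"

definition mae_class :: "'a measure \<Rightarrow> ('a \<times> 'a \<Rightarrow> complex) \<Rightarrow> ('a \<times> 'a \<Rightarrow> complex) set" where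
  "mae_class M \<psi> = {\<phi> \<in> borel_measurable (M \<Otimes>\<^sub>M M).
     marginally_null M {p \<in> space M \<times> space M. \<phi> p \<noteq> \<psi> p}}"

definition bounded_square_sums :: "'a measure \<Rightarrow> (nat \<Rightarrow> 'a \<Rightarrow> complex) \<Rightarrow> bool" where
  "bounded_square_sums M f \<longleftrightarrow> (\<forall>n. f n \<in> borel_measurable M) \<and>
     (\<forall>s\<in>space M. summable (\<lambda>n. (cmod (f n s))\<^sup>2)) \<and>
     (\<exists>C. \<forall>s\<in>space M. (\<Sum>n. (cmod (f n s))\<^sup>2) \<le> C)"

definition represents ::
  "'a measure \<Rightarrow> (nat \<Rightarrow> 'a \<Rightarrow> complex) \<Rightarrow> (nat \<Rightarrow> 'a \<Rightarrow> complex) \<Rightarrow> ('a oper \<Rightarrow> 'a oper) \<Rightarrow> bool"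
  where
  "represents M f g \<Phi> \<longleftrightarrow> bounded_square_sums M f \<and> bounded_square_sums M g \<and>
     (\<forall>T\<in>BH M. limitin (wstar_topology M)
        (op_sum M (\<lambda>n. op_mult M (mult_op M (f n)) (op_mult M T (mult_op M (g n)))))
        (\<Phi> T) sequentially)"

text \<open>All representations of a map yield the same class, so the union below is that class. It is
  empty if there is no representation.\<close>

definition symbol :: "'a measure \<Rightarrow> ('a oper \<Rightarrow> 'a oper) \<Rightarrow> ('a \<times> 'a \<Rightarrow> complex) set" where
  "symbol M \<Phi> = (\<Union>(f, g)\<in>{(f, g). represents M f g \<Phi>}.
     mae_class M (\<lambda>(s, t). \<Sum>n. f n s * g n t))"

end

theory Submission
  imports Defs
begin

text \<open>
  A bounded bimodule map multiplies the kernels of integral operators by a function \<open>\<phi>\<close> on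
  \<open>X \<times> X\<close>. Write \<open>T\<^sub>k\<close> for the integral operator with kernel \<open>k\<close>. The functional that sends
  \<open>k\<close> to \<open>\<langle>P (T\<^sub>k) 1, 1\<rangle>\<close> is bounded in the \<open>L\<^sup>2\<close>-norm of \<open>k\<close>, so by the Riesz theorem it is integration
  against some \<open>\<phi>\<close>, and the bimodule property extends this from the vector \<open>1\<close> to all bounded vectors
  (\<open>symbol_exists\<close>). Idempotence forces \<open>\<phi>\<^sup>2 = \<phi>\<close>, so \<open>\<phi>\<close> is almost everywhere the indicator of a set \<open>E\<close>
  (\<open>idempotent_symbol\<close>).

  The norm bound enters through two-by-two matrices: the Schur multiplier with entries \<open>1, 1, 1, 0\<close>
  has norm \<open>2 / sqrt 3\<close>, attained at a reflection. If \<open>E\<close> almost filled three of the four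
  rectangles formed by two disjoint sets of rows and two disjoint sets of columns and almost avoided
  the fourth, then the norm of \<open>P\<close> would be at least almost \<open>2 / sqrt 3\<close> (\<open>four_corner_estimate\<close>).
  Outside a null set of points \<open>s\<close>, the section \<open>E\<^sub>s\<close> is approximated in measure by the sections over a whole set of
  points of positive measure (\<open>essential_sections\<close>). Hence two such sections that overlap and differ,
  both in positive measure, would produce the excluded configuration. So any two sections agree or
  are disjoint up to null sets (\<open>section_dichotomy\<close>). Separability of the measure algebra leaves
  countably many classes of sections, and \<open>E\<close> is, up to a null set, a union of rectangles \<open>I m \<times> J m\<close>
  with disjoint \<open>I m\<close> and disjoint \<open>J m\<close> (\<open>rectangles_of_sections\<close>).

  Therefore \<open>P T = \<Sum>\<^sub>m \<chi>\<^bsub>I m\<^esub> T \<chi>\<^bsub>J m\<^esub>\<close> for integral operators \<open>T\<close>. Both sides are w*-continuous, and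
  integral operators are w*-dense, since an operator compressed to the functions that are constant on
  the cells of a finite partition has a step function as kernel (\<open>kernel_op_dense\<close>). So the formula
  holds for all \<open>T\<close> (\<open>block_formula\<close>). It contains the claims about range and norm. Taking the block
  diagonal does not increase the norm, by Cauchy-Schwarz. The partial sums lie in the span of the
  corners, which \<open>P\<close> fixes. The range is the set of fixed points of \<open>P\<close>; these carry \<open>\<chi>\<^bsub>J m\<^esub>\<close> on the right
  over to \<open>\<chi>\<^bsub>I m\<^esub>\<close> on the left, adjoints do the reverse, and so products \<open>m\<^sub>1 m\<^sub>2\<^sup>* m\<^sub>3\<close> stay in the range.

  The formula is also a representation of \<open>P\<close> by the indicators of the \<open>I m\<close> and \<open>J m\<close>, so it remains to
  see that all representations have the same symbol marginally almost everywhere. Two of them have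
  equal integrals over rectangles, and each is assembled from maps into the separable space \<open>\<ell>\<^sup>2\<close>.
  Hence a disagreement at a point outside a marginally null set would persist on a rectangle of
  positive measure (\<open>marginally_null_of_rectangle_integrals\<close>).

  Vectors are classes of functions, and all work with operators is done on the scalars \<open>\<langle>T f, g\<rangle>\<close> for
  functions \<open>f\<close> and \<open>g\<close>, where the choice of representatives is invisible.
\<close>

section \<open>Square-integrable functions\<close>

lemma sqintD:
  assumes "f \<in> square_integrable N"
  shows "f \<in> borel_measurable N" "integrable N (\<lambda>x. (cmod (f x))\<^sup>2)"
  using assms by (auto simp: square_integrable_def)

lemma sqint_mult_integrable:
  assumes f: "f \<in> square_integrable N" and g: "g \<in> square_integrable N"
  shows "integrable N (\<lambda>x. f x * g x)"
proof (rule Bochner_Integration.integrable_bound)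
  show "integrable N (\<lambda>x. (cmod (f x))\<^sup>2 + (cmod (g x))\<^sup>2)"
    using sqintD[OF f] sqintD[OF g] by auto
  show "(\<lambda>x. f x * g x) \<in> borel_measurable N"
    using sqintD(1)[OF f] sqintD(1)[OF g] by measurable
  have "cmod (f x * g x) \<le> (cmod (f x))\<^sup>2 + (cmod (g x))\<^sup>2" for x
  proof -
    have "2 * (cmod (f x) * cmod (g x)) \<le> (cmod (f x))\<^sup>2 + (cmod (g x))\<^sup>2"
      using sum_squares_bound[of "cmod (f x)" "cmod (g x)"] by (simp add: algebra_simps)
    moreover have "0 \<le> cmod (f x) * cmod (g x)" by simp
    ultimately show ?thesis unfolding norm_mult by linarith
  qed
  then show "AE x in N. cmod (f x * g x) \<le> norm ((cmod (f x))\<^sup>2 + (cmod (g x))\<^sup>2)"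
    by (simp add: order_trans[OF _ abs_ge_self])
qed

lemma borel_measurable_cnj [measurable (raw)]:
  "f \<in> borel_measurable N \<Longrightarrow> (\<lambda>x. cnj (f x)) \<in> borel_measurable N"
  by (rule borel_measurable_continuous_on[OF continuous_on_cnj[OF continuous_on_id]])

lemma sqint_cnj:
  assumes "f \<in> square_integrable N" shows "(\<lambda>x. cnj (f x)) \<in> square_integrable N"
  using assms by (auto simp: square_integrable_def)

lemma sqint_norm_mult:
  assumes "f \<in> square_integrable N" "g \<in> square_integrable N"
  shows "integrable N (\<lambda>x. cmod (f x) * cmod (g x))"
  using integrable_norm[OF sqint_mult_integrable[OF assms]] by (simp add: norm_mult)

lemma sqint_add:
  assumes f: "f \<in> square_integrable N" and g: "g \<in> square_integrable N"
  shows "(\<lambda>x. f x + g x) \<in> square_integrable N"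
proof -
  have "integrable N (\<lambda>x. (cmod (f x + g x))\<^sup>2)"
  proof (rule Bochner_Integration.integrable_bound)
    show "integrable N (\<lambda>x. 2 * ((cmod (f x))\<^sup>2 + (cmod (g x))\<^sup>2))"
      using sqintD[OF f] sqintD[OF g] by auto
    show "(\<lambda>x. (cmod (f x + g x))\<^sup>2) \<in> borel_measurable N"
      using sqintD(1)[OF f] sqintD(1)[OF g] by measurable
    have "(cmod (f x + g x))\<^sup>2 \<le> 2 * ((cmod (f x))\<^sup>2 + (cmod (g x))\<^sup>2)" for x
    proof -
      have "(cmod (f x + g x))\<^sup>2 \<le> (cmod (f x) + cmod (g x))\<^sup>2"
        by (intro power_mono norm_triangle_ineq) auto
      also have "\<dots> \<le> 2 * ((cmod (f x))\<^sup>2 + (cmod (g x))\<^sup>2)"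
        using sum_squares_bound[of "cmod (f x)" "cmod (g x)"] by (simp add: power2_sum)
      finally show ?thesis .
    qed
    then show "AE x in N. norm ((cmod (f x + g x))\<^sup>2) \<le> norm (2 * ((cmod (f x))\<^sup>2 + (cmod (g x))\<^sup>2))"
      by (simp add: order_trans[OF _ abs_ge_self])
  qed
  then show ?thesis using sqintD(1)[OF f] sqintD(1)[OF g]
    by (auto simp: square_integrable_def)
qed

lemma sqint_scale:
  assumes "f \<in> square_integrable N" shows "(\<lambda>x. c * f x) \<in> square_integrable N"
  using assms by (auto simp: square_integrable_def norm_mult power_mult_distrib)

lemma sqint_diff:
  assumes f: "f \<in> square_integrable N" and g: "g \<in> square_integrable N"
  shows "(\<lambda>x. f x - g x) \<in> square_integrable N"
  using sqint_add[OF f sqint_scale[OF g, of "-1"]] by simp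

lemma sqint_mult_bounded:
  assumes f: "f \<in> square_integrable N" and h: "h \<in> borel_measurable N"
    and b: "AE x in N. cmod (h x) \<le> C"
  shows "(\<lambda>x. h x * f x) \<in> square_integrable N"
proof -
  have "integrable N (\<lambda>x. (cmod (h x * f x))\<^sup>2)"
  proof (rule Bochner_Integration.integrable_bound)
    show "integrable N (\<lambda>x. C\<^sup>2 * (cmod (f x))\<^sup>2)"
      using sqintD[OF f] by auto
    show "(\<lambda>x. (cmod (h x * f x))\<^sup>2) \<in> borel_measurable N"
      using sqintD(1)[OF f] h by measurable
    show "AE x in N. norm ((cmod (h x * f x))\<^sup>2) \<le> norm (C\<^sup>2 * (cmod (f x))\<^sup>2)"
      using b by eventually_elim (auto simp: norm_mult power_mult_distrib intro!: mult_right_mono power_mono)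
  qed
  then show ?thesis using sqintD(1)[OF f] h by (auto simp: square_integrable_def)
qed

lemma sqint_indicator_mult:
  assumes f: "f \<in> square_integrable N" and A: "A \<in> sets N"
  shows "(\<lambda>x. indicator A x * f x) \<in> square_integrable N"
  by (rule sqint_mult_bounded[OF f, of _ 1]) (use A in \<open>auto simp: indicator_def\<close>)

lemma sqint_cong_AE:
  assumes "f \<in> square_integrable N" "g \<in> borel_measurable N" "AE x in N. g x = f x"
  shows "g \<in> square_integrable N"
proof -
  have "integrable N (\<lambda>x. (cmod (g x))\<^sup>2) \<longleftrightarrow> integrable N (\<lambda>x. (cmod (f x))\<^sup>2)"
    by (rule integrable_cong_AE) (use assms sqintD(1)[OF assms(1)] in auto)
  then show ?thesis using assms by (auto simp: square_integrable_def)
qed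

definition l2norm :: "'a measure \<Rightarrow> ('a \<Rightarrow> complex) \<Rightarrow> real" where
  "l2norm N f = sqrt (\<integral>x. (cmod (f x))\<^sup>2 \<partial>N)"

lemma l2norm_nonneg [simp]: "0 \<le> l2norm N f"
  by (simp add: l2norm_def)

lemma l2norm_power2: "(l2norm N f)\<^sup>2 = (\<integral>x. (cmod (f x))\<^sup>2 \<partial>N)"
  by (simp add: l2norm_def)

lemma l2norm_scale: "l2norm N (\<lambda>x. c * f x) = cmod c * l2norm N f"
  by (simp add: l2norm_def norm_mult power_mult_distrib real_sqrt_mult)

lemma l2norm_cnj [simp]: "l2norm N (\<lambda>x. cnj (f x)) = l2norm N f"
  by (simp add: l2norm_def)

lemma l2norm_cong_AE:
  assumes "f \<in> borel_measurable N" "g \<in> borel_measurable N" "AE x in N. f x = g x"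
  shows "l2norm N f = l2norm N g"
proof -
  have "(\<integral>x. (cmod (f x))\<^sup>2 \<partial>N) = (\<integral>x. (cmod (g x))\<^sup>2 \<partial>N)"
    by (rule integral_cong_AE) (use assms in auto)
  then show ?thesis by (simp add: l2norm_def)
qed

lemma l2norm_mono:
  assumes f: "f \<in> square_integrable N" and g: "g \<in> square_integrable N"
    and le: "AE x in N. cmod (f x) \<le> cmod (g x)"
  shows "l2norm N f \<le> l2norm N g"
  unfolding l2norm_def
  by (intro real_sqrt_le_mono integral_mono_AE sqintD f g) (use le in eventually_elim, simp add: power_mono)

lemma l2norm_eq_0:
  assumes "f \<in> square_integrable N" "l2norm N f = 0" shows "AE x in N. f x = 0"
proof -
  have "(\<integral>x. (cmod (f x))\<^sup>2 \<partial>N) = 0" using assms(2) by (simp add: l2norm_def)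
  then have "AE x in N. (cmod (f x))\<^sup>2 = 0"
    using integral_nonneg_eq_0_iff_AE[OF sqintD(2)[OF assms(1)]] by simp
  then show ?thesis by simp
qed

lemma cauchy_schwarz_norm:
  assumes f: "f \<in> square_integrable N" and g: "g \<in> square_integrable N"
  shows "(\<integral>x. cmod (f x) * cmod (g x) \<partial>N) \<le> l2norm N f * l2norm N g"
proof -
  define a b I where "a = (\<integral>x. (cmod (f x))\<^sup>2 \<partial>N)" and "b = (\<integral>x. (cmod (g x))\<^sup>2 \<partial>N)"
    and "I = (\<integral>x. cmod (f x) * cmod (g x) \<partial>N)"
  note intf = sqintD(2)[OF f] and intg = sqintD(2)[OF g]
  note intfg = sqint_norm_mult[OF f g]
  have quad: "0 \<le> t\<^sup>2 * a - 2 * t * I + b" for t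
  proof -
    have "0 \<le> (\<integral>x. (t * cmod (f x) - cmod (g x))\<^sup>2 \<partial>N)" by simp
    also have "\<dots> = (\<integral>x. t\<^sup>2 * (cmod (f x))\<^sup>2 - 2 * t * (cmod (f x) * cmod (g x)) + (cmod (g x))\<^sup>2 \<partial>N)"
      by (intro Bochner_Integration.integral_cong) (auto simp: power2_diff power_mult_distrib)
    also have "\<dots> = t\<^sup>2 * a - 2 * t * I + b"
      unfolding a_def b_def I_def using intf intg intfg by simp
    finally show ?thesis .
  qed
  have a0: "0 \<le> a" and b0: "0 \<le> b" by (auto simp: a_def b_def)
  have "I\<^sup>2 \<le> a * b"
  proof (cases "a = 0")
    case True
    then have "l2norm N f = 0" by (simp add: l2norm_def a_def)
    then have "AE x in N. f x = 0" by (rule l2norm_eq_0[OF f])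
    then have "I = 0" unfolding I_def by (intro integral_eq_zero_AE) auto
    then show ?thesis using a0 b0 by simp
  next
    case False
    then have "a > 0" using a0 by simp
    have "0 \<le> a * ((I / a)\<^sup>2 * a - 2 * (I / a) * I + b)" using quad[of "I / a"] \<open>a > 0\<close> by simp
    also have "\<dots> = a * b - I\<^sup>2" using \<open>a > 0\<close> by (simp add: field_simps power2_eq_square)
    finally show ?thesis by simp
  qed
  then have "I \<le> sqrt (a * b)" by (rule real_le_rsqrt)
  then show ?thesis by (simp add: I_def a_def b_def l2norm_def real_sqrt_mult)
qed

lemma cauchy_schwarz:
  assumes f: "f \<in> square_integrable N" and g: "g \<in> square_integrable N"
  shows "cmod (\<integral>x. f x * g x \<partial>N) \<le> l2norm N f * l2norm N g"
proof -
  have "cmod (\<integral>x. f x * g x \<partial>N) \<le> (\<integral>x. cmod (f x * g x) \<partial>N)"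
    by (rule integral_norm_bound)
  also have "\<dots> \<le> l2norm N f * l2norm N g"
    using cauchy_schwarz_norm[OF f g] by (simp add: norm_mult)
  finally show ?thesis .
qed

lemma cauchy_schwarz_cnj:
  assumes f: "f \<in> square_integrable N" and g: "g \<in> square_integrable N"
  shows "cmod (\<integral>x. f x * cnj (g x) \<partial>N) \<le> l2norm N f * l2norm N g"
  using cauchy_schwarz[OF f sqint_cnj[OF g]] by simp

lemma integral_self_cnj:
  "(\<integral>x. f x * cnj (f x) \<partial>N) = complex_of_real ((l2norm N f)\<^sup>2)"
proof -
  have "(\<integral>x. f x * cnj (f x) \<partial>N) = (\<integral>x. complex_of_real ((cmod (f x))\<^sup>2) \<partial>N)"
    by (intro Bochner_Integration.integral_cong refl) (rule complex_norm_square[symmetric])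
  also have "\<dots> = complex_of_real (\<integral>x. (cmod (f x))\<^sup>2 \<partial>N)"
    by (rule integral_complex_of_real)
  finally show ?thesis by (simp only: l2norm_power2)
qed

lemma l2norm_power2_cmod: "(l2norm N f)\<^sup>2 = cmod (\<integral>x. f x * cnj (f x) \<partial>N)"
  unfolding integral_self_cnj by (simp only: norm_of_real abs_power2 abs_of_nonneg[OF zero_le_power2])

lemma l2norm_le_of_power2_le:
  assumes "(l2norm N f)\<^sup>2 \<le> C * l2norm N f" and "0 \<le> C" shows "l2norm N f \<le> C"
  using assms by (cases "l2norm N f = 0") (auto simp: power2_eq_square mult_le_cancel_right less_le)

text \<open>Test the hypothesis with \<open>w = u - v\<close>.\<close>

lemma AE_eqI_inner:
  assumes u: "u \<in> square_integrable N" and v: "v \<in> square_integrable N"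
    and eq: "\<And>w. w \<in> square_integrable N \<Longrightarrow> (\<integral>x. u x * cnj (w x) \<partial>N) = (\<integral>x. v x * cnj (w x) \<partial>N)"
  shows "AE x in N. u x = v x"
proof -
  define d where "d = (\<lambda>x. u x - v x)"
  have d: "d \<in> square_integrable N" unfolding d_def by (rule sqint_diff[OF u v])
  have "complex_of_real ((l2norm N d)\<^sup>2) = (\<integral>x. u x * cnj (d x) - v x * cnj (d x) \<partial>N)"
    unfolding integral_self_cnj[symmetric]
    by (intro Bochner_Integration.integral_cong refl) (simp add: d_def algebra_simps)
  also have "\<dots> = 0"
    by (simp add: eq[OF d] sqint_mult_integrable[OF _ sqint_cnj[OF d]] u v)
  finally have "AE x in N. d x = 0" by (intro l2norm_eq_0[OF d]) simp
  then show ?thesis by (simp add: d_def)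
qed

lemma integral_indicator_cnj:
  "(\<integral>x. indicator A x * cnj (g x) \<partial>N) = cnj (\<integral>x. indicator A x * g x \<partial>N)"
proof -
  have "(\<integral>x. indicator A x * cnj (g x) \<partial>N) = (\<integral>x. cnj (indicator A x * g x) \<partial>N)"
    by (intro Bochner_Integration.integral_cong) (auto simp: indicator_def)
  then show ?thesis by (simp only: Bochner_Integration.integral_cnj)
qed

lemma l2norm_triangle:
  assumes f: "f \<in> square_integrable N" and g: "g \<in> square_integrable N"
  shows "l2norm N (\<lambda>x. f x + g x) \<le> l2norm N f + l2norm N g"
proof -
  note intf = sqintD(2)[OF f] and intg = sqintD(2)[OF g]
  note intfg = sqint_norm_mult[OF f g]
  have "(l2norm N (\<lambda>x. f x + g x))\<^sup>2 = (\<integral>x. (cmod (f x + g x))\<^sup>2 \<partial>N)"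
    by (rule l2norm_power2)
  also have "\<dots> \<le> (\<integral>x. (cmod (f x))\<^sup>2 + 2 * (cmod (f x) * cmod (g x)) + (cmod (g x))\<^sup>2 \<partial>N)"
  proof (intro integral_mono)
    show "integrable N (\<lambda>x. (cmod (f x + g x))\<^sup>2)"
      using sqintD(2)[OF sqint_add[OF f g]] .
    show "integrable N (\<lambda>x. (cmod (f x))\<^sup>2 + 2 * (cmod (f x) * cmod (g x)) + (cmod (g x))\<^sup>2)"
      using intf intg intfg by auto
    show "(cmod (f x + g x))\<^sup>2 \<le> (cmod (f x))\<^sup>2 + 2 * (cmod (f x) * cmod (g x)) + (cmod (g x))\<^sup>2" for x
      using power_mono[OF norm_triangle_ineq[of "f x" "g x"], of 2] by (simp add: power2_sum)
  qed
  also have "\<dots> = (l2norm N f)\<^sup>2 + 2 * (\<integral>x. cmod (f x) * cmod (g x) \<partial>N) + (l2norm N g)\<^sup>2"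
    unfolding l2norm_power2 using intf intg intfg by simp
  also have "\<dots> \<le> (l2norm N f + l2norm N g)\<^sup>2"
    using cauchy_schwarz_norm[OF f g] by (simp add: power2_sum)
  finally show ?thesis by (rule power2_le_imp_le) simp
qed

lemma l2norm_minus_commute: "l2norm N (\<lambda>x. f x - g x) = l2norm N (\<lambda>x. g x - f x)"
  by (simp add: l2norm_def norm_minus_commute)

definition bmeas :: "'a measure \<Rightarrow> ('a \<Rightarrow> complex) set" where
  "bmeas N = {f \<in> borel_measurable N. \<exists>C. \<forall>x\<in>space N. cmod (f x) \<le> C}"

lemma bmeasI:
  "f \<in> borel_measurable N \<Longrightarrow> (\<And>x. x \<in> space N \<Longrightarrow> cmod (f x) \<le> C) \<Longrightarrow> f \<in> bmeas N"
  by (auto simp: bmeas_def)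

lemma bmeasE:
  assumes "f \<in> bmeas N"
  obtains C where "f \<in> borel_measurable N" "0 \<le> C" "\<And>x. x \<in> space N \<Longrightarrow> cmod (f x) \<le> C"
proof -
  from assms obtain C where *: "f \<in> borel_measurable N" "\<forall>x\<in>space N. cmod (f x) \<le> C"
    by (auto simp: bmeas_def)
  show ?thesis by (rule that[of "max 0 C"]) (use * in \<open>auto simp: le_max_iff_disj\<close>)
qed

lemma bmeas_const: "(\<lambda>_. c) \<in> bmeas N"
  by (rule bmeasI[of _ _ "cmod c"]) auto

lemma bmeas_indicator: "A \<in> sets N \<Longrightarrow> indicator A \<in> bmeas N"
  by (rule bmeasI[of _ _ 1]) (auto simp: indicator_def)

lemma bmeas_cnj: "f \<in> bmeas N \<Longrightarrow> (\<lambda>x. cnj (f x)) \<in> bmeas N"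
  by (auto simp: bmeas_def)

lemma bmeas_mult:
  assumes "f \<in> bmeas N" "g \<in> bmeas N"
  shows "(\<lambda>x. f x * g x) \<in> bmeas N"
proof -
  from assms(1) obtain C where C: "f \<in> borel_measurable N" "0 \<le> C" "\<And>x. x \<in> space N \<Longrightarrow> cmod (f x) \<le> C"
    by (rule bmeasE) blast
  from assms(2) obtain D where D: "g \<in> borel_measurable N" "0 \<le> D" "\<And>x. x \<in> space N \<Longrightarrow> cmod (g x) \<le> D"
    by (rule bmeasE) blast
  show ?thesis
    by (rule bmeasI[of _ _ "C * D"]) (use C D in \<open>auto simp: norm_mult intro!: mult_mono\<close>)
qed

lemma bmeas_add:
  assumes "f \<in> bmeas N" "g \<in> bmeas N"
  shows "(\<lambda>x. f x + g x) \<in> bmeas N"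
proof -
  from assms(1) obtain C where C: "f \<in> borel_measurable N" "0 \<le> C" "\<And>x. x \<in> space N \<Longrightarrow> cmod (f x) \<le> C"
    by (rule bmeasE) blast
  from assms(2) obtain D where D: "g \<in> borel_measurable N" "0 \<le> D" "\<And>x. x \<in> space N \<Longrightarrow> cmod (g x) \<le> D"
    by (rule bmeasE) blast
  show ?thesis
    by (rule bmeasI[of _ _ "C + D"])
       (use C D in \<open>auto intro!: norm_triangle_le add_mono\<close>)
qed

lemma bmeas_scale: "f \<in> bmeas N \<Longrightarrow> (\<lambda>x. c * f x) \<in> bmeas N"
  by (intro bmeas_mult bmeas_const)

lemma bmeas_diff:
  assumes "f \<in> bmeas N" "g \<in> bmeas N"
  shows "(\<lambda>x. f x - g x) \<in> bmeas N"
  using bmeas_add[OF assms(1) bmeas_scale[OF assms(2), of "-1"]] by simp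

lemma bmeas_sum:
  assumes "\<And>i. i \<in> S \<Longrightarrow> f i \<in> bmeas N"
  shows "(\<lambda>x. \<Sum>i\<in>S. f i x) \<in> bmeas N"
  using assms
  by (induction S rule: infinite_finite_induct) (auto simp: bmeas_const intro: bmeas_add)

lemma (in finite_measure) bmeas_sqint:
  assumes "f \<in> bmeas M" shows "f \<in> square_integrable M"
proof -
  from assms obtain C where C: "f \<in> borel_measurable M" "0 \<le> C" "\<And>x. x \<in> space M \<Longrightarrow> cmod (f x) \<le> C"
    by (rule bmeasE) blast
  have "integrable M (\<lambda>x. (cmod (f x))\<^sup>2)"
    by (rule integrable_const_bound[of _ "C\<^sup>2"]) (use C in \<open>auto intro!: AE_I2 power_mono\<close>)
  then show ?thesis using C by (auto simp: square_integrable_def)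
qed

lemma (in finite_measure) bmeas_integrable:
  assumes "f \<in> bmeas M" shows "integrable M f"
proof -
  from assms obtain C where C: "f \<in> borel_measurable M" "0 \<le> C" "\<And>x. x \<in> space M \<Longrightarrow> cmod (f x) \<le> C"
    by (rule bmeasE) blast
  show ?thesis by (rule integrable_const_bound[of _ "C"]) (use C in \<open>auto intro!: AE_I2\<close>)
qed

lemma l2norm_indicator:
  assumes "A \<in> sets N" shows "l2norm N (indicator A) = sqrt (measure N A)"
proof -
  have "(\<integral>x. (cmod (indicator A x))\<^sup>2 \<partial>N) = (\<integral>x. indicator A x \<partial>N)"
    by (intro Bochner_Integration.integral_cong) (auto simp: indicator_def)
  then show ?thesis using assms by (simp add: l2norm_def sets.Int_space_eq2)
qed

definition truncate :: "('a \<Rightarrow> complex) \<Rightarrow> nat \<Rightarrow> 'a \<Rightarrow> complex" where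
  "truncate f n x = (if cmod (f x) \<le> real n then f x else 0)"

lemma truncate_measurable [measurable]:
  assumes [measurable]: "f \<in> borel_measurable N"
  shows "truncate f n \<in> borel_measurable N"
proof -
  have "(\<lambda>x. if cmod (f x) \<le> real n then f x else 0) \<in> borel_measurable N"
    by measurable
  then show ?thesis by (simp add: truncate_def[abs_def])
qed

lemma truncate_bounded: "f \<in> borel_measurable N \<Longrightarrow> truncate f n \<in> bmeas N"
  by (rule bmeasI[of _ _ "real n"]) (auto simp: truncate_def)

lemma truncate_le: "cmod (truncate f n x) \<le> cmod (f x)"
  by (auto simp: truncate_def)

lemma truncate_eventually: "\<forall>\<^sub>F n in sequentially. truncate f n x = f x"
  using eventually_ge_at_top[of "nat \<lceil>cmod (f x)\<rceil>"]
  by eventually_elim (auto simp: truncate_def nat_ceiling_le_eq)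

lemma l2norm_dominated:
  assumes f: "f \<in> square_integrable N" and h: "h \<in> square_integrable N"
    and g: "\<And>n. g n \<in> borel_measurable N"
    and bd: "\<And>n. AE x in N. cmod (g n x) \<le> cmod (h x)"
    and lim: "AE x in N. (\<lambda>n. g n x) \<longlonglongrightarrow> f x"
  shows "(\<lambda>n. l2norm N (\<lambda>x. g n x - f x)) \<longlonglongrightarrow> 0"
proof -
  note mf[measurable] = sqintD(1)[OF f]
  have mh [measurable]: "\<And>n. g n \<in> borel_measurable N" by (rule g)
  have "(\<lambda>n. \<integral>x. (cmod (g n x - f x))\<^sup>2 \<partial>N) \<longlonglongrightarrow> (\<integral>x. 0 \<partial>N)"
  proof (rule integral_dominated_convergence)
    show "integrable N (\<lambda>x. 2 * ((cmod (h x))\<^sup>2 + (cmod (f x))\<^sup>2))"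
      using sqintD(2)[OF f] sqintD(2)[OF h] by auto
    show "AE x in N. (\<lambda>n. (cmod (g n x - f x))\<^sup>2) \<longlonglongrightarrow> 0"
      using lim
    proof eventually_elim
      case (elim x)
      then have "(\<lambda>n. g n x - f x) \<longlonglongrightarrow> 0" by (simp add: LIM_zero)
      then have "(\<lambda>n. (cmod (g n x - f x))\<^sup>2) \<longlonglongrightarrow> (cmod 0)\<^sup>2"
        by (intro tendsto_power tendsto_norm)
      then show ?case by simp
    qed
    show "AE x in N. norm ((cmod (g n x - f x))\<^sup>2) \<le> 2 * ((cmod (h x))\<^sup>2 + (cmod (f x))\<^sup>2)" for n
      using bd[of n]
    proof eventually_elim
      case (elim x)
      have "(cmod (g n x - f x))\<^sup>2 \<le> (cmod (g n x) + cmod (f x))\<^sup>2"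
        by (intro power_mono norm_triangle_ineq4) auto
      also have "\<dots> \<le> (cmod (h x) + cmod (f x))\<^sup>2" using elim by (intro power_mono) auto
      also have "\<dots> \<le> 2 * ((cmod (h x))\<^sup>2 + (cmod (f x))\<^sup>2)"
        using sum_squares_bound[of "cmod (h x)" "cmod (f x)"] by (simp add: power2_sum)
      finally show ?case by simp
    qed
  qed auto
  then have "(\<lambda>n. sqrt (\<integral>x. (cmod (g n x - f x))\<^sup>2 \<partial>N)) \<longlonglongrightarrow> sqrt 0"
    by (intro tendsto_real_sqrt) simp
  then show ?thesis by (simp add: l2norm_def)
qed

lemma truncate_l2_tendsto:
  assumes f: "f \<in> square_integrable N"
  shows "(\<lambda>n. l2norm N (\<lambda>x. truncate f n x - f x)) \<longlonglongrightarrow> 0"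
proof (rule l2norm_dominated[OF f f])
  show "truncate f n \<in> borel_measurable N" for n
    using sqintD(1)[OF f] by measurable
  show "AE x in N. cmod (truncate f n x) \<le> cmod (f x)" for n by (simp add: truncate_le)
  show "AE x in N. (\<lambda>n. truncate f n x) \<longlonglongrightarrow> f x"
    by (intro AE_I2 tendsto_eventually truncate_eventually)
qed

lemma truncate_sqint:
  assumes f: "f \<in> square_integrable N" shows "truncate f n \<in> square_integrable N"
proof -
  have "(\<lambda>x. indicator {x \<in> space N. cmod (f x) \<le> real n} x * f x) \<in> square_integrable N"
    using sqintD(1)[OF f] by (intro sqint_indicator_mult f) measurable
  moreover have "truncate f n \<in> borel_measurable N" using sqintD(1)[OF f] by measurable
  ultimately show ?thesis
    by (rule sqint_cong_AE) (auto intro!: AE_I2 simp: truncate_def)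
qed

section \<open>Vectors and operators through representing functions\<close>

lemma ae_class_eqI:
  assumes "AE x in M. f x = g x" shows "ae_class M f = ae_class M g"
proof -
  have "(AE x in M. h x = f x) \<longleftrightarrow> (AE x in M. h x = g x)" for h
    using assms by (auto elim!: AE_mp)
  then show ?thesis by (simp add: ae_class_def)
qed

lemma ae_class_self: "f \<in> borel_measurable M \<Longrightarrow> f \<in> ae_class M f"
  by (simp add: ae_class_def)

lemma ae_class_eqD:
  assumes "f \<in> borel_measurable M" "ae_class M f = ae_class M g" shows "AE x in M. f x = g x"
proof -
  have "f \<in> ae_class M g" using ae_class_self[OF assms(1)] unfolding assms(2) .
  then show ?thesis by (simp add: ae_class_def)
qed

lemma rep_ae_class:
  assumes "f \<in> borel_measurable M"
  shows "rep (ae_class M f) \<in> borel_measurable M" "AE x in M. rep (ae_class M f) x = f x"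
proof -
  have "rep (ae_class M f) \<in> ae_class M f"
    unfolding rep_def by (rule someI[of "\<lambda>g. g \<in> ae_class M f", OF ae_class_self[OF assms]])
  then show "rep (ae_class M f) \<in> borel_measurable M" "AE x in M. rep (ae_class M f) x = f x"
    by (auto simp: ae_class_def)
qed

lemma ae_class_L2: "f \<in> square_integrable M \<Longrightarrow> ae_class M f \<in> L2 M"
  by (simp add: L2_def)

lemma L2_E:
  assumes "\<xi> \<in> L2 M" obtains f where "f \<in> square_integrable M" "\<xi> = ae_class M f"
  using assms by (auto simp: L2_def)

lemma rep_L2:
  assumes "\<xi> \<in> L2 M" shows "rep \<xi> \<in> square_integrable M" "ae_class M (rep \<xi>) = \<xi>"
proof -
  obtain f where f: "f \<in> square_integrable M" "\<xi> = ae_class M f" using assms by (rule L2_E)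
  note r = rep_ae_class[OF sqintD(1)[OF f(1)]]
  show "rep \<xi> \<in> square_integrable M"
    unfolding f(2) by (rule sqint_cong_AE[OF f(1) r])
  show "ae_class M (rep \<xi>) = \<xi>"
    unfolding f(2) by (rule ae_class_eqI[OF r(2)])
qed

lemma vec_add_class:
  assumes "f \<in> square_integrable M" "g \<in> square_integrable M"
  shows "vec_add M (ae_class M f) (ae_class M g) = ae_class M (\<lambda>x. f x + g x)"
  unfolding vec_add_def
proof (rule ae_class_eqI)
  show "AE x in M. rep (ae_class M f) x + rep (ae_class M g) x = f x + g x"
    using rep_ae_class(2)[OF sqintD(1)[OF assms(1)]]
      rep_ae_class(2)[OF sqintD(1)[OF assms(2)]]
    by eventually_elim simp
qed

lemma vec_scale_class:
  assumes "f \<in> square_integrable M"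
  shows "vec_scale M c (ae_class M f) = ae_class M (\<lambda>x. c * f x)"
  unfolding vec_scale_def
proof (rule ae_class_eqI)
  show "AE x in M. c * rep (ae_class M f) x = c * f x"
    using rep_ae_class(2)[OF sqintD(1)[OF assms]] by eventually_elim simp
qed

lemma vec_inner_class:
  assumes f: "f \<in> square_integrable M" and g: "g \<in> square_integrable M"
  shows "vec_inner M (ae_class M f) (ae_class M g) = (\<integral>x. f x * cnj (g x) \<partial>M)"
  unfolding vec_inner_def
proof (rule integral_cong_AE)
  note mf [measurable] = sqintD(1)[OF f] rep_ae_class(1)[OF sqintD(1)[OF f]]
  note mg [measurable] = sqintD(1)[OF g] rep_ae_class(1)[OF sqintD(1)[OF g]]
  show "(\<lambda>x. rep (ae_class M f) x * cnj (rep (ae_class M g) x)) \<in> borel_measurable M"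
    "(\<lambda>x. f x * cnj (g x)) \<in> borel_measurable M" by measurable
  show "AE x in M. rep (ae_class M f) x * cnj (rep (ae_class M g) x) = f x * cnj (g x)"
    using rep_ae_class(2)[OF mf(1)] rep_ae_class(2)[OF mg(1)] by eventually_elim simp
qed

lemma vec_norm_class:
  assumes f: "f \<in> square_integrable M"
  shows "vec_norm M (ae_class M f) = l2norm M f"
proof -
  note mf = sqintD(1)[OF f]
  have "vec_norm M (ae_class M f) = l2norm M (rep (ae_class M f))"
    by (simp add: vec_norm_def l2norm_def)
  also have "\<dots> = l2norm M f" by (rule l2norm_cong_AE[OF rep_ae_class(1)[OF mf] mf rep_ae_class(2)[OF mf]])
  finally show ?thesis .
qed

lemma zero_sqint: "(\<lambda>_. 0) \<in> square_integrable M"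
  by (simp add: square_integrable_def)

text \<open>A representative of the vector \<open>T f\<close>; it is determined only up to a null set.\<close>

definition op_fun :: "'a measure \<Rightarrow> 'a oper \<Rightarrow> ('a \<Rightarrow> complex) \<Rightarrow> 'a \<Rightarrow> complex" where
  "op_fun M T f = rep (T (ae_class M f))"

definition form :: "'a measure \<Rightarrow> 'a oper \<Rightarrow> ('a \<Rightarrow> complex) \<Rightarrow> ('a \<Rightarrow> complex) \<Rightarrow> complex" where
  "form M T f g = vec_inner M (T (ae_class M f)) (ae_class M g)"

lemma BH_funcset: "T \<in> BH M \<Longrightarrow> T \<in> L2 M \<rightarrow>\<^sub>E L2 M"
  by (simp add: BH_def)

lemma BH_L2: "T \<in> BH M \<Longrightarrow> \<xi> \<in> L2 M \<Longrightarrow> T \<xi> \<in> L2 M"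
  using BH_funcset by blast

lemma op_fun_sqint:
  "T \<in> BH M \<Longrightarrow> f \<in> square_integrable M \<Longrightarrow> op_fun M T f \<in> square_integrable M"
  unfolding op_fun_def by (rule rep_L2(1)[OF BH_L2[OF _ ae_class_L2]])

lemma ae_class_op_fun:
  "T \<in> BH M \<Longrightarrow> f \<in> square_integrable M \<Longrightarrow> ae_class M (op_fun M T f) = T (ae_class M f)"
  unfolding op_fun_def by (rule rep_L2(2)[OF BH_L2[OF _ ae_class_L2]])

lemma op_fun_AE_eq:
  assumes "T \<in> BH M" "f \<in> square_integrable M" "T (ae_class M f) = ae_class M h"
  shows "AE x in M. op_fun M T f x = h x"
  using assms ae_class_op_fun[OF assms(1,2)] op_fun_sqint[OF assms(1,2)]
  by (intro ae_class_eqD sqintD) auto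

lemma form_op_fun:
  assumes "T \<in> BH M" "f \<in> square_integrable M" "g \<in> square_integrable M"
  shows "form M T f g = (\<integral>x. op_fun M T f x * cnj (g x) \<partial>M)"
  unfolding form_def ae_class_op_fun[OF assms(1,2), symmetric]
  by (rule vec_inner_class[OF op_fun_sqint[OF assms(1,2)] assms(3)])

lemma form_class:
  assumes "T (ae_class M f) = ae_class M h" "h \<in> square_integrable M" "g \<in> square_integrable M"
  shows "form M T f g = (\<integral>x. h x * cnj (g x) \<partial>M)"
  unfolding form_def assms(1) by (rule vec_inner_class[OF assms(2,3)])

lemma BH_add:
  assumes "T \<in> BH M" "f \<in> square_integrable M" "g \<in> square_integrable M"
  shows "T (ae_class M (\<lambda>x. f x + g x)) = ae_class M (\<lambda>x. op_fun M T f x + op_fun M T g x)"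
proof -
  have "T (vec_add M (ae_class M f) (ae_class M g)) = vec_add M (T (ae_class M f)) (T (ae_class M g))"
    using assms by (auto simp: BH_def ae_class_L2)
  then show ?thesis
    by (simp add: vec_add_class[OF assms(2,3)] flip: ae_class_op_fun[OF assms(1,2)] ae_class_op_fun[OF assms(1,3)])
       (simp add: vec_add_class op_fun_sqint assms)
qed

lemma BH_scale:
  assumes "T \<in> BH M" "f \<in> square_integrable M"
  shows "T (ae_class M (\<lambda>x. c * f x)) = ae_class M (\<lambda>x. c * op_fun M T f x)"
proof -
  have "T (vec_scale M c (ae_class M f)) = vec_scale M c (T (ae_class M f))"
    using assms by (auto simp: BH_def ae_class_L2)
  then show ?thesis
    by (simp add: vec_scale_class[OF assms(2)] flip: ae_class_op_fun[OF assms(1,2)])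
       (simp add: vec_scale_class op_fun_sqint assms)
qed

lemma form_add_left:
  assumes "T \<in> BH M" "f \<in> square_integrable M" "g \<in> square_integrable M" "h \<in> square_integrable M"
  shows "form M T (\<lambda>x. f x + g x) h = form M T f h + form M T g h"
proof -
  note sf = op_fun_sqint[OF assms(1,2)] and sg = op_fun_sqint[OF assms(1,3)]
  have "form M T (\<lambda>x. f x + g x) h = (\<integral>x. op_fun M T f x * cnj (h x) + op_fun M T g x * cnj (h x) \<partial>M)"
    using form_class[where T = T, OF BH_add[OF assms(1-3)] sqint_add[OF sf sg] assms(4)]
    by (simp add: distrib_right)
  then show ?thesis
    by (simp add: form_op_fun assms sqint_mult_integrable[OF sf sqint_cnj]
        sqint_mult_integrable[OF sg sqint_cnj])
qed

lemma form_scale_left: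
  assumes "T \<in> BH M" "f \<in> square_integrable M" "h \<in> square_integrable M"
  shows "form M T (\<lambda>x. c * f x) h = c * form M T f h"
proof -
  note sf = op_fun_sqint[OF assms(1,2)]
  have "form M T (\<lambda>x. c * f x) h = (\<integral>x. c * (op_fun M T f x * cnj (h x)) \<partial>M)"
    using form_class[where T = T, OF BH_scale[OF assms(1,2)] sqint_scale[OF sf] assms(3)]
    by (simp add: mult.assoc)
  then show ?thesis
    by (simp add: form_op_fun assms)
qed

lemma form_add_right:
  assumes "T \<in> BH M" "f \<in> square_integrable M" "g \<in> square_integrable M" "h \<in> square_integrable M"
  shows "form M T h (\<lambda>x. f x + g x) = form M T h f + form M T h g"
proof -
  note sh = op_fun_sqint[OF assms(1,4)]
  show ?thesis
    by (simp add: form_op_fun sqint_add assms distrib_left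
        sqint_mult_integrable[OF sh sqint_cnj])
qed

lemma form_scale_right:
  assumes "T \<in> BH M" "f \<in> square_integrable M" "h \<in> square_integrable M"
  shows "form M T h (\<lambda>x. c * f x) = cnj c * form M T h f"
  by (simp add: form_op_fun sqint_scale assms mult.left_commute)

lemma form_diff_left:
  assumes "T \<in> BH M" "f \<in> square_integrable M" "g \<in> square_integrable M" "h \<in> square_integrable M"
  shows "form M T (\<lambda>x. f x - g x) h = form M T f h - form M T g h"
  using form_add_left[OF assms(1,2) sqint_scale[OF assms(3), of "-1"] assms(4)]
    form_scale_left[OF assms(1,3,4), of "-1"] by simp

lemma form_diff_right:
  assumes "T \<in> BH M" "f \<in> square_integrable M" "g \<in> square_integrable M" "h \<in> square_integrable M"
  shows "form M T h (\<lambda>x. f x - g x) = form M T h f - form M T h g"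
  using form_add_right[OF assms(1,2) sqint_scale[OF assms(3), of "-1"] assms(4)]
    form_scale_right[OF assms(1,3,4), of "-1"] by simp

lemma form_cong_AE:
  assumes "AE x in M. f x = f' x" "AE x in M. g x = g' x"
  shows "form M T f g = form M T f' g'"
  unfolding form_def ae_class_eqI[OF assms(1)] ae_class_eqI[OF assms(2)] ..

lemma op_norm_bdd_above:
  assumes "T \<in> BH M"
  shows "bdd_above ((\<lambda>\<xi>. vec_norm M (T \<xi>)) ` {\<xi> \<in> L2 M. vec_norm M \<xi> \<le> 1})"
proof -
  obtain C where C: "\<forall>\<xi>\<in>L2 M. vec_norm M (T \<xi>) \<le> C * vec_norm M \<xi>" using assms by (auto simp: BH_def)
  have "vec_norm M (T \<xi>) \<le> \<bar>C\<bar>" if "\<xi> \<in> L2 M" "vec_norm M \<xi> \<le> 1" for \<xi>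
  proof -
    have "0 \<le> vec_norm M \<xi>" by (simp add: vec_norm_def)
    have "vec_norm M (T \<xi>) \<le> C * vec_norm M \<xi>" using C that(1) by blast
    also have "\<dots> \<le> \<bar>C\<bar> * 1" using that \<open>0 \<le> vec_norm M \<xi>\<close> by (intro mult_mono) auto
    finally show ?thesis by simp
  qed
  then show ?thesis by (auto intro!: bdd_aboveI2)
qed

lemma op_norm_nonneg: assumes "T \<in> BH M" shows "0 \<le> op_norm M T"
proof -
  have "vec_norm M (T (ae_class M (\<lambda>_. 0))) \<le> op_norm M T"
    unfolding op_norm_def
    by (rule cSUP_upper[OF _ op_norm_bdd_above[OF assms]])
       (auto simp: ae_class_L2 zero_sqint vec_norm_class l2norm_def)
  moreover have "0 \<le> vec_norm M \<xi>" for \<xi> :: "'a vec_class" by (simp add: vec_norm_def)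
  ultimately show ?thesis using order_trans by blast
qed

lemma op_fun_norm_le:
  assumes T: "T \<in> BH M" and f: "f \<in> square_integrable M"
  shows "l2norm M (op_fun M T f) \<le> op_norm M T * l2norm M f"
proof (cases "l2norm M f = 0")
  case True
  obtain C where C: "\<forall>\<xi>\<in>L2 M. vec_norm M (T \<xi>) \<le> C * vec_norm M \<xi>" using T by (auto simp: BH_def)
  have "vec_norm M (T (ae_class M f)) \<le> C * l2norm M f"
    using C f by (metis ae_class_L2 vec_norm_class)
  then show ?thesis using True f T
    by (metis ae_class_op_fun mult_zero_right op_fun_sqint vec_norm_class)
next
  case False
  define t where "t = l2norm M f"
  have t: "t > 0" using False by (simp add: t_def less_le)
  define g where "g = (\<lambda>x. complex_of_real (1 / t) * f x)"
  have g: "g \<in> square_integrable M" unfolding g_def by (rule sqint_scale[OF f])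
  have "l2norm M g = cmod (complex_of_real (1 / t)) * t"
    unfolding g_def t_def by (rule l2norm_scale)
  also have "\<dots> = 1" using t by (simp add: norm_divide)
  finally have "vec_norm M (T (ae_class M g)) \<le> op_norm M T"
    unfolding op_norm_def
    by (intro cSUP_upper[OF _ op_norm_bdd_above[OF T]]) (auto simp: ae_class_L2 g vec_norm_class)
  moreover have "vec_norm M (T (ae_class M g)) = l2norm M (op_fun M T f) / t"
  proof -
    have "vec_norm M (T (ae_class M g)) = cmod (complex_of_real (1 / t)) * l2norm M (op_fun M T f)"
      unfolding g_def BH_scale[OF T f] vec_norm_class[OF sqint_scale[OF op_fun_sqint[OF T f]]]
      by (rule l2norm_scale)
    then show ?thesis using t by (simp add: norm_divide)
  qed
  ultimately show ?thesis using t by (simp add: field_simps t_def)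
qed

lemma form_bound:
  assumes T: "T \<in> BH M" and f: "f \<in> square_integrable M" and g: "g \<in> square_integrable M"
  shows "cmod (form M T f g) \<le> op_norm M T * l2norm M f * l2norm M g"
proof -
  have "cmod (form M T f g) \<le> l2norm M (op_fun M T f) * l2norm M g"
    unfolding form_op_fun[OF assms]
    by (rule cauchy_schwarz_cnj[OF op_fun_sqint[OF T f] g])
  also have "\<dots> \<le> op_norm M T * l2norm M f * l2norm M g"
    using op_fun_norm_le[OF T f] by (intro mult_right_mono) auto
  finally show ?thesis .
qed

lemma op_norm_leI:
  assumes T: "T \<in> BH M" and C: "0 \<le> C"
    and bd: "\<And>f g. f \<in> square_integrable M \<Longrightarrow> g \<in> square_integrable M \<Longrightarrow>
       cmod (form M T f g) \<le> C * l2norm M f * l2norm M g"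
  shows "op_norm M T \<le> C"
  unfolding op_norm_def
proof (rule cSUP_least)
  have "ae_class M (\<lambda>_. 0) \<in> {\<xi> \<in> L2 M. vec_norm M \<xi> \<le> 1}"
    by (simp add: ae_class_L2 zero_sqint vec_norm_class l2norm_def)
  then show "{\<xi> \<in> L2 M. vec_norm M \<xi> \<le> 1} \<noteq> {}" by blast
  fix \<xi> assume xi: "\<xi> \<in> {\<xi> \<in> L2 M. vec_norm M \<xi> \<le> 1}"
  then obtain f where f: "f \<in> square_integrable M" "\<xi> = ae_class M f" by (auto elim: L2_E)
  then have l1: "l2norm M f \<le> 1" using xi by (simp add: vec_norm_class)
  define h where "h = op_fun M T f"
  have h: "h \<in> square_integrable M" unfolding h_def by (rule op_fun_sqint[OF T f(1)])
  have "(l2norm M h)\<^sup>2 = cmod (form M T f h)"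
    by (subst form_op_fun[OF T f(1) h]) (simp only: h_def l2norm_power2_cmod)
  also have "\<dots> \<le> C * l2norm M f * l2norm M h" by (rule bd[OF f(1) h])
  also have "\<dots> \<le> C * 1 * l2norm M h" using C l1 by (intro mult_mono) auto
  finally have "l2norm M h \<le> C" using C by (intro l2norm_le_of_power2_le) simp_all
  then show "vec_norm M (T \<xi>) \<le> C"
    unfolding f(2) ae_class_op_fun[OF T f(1), symmetric] vec_norm_class[OF h[unfolded h_def]] h_def .
qed

lemma form_tendsto:
  assumes T: "T \<in> BH M" and f: "f \<in> square_integrable M" and g: "g \<in> square_integrable M"
    and fn: "\<And>n. fn n \<in> square_integrable M" and gn: "\<And>n. gn n \<in> square_integrable M"
    and lf: "(\<lambda>n. l2norm M (\<lambda>x. fn n x - f x)) \<longlonglongrightarrow> 0"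
    and lg: "(\<lambda>n. l2norm M (\<lambda>x. gn n x - g x)) \<longlonglongrightarrow> 0"
  shows "(\<lambda>n. form M T (fn n) (gn n)) \<longlonglongrightarrow> form M T f g"
proof -
  define a b where "a = (\<lambda>n. l2norm M (\<lambda>x. fn n x - f x))" and "b = (\<lambda>n. l2norm M (\<lambda>x. gn n x - g x))"
  have la: "a \<longlonglongrightarrow> 0" unfolding a_def by (rule lf)
  have lb: "b \<longlonglongrightarrow> 0" unfolding b_def by (rule lg)
  have df: "\<And>n. (\<lambda>x. fn n x - f x) \<in> square_integrable M"
    and dg: "\<And>n. (\<lambda>x. gn n x - g x) \<in> square_integrable M"
    by (auto intro!: sqint_diff assms)
  have dec: "form M T (fn n) (gn n) - form M T f g
      = form M T (\<lambda>x. fn n x - f x) g + form M T f (\<lambda>x. gn n x - g x)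
        + form M T (\<lambda>x. fn n x - f x) (\<lambda>x. gn n x - g x)" for n
    by (simp add: form_diff_left form_diff_right T f g fn gn df dg)
  have "cmod (form M T (fn n) (gn n) - form M T f g)
      \<le> op_norm M T * a n * l2norm M g + op_norm M T * l2norm M f * b n + op_norm M T * a n * b n" for n
    unfolding a_def b_def dec
    using form_bound[OF T df[of n] g] form_bound[OF T f dg[of n]] form_bound[OF T df[of n] dg[of n]]
      norm_triangle_ineq[of "form M T (\<lambda>x. fn n x - f x) g + form M T f (\<lambda>x. gn n x - g x)"
        "form M T (\<lambda>x. fn n x - f x) (\<lambda>x. gn n x - g x)"]
      norm_triangle_ineq[of "form M T (\<lambda>x. fn n x - f x) g" "form M T f (\<lambda>x. gn n x - g x)"]
    by linarith
  then have bd: "\<forall>n. cmod (form M T (fn n) (gn n) - form M T f g)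
      \<le> op_norm M T * a n * l2norm M g + op_norm M T * l2norm M f * b n + op_norm M T * a n * b n"
    by blast
  have "(\<lambda>n. op_norm M T * a n * l2norm M g + op_norm M T * l2norm M f * b n + op_norm M T * a n * b n)
      \<longlonglongrightarrow> op_norm M T * 0 * l2norm M g + op_norm M T * l2norm M f * 0 + op_norm M T * 0 * 0"
    by (intro tendsto_add tendsto_mult tendsto_const la lb)
  then have "(\<lambda>n. op_norm M T * a n * l2norm M g + op_norm M T * l2norm M f * b n + op_norm M T * a n * b n) \<longlonglongrightarrow> 0"
    by simp
  then have "(\<lambda>n. form M T (fn n) (gn n) - form M T f g) \<longlonglongrightarrow> 0"
    by (rule Lim_null_comparison[OF always_eventually[OF bd]])
  then show ?thesis by (simp add: LIM_zero_iff)
qed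

lemma op_eqI:
  assumes S: "S \<in> BH M" and T: "T \<in> BH M"
    and eq: "\<And>f g. f \<in> square_integrable M \<Longrightarrow> g \<in> square_integrable M \<Longrightarrow> form M S f g = form M T f g"
  shows "S = T"
proof -
  have "S \<xi> = T \<xi>" if xi: "\<xi> \<in> L2 M" for \<xi>
  proof -
    obtain f where f: "f \<in> square_integrable M" "\<xi> = ae_class M f" using xi by (rule L2_E)
    have "AE x in M. op_fun M S f x = op_fun M T f x"
      by (rule AE_eqI_inner)
        (simp_all add: op_fun_sqint S T f(1) eq flip: form_op_fun)
    then have "ae_class M (op_fun M S f) = ae_class M (op_fun M T f)" by (rule ae_class_eqI)
    then show ?thesis by (simp add: ae_class_op_fun S T f)
  qed
  then show ?thesis using BH_funcset[OF S] BH_funcset[OF T] by (metis PiE_ext)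
qed

text \<open>Truncations are dense in \<open>L\<^sup>2\<close>, and forms are jointly continuous there.\<close>

lemma op_eqI_bounded:
  assumes S: "S \<in> BH M" and T: "T \<in> BH M"
    and eq: "\<And>f g. f \<in> bmeas M \<Longrightarrow> g \<in> bmeas M \<Longrightarrow> form M S f g = form M T f g"
  shows "S = T"
proof (rule op_eqI[OF S T])
  fix f g assume f: "f \<in> square_integrable M" and g: "g \<in> square_integrable M"
  note tr = truncate_sqint[OF f] truncate_sqint[OF g]
    truncate_l2_tendsto[OF f] truncate_l2_tendsto[OF g]
  have "(\<lambda>n. form M S (truncate f n) (truncate g n)) \<longlonglongrightarrow> form M S f g"
    by (intro form_tendsto S f g tr)
  moreover have "(\<lambda>n. form M T (truncate f n) (truncate g n)) \<longlonglongrightarrow> form M T f g"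
    by (intro form_tendsto T f g tr)
  ultimately show "form M S f g = form M T f g"
    using eq[OF truncate_bounded[OF sqintD(1)[OF f]] truncate_bounded[OF sqintD(1)[OF g]]]
    by (simp add: LIMSEQ_unique)
qed

text \<open>Sums, multiplication operators, integral operators and adjoints are all given by formulas on
  functions; this is the passage from such a formula to an operator on classes.\<close>

lemma operator_of_function_map:
  assumes F: "\<And>f. f \<in> square_integrable M \<Longrightarrow> F f \<in> square_integrable M"
    and cong: "\<And>f g. f \<in> square_integrable M \<Longrightarrow> g \<in> square_integrable M \<Longrightarrow> AE x in M. f x = g x \<Longrightarrow>
      AE x in M. F f x = F g x"
    and add: "\<And>f g. f \<in> square_integrable M \<Longrightarrow> g \<in> square_integrable M \<Longrightarrow>
      AE x in M. F (\<lambda>x. f x + g x) x = F f x + F g x"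
    and scale: "\<And>c f. f \<in> square_integrable M \<Longrightarrow> AE x in M. F (\<lambda>x. c * f x) x = c * F f x"
    and bd: "\<And>f. f \<in> square_integrable M \<Longrightarrow> l2norm M (F f) \<le> C * l2norm M f"
  defines "T \<equiv> (\<lambda>\<xi>\<in>L2 M. ae_class M (F (rep \<xi>)))"
  shows "T \<in> BH M" "\<And>f. f \<in> square_integrable M \<Longrightarrow> T (ae_class M f) = ae_class M (F f)"
proof -
  show app: "T (ae_class M f) = ae_class M (F f)" if f: "f \<in> square_integrable M" for f
  proof -
    note L = ae_class_L2[OF f]
    have "AE x in M. F (rep (ae_class M f)) x = F f x"
      by (rule cong[OF rep_L2(1)[OF L] f rep_ae_class(2)[OF sqintD(1)[OF f]]])
    then show ?thesis unfolding T_def using L by (simp add: ae_class_eqI)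
  qed
  show "T \<in> BH M"
    unfolding BH_def
  proof (intro CollectI conjI ballI allI)
    show "T \<in> L2 M \<rightarrow>\<^sub>E L2 M" by (auto simp: T_def intro!: ae_class_L2 F rep_L2)
    show "T (vec_add M \<xi> \<eta>) = vec_add M (T \<xi>) (T \<eta>)" if "\<xi> \<in> L2 M" "\<eta> \<in> L2 M" for \<xi> \<eta>
    proof -
      obtain f where f: "f \<in> square_integrable M" "\<xi> = ae_class M f" using L2_E[OF \<open>\<xi> \<in> L2 M\<close>] by blast
      obtain g where g: "g \<in> square_integrable M" "\<eta> = ae_class M g" using L2_E[OF \<open>\<eta> \<in> L2 M\<close>] by blast
      show ?thesis unfolding f(2) g(2)
        by (simp add: vec_add_class app f(1) g(1) sqint_add F ae_class_eqI[OF add])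
    qed
    show "T (vec_scale M c \<xi>) = vec_scale M c (T \<xi>)" if "\<xi> \<in> L2 M" for c \<xi>
    proof -
      obtain f where f: "f \<in> square_integrable M" "\<xi> = ae_class M f" using L2_E[OF \<open>\<xi> \<in> L2 M\<close>] by blast
      show ?thesis unfolding f(2)
        by (simp add: vec_scale_class app f(1) sqint_scale F ae_class_eqI[OF scale])
    qed
    show "\<exists>C. \<forall>\<xi>\<in>L2 M. vec_norm M (T \<xi>) \<le> C * vec_norm M \<xi>"
    proof (intro exI ballI)
      fix \<xi> assume "\<xi> \<in> L2 M"
      then obtain f where f: "f \<in> square_integrable M" "\<xi> = ae_class M f" by (rule L2_E)
      show "vec_norm M (T \<xi>) \<le> C * vec_norm M \<xi>" unfolding f(2)
        by (simp add: vec_norm_class app f(1) F bd)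
    qed
  qed
qed

lemma op_zero_BH: "op_zero M \<in> BH M"
  and op_zero_class: "f \<in> square_integrable M \<Longrightarrow> op_zero M (ae_class M f) = ae_class M (\<lambda>_. 0)"
  using operator_of_function_map[of M "\<lambda>_ _. 0" 0]
  by (simp_all add: op_zero_def zero_sqint l2norm_def)

lemma form_op_zero:
  "f \<in> square_integrable M \<Longrightarrow> g \<in> square_integrable M \<Longrightarrow> form M (op_zero M) f g = 0"
  by (simp add: form_class[where T = "op_zero M", OF op_zero_class] zero_sqint)

lemma op_add_class:
  assumes "S \<in> BH M" "T \<in> BH M" "f \<in> square_integrable M"
  shows "op_add M S T (ae_class M f) = ae_class M (\<lambda>x. op_fun M S f x + op_fun M T f x)"
  using vec_add_class[OF op_fun_sqint[OF assms(1,3)] op_fun_sqint[OF assms(2,3)]]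
  by (simp add: op_add_def ae_class_L2 assms ae_class_op_fun)

lemma op_scale_class:
  assumes "T \<in> BH M" "f \<in> square_integrable M"
  shows "op_scale M c T (ae_class M f) = ae_class M (\<lambda>x. c * op_fun M T f x)"
  using vec_scale_class[OF op_fun_sqint[OF assms(1,2)]]
  by (simp add: op_scale_def ae_class_L2 assms ae_class_op_fun)

lemma op_fun_cong:
  assumes "AE x in M. f x = g x" shows "op_fun M T f = op_fun M T g"
  unfolding op_fun_def ae_class_eqI[OF assms] ..

lemma op_add_BH:
  assumes S: "S \<in> BH M" and T: "T \<in> BH M" shows "op_add M S T \<in> BH M"
proof -
  have eq: "op_add M S T = (\<lambda>\<xi>\<in>L2 M. ae_class M ((\<lambda>f x. op_fun M S f x + op_fun M T f x) (rep \<xi>)))"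
  proof (unfold op_add_def, rule restrict_ext)
    fix \<xi> assume xi: "\<xi> \<in> L2 M"
    show "vec_add M (S \<xi>) (T \<xi>) = ae_class M (\<lambda>x. op_fun M S (rep \<xi>) x + op_fun M T (rep \<xi>) x)"
      unfolding op_fun_def rep_L2(2)[OF xi] vec_add_def ..
  qed
  show ?thesis
    unfolding eq
  proof (rule operator_of_function_map[where C = "op_norm M S + op_norm M T"])
    fix f assume f: "f \<in> square_integrable M"
    note sf = op_fun_sqint[OF S f] op_fun_sqint[OF T f]
    show "(\<lambda>x. op_fun M S f x + op_fun M T f x) \<in> square_integrable M" by (intro sqint_add sf)
    show "l2norm M (\<lambda>x. op_fun M S f x + op_fun M T f x) \<le> (op_norm M S + op_norm M T) * l2norm M f"
      using l2norm_triangle[OF sf] op_fun_norm_le[OF S f] op_fun_norm_le[OF T f]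
      by (simp add: distrib_right)
    show "AE x in M. op_fun M S (\<lambda>x. c * f x) x + op_fun M T (\<lambda>x. c * f x) x
        = c * (op_fun M S f x + op_fun M T f x)" for c
      using op_fun_AE_eq[OF S sqint_scale[OF f] BH_scale[OF S f], of c]
        op_fun_AE_eq[OF T sqint_scale[OF f] BH_scale[OF T f], of c]
      by eventually_elim (simp add: distrib_left)
    fix g assume g: "g \<in> square_integrable M"
    show "AE x in M. op_fun M S (\<lambda>x. f x + g x) x + op_fun M T (\<lambda>x. f x + g x) x =
        op_fun M S f x + op_fun M T f x + (op_fun M S g x + op_fun M T g x)"
      using op_fun_AE_eq[OF S sqint_add[OF f g] BH_add[OF S f g]]
        op_fun_AE_eq[OF T sqint_add[OF f g] BH_add[OF T f g]]
      by eventually_elim simp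
    assume "AE x in M. f x = g x"
    then show "AE x in M. op_fun M S f x + op_fun M T f x = op_fun M S g x + op_fun M T g x"
      by (simp add: op_fun_cong)
  qed
qed

lemma op_scale_BH:
  assumes T: "T \<in> BH M" shows "op_scale M c T \<in> BH M"
proof -
  have eq: "op_scale M c T = (\<lambda>\<xi>\<in>L2 M. ae_class M ((\<lambda>f x. c * op_fun M T f x) (rep \<xi>)))"
  proof (unfold op_scale_def, rule restrict_ext)
    fix \<xi> assume xi: "\<xi> \<in> L2 M"
    show "vec_scale M c (T \<xi>) = ae_class M (\<lambda>x. c * op_fun M T (rep \<xi>) x)"
      unfolding op_fun_def rep_L2(2)[OF xi] vec_scale_def ..
  qed
  show ?thesis
    unfolding eq
  proof (rule operator_of_function_map[where C = "cmod c * op_norm M T"])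
    fix f assume f: "f \<in> square_integrable M"
    note sf = op_fun_sqint[OF T f]
    show "(\<lambda>x. c * op_fun M T f x) \<in> square_integrable M" by (intro sqint_scale sf)
    show "l2norm M (\<lambda>x. c * op_fun M T f x) \<le> (cmod c * op_norm M T) * l2norm M f"
      using op_fun_norm_le[OF T f] by (simp add: l2norm_scale mult.assoc mult_left_mono)
    show "AE x in M. c * op_fun M T (\<lambda>x. d * f x) x = d * (c * op_fun M T f x)" for d
      using op_fun_AE_eq[OF T sqint_scale[OF f] BH_scale[OF T f], of d]
      by eventually_elim simp
    fix g assume g: "g \<in> square_integrable M"
    show "AE x in M. c * op_fun M T (\<lambda>x. f x + g x) x = c * op_fun M T f x + c * op_fun M T g x"
      using op_fun_AE_eq[OF T sqint_add[OF f g] BH_add[OF T f g]]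
      by eventually_elim (simp add: distrib_left)
    assume "AE x in M. f x = g x"
    then show "AE x in M. c * op_fun M T f x = c * op_fun M T g x"
      by (simp add: op_fun_cong)
  qed
qed

lemma op_mult_class:
  assumes "T \<in> BH M" "f \<in> square_integrable M"
  shows "op_mult M S T (ae_class M f) = S (ae_class M (op_fun M T f))"
  using assms by (simp add: op_mult_def compose_def ae_class_L2 ae_class_op_fun)

lemma op_mult_BH:
  assumes S: "S \<in> BH M" and T: "T \<in> BH M" shows "op_mult M S T \<in> BH M"
  unfolding BH_def
proof (intro CollectI conjI ballI allI)
  obtain C where C: "\<forall>\<xi>\<in>L2 M. vec_norm M (S \<xi>) \<le> C * vec_norm M \<xi>" using S by (auto simp: BH_def)
  obtain D where D: "\<forall>\<xi>\<in>L2 M. vec_norm M (T \<xi>) \<le> D * vec_norm M \<xi>" using T by (auto simp: BH_def)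
  have ap: "\<xi> \<in> L2 M \<Longrightarrow> op_mult M S T \<xi> = S (T \<xi>)" for \<xi> by (simp add: op_mult_def compose_def)
  show "op_mult M S T \<in> L2 M \<rightarrow>\<^sub>E L2 M"
    using BH_L2[OF S] BH_L2[OF T] by (auto simp: op_mult_def compose_def)
  have va: "vec_add M \<xi> \<eta> \<in> L2 M" "vec_scale M c \<xi> \<in> L2 M" if "\<xi> \<in> L2 M" "\<eta> \<in> L2 M" for \<xi> \<eta> c
    using that by (auto elim!: L2_E simp: vec_add_class vec_scale_class intro!: ae_class_L2
        sqint_add sqint_scale)
  show "op_mult M S T (vec_add M \<xi> \<eta>) = vec_add M (op_mult M S T \<xi>) (op_mult M S T \<eta>)"
    if "\<xi> \<in> L2 M" "\<eta> \<in> L2 M" for \<xi> \<eta>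
    using that S T BH_L2[OF T that(1)] BH_L2[OF T that(2)] by (simp add: ap va BH_def)
  show "op_mult M S T (vec_scale M c \<xi>) = vec_scale M c (op_mult M S T \<xi>)" if "\<xi> \<in> L2 M" for c \<xi>
    using that S T BH_L2[OF T that] by (simp add: ap va[OF that that] BH_def)
  show "\<exists>C. \<forall>\<xi>\<in>L2 M. vec_norm M (op_mult M S T \<xi>) \<le> C * vec_norm M \<xi>"
  proof (intro exI[of _ "\<bar>C\<bar> * D"] ballI)
    fix \<xi> assume xi: "\<xi> \<in> L2 M"
    have "vec_norm M (S (T \<xi>)) \<le> C * vec_norm M (T \<xi>)" using C BH_L2[OF T xi] by blast
    also have "\<dots> \<le> \<bar>C\<bar> * vec_norm M (T \<xi>)" by (intro mult_right_mono) (auto simp: vec_norm_def)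
    also have "\<dots> \<le> \<bar>C\<bar> * (D * vec_norm M \<xi>)" using D xi by (intro mult_left_mono) auto
    finally show "vec_norm M (op_mult M S T \<xi>) \<le> \<bar>C\<bar> * D * vec_norm M \<xi>" by (simp add: ap xi mult.assoc)
  qed
qed

lemma form_op_add:
  assumes "S \<in> BH M" "T \<in> BH M" "f \<in> square_integrable M" "g \<in> square_integrable M"
  shows "form M (op_add M S T) f g = form M S f g + form M T f g"
proof -
  note s = op_fun_sqint[OF assms(1,3)] op_fun_sqint[OF assms(2,3)]
  show ?thesis
    by (simp add: form_class[where T = "op_add M S T", OF op_add_class[OF assms(1-3)] sqint_add[OF s] assms(4)]
        form_op_fun assms distrib_right sqint_mult_integrable[OF _ sqint_cnj] s)
qed

lemma form_op_scale:
  assumes "T \<in> BH M" "f \<in> square_integrable M" "g \<in> square_integrable M"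
  shows "form M (op_scale M c T) f g = c * form M T f g"
proof -
  note s = op_fun_sqint[OF assms(1,2)]
  show ?thesis
    by (simp add: form_class[where T = "op_scale M c T", OF op_scale_class[OF assms(1,2)] sqint_scale[OF s] assms(3)]
        form_op_fun assms mult.assoc)
qed

lemma form_op_mult:
  assumes "T \<in> BH M" "f \<in> square_integrable M"
  shows "form M (op_mult M S T) f g = form M S (op_fun M T f) g"
  by (simp add: form_def op_mult_class assms)

lemma op_scale_0:
  assumes T: "T \<in> BH M" shows "op_scale M 0 T = op_zero M"
  by (rule op_eqI[OF op_scale_BH[OF T] op_zero_BH]) (simp add: form_op_scale form_op_zero T)

lemma op_sum_BH: "(\<And>i. S i \<in> BH M) \<Longrightarrow> op_sum M S n \<in> BH M"
  by (induction n) (auto intro: op_zero_BH op_add_BH)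

lemma form_op_sum:
  assumes "\<And>i. S i \<in> BH M" "f \<in> square_integrable M" "g \<in> square_integrable M"
  shows "form M (op_sum M S n) f g = (\<Sum>i<n. form M (S i) f g)"
  by (induction n) (simp_all add: form_op_zero form_op_add op_sum_BH assms)

lemma mult_op_BH: "h \<in> Linfty M \<Longrightarrow> mult_op M h \<in> BH M"
  and mult_op_class: "h \<in> Linfty M \<Longrightarrow> f \<in> square_integrable M \<Longrightarrow>
    mult_op M h (ae_class M f) = ae_class M (\<lambda>x. h x * f x)"
proof -
  assume h: "h \<in> Linfty M"
  then obtain C where C: "h \<in> borel_measurable M" "AE x in M. cmod (h x) \<le> C" by (auto simp: Linfty_def)
  have bd: "l2norm M (\<lambda>x. h x * f x) \<le> \<bar>C\<bar> * l2norm M f" if f: "f \<in> square_integrable M" for f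
  proof -
    have "l2norm M (\<lambda>x. h x * f x) \<le> l2norm M (\<lambda>x. complex_of_real \<bar>C\<bar> * f x)"
    proof (intro l2norm_mono sqint_scale f sqint_mult_bounded[OF f C])
      show "AE x in M. cmod (h x * f x) \<le> cmod (complex_of_real \<bar>C\<bar> * f x)"
        using C(2) by eventually_elim (auto simp: norm_mult intro!: mult_right_mono)
    qed
    then show ?thesis by (simp add: l2norm_scale)
  qed
  have sqi: "(\<lambda>x. h x * f x) \<in> square_integrable M" if "f \<in> square_integrable M" for f
    by (rule sqint_mult_bounded[OF that C])
  have cong: "AE x in M. h x * f x = h x * g x" if "AE x in M. f x = g x" for f g
    using that by eventually_elim simp
  note * = operator_of_function_map[of M "\<lambda>f x. h x * f x", OF sqi cong _ _ bd, folded mult_op_def]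
  show "mult_op M h \<in> BH M"
    by (rule *(1)) (auto simp: algebra_simps)
  show "mult_op M h (ae_class M f) = ae_class M (\<lambda>x. h x * f x)" if "f \<in> square_integrable M"
    by (rule *(2)[OF _ _ _ _ _ that]) (auto simp: algebra_simps)
qed

lemma Linfty_mult_sqint:
  assumes "h \<in> Linfty M" "f \<in> square_integrable M" shows "(\<lambda>x. h x * f x) \<in> square_integrable M"
  using assms by (auto simp: Linfty_def intro: sqint_mult_bounded)

lemma Linfty_cnj: "h \<in> Linfty M \<Longrightarrow> (\<lambda>x. cnj (h x)) \<in> Linfty M"
  by (auto simp: Linfty_def)

lemma bmeas_Linfty: "h \<in> bmeas M \<Longrightarrow> h \<in> Linfty M"
  by (auto simp: Linfty_def bmeas_def intro!: AE_I2)

lemma form_mult_op_right: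
  assumes "T \<in> BH M" "h \<in> Linfty M" "f \<in> square_integrable M"
  shows "form M (op_mult M T (mult_op M h)) f g = form M T (\<lambda>x. h x * f x) g"
  unfolding form_def
  using assms mult_op_class[OF assms(2,3)]
  by (simp add: op_mult_def compose_def ae_class_L2)

lemma form_mult_op_left:
  assumes "T \<in> BH M" "h \<in> Linfty M" "f \<in> square_integrable M" "g \<in> square_integrable M"
  shows "form M (op_mult M (mult_op M h) T) f g = form M T f (\<lambda>x. cnj (h x) * g x)"
proof -
  note s = op_fun_sqint[OF assms(1,3)]
  have "op_mult M (mult_op M h) T (ae_class M f) = ae_class M (\<lambda>x. h x * op_fun M T f x)"
    by (simp add: op_mult_class assms mult_op_class s)
  then show ?thesis
    by (simp add: form_class[where T = "op_mult M (mult_op M h) T", OF _ Linfty_mult_sqint[OF assms(2) s] assms(4)] form_op_fun assms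
        Linfty_mult_sqint Linfty_cnj mult.assoc mult.left_commute)
qed

lemma form_mult_op_both:
  assumes "T \<in> BH M" "h \<in> Linfty M" "k \<in> Linfty M" "f \<in> square_integrable M" "g \<in> square_integrable M"
  shows "form M (op_mult M (mult_op M h) (op_mult M T (mult_op M k))) f g
    = form M T (\<lambda>x. k x * f x) (\<lambda>x. cnj (h x) * g x)"
  using assms
  by (simp add: form_mult_op_left form_mult_op_right op_mult_BH mult_op_BH)

section \<open>The w*-topology through sesquilinear forms\<close>

lemma normal_functionalI:
  assumes f: "\<And>n. f n \<in> square_integrable M" and g: "\<And>n. g n \<in> square_integrable M"
    and "summable (\<lambda>n. (l2norm M (f n))\<^sup>2)" and "summable (\<lambda>n. (l2norm M (g n))\<^sup>2)"
  shows "(\<lambda>T. \<Sum>n. form M T (f n) (g n)) \<in> normal_functionals M"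
  unfolding normal_functionals_def form_def
  using assms
  by (intro CollectI exI[of _ "\<lambda>n. ae_class M (f n)"] exI[of _ "\<lambda>n. ae_class M (g n)"])
     (auto simp: ae_class_L2 vec_norm_class)

lemma normal_functionalE:
  assumes "\<omega> \<in> normal_functionals M"
  obtains f g where "\<And>n. f n \<in> square_integrable M" "\<And>n. g n \<in> square_integrable M"
    "summable (\<lambda>n. (l2norm M (f n))\<^sup>2)" "summable (\<lambda>n. (l2norm M (g n))\<^sup>2)"
    "\<omega> = (\<lambda>T. \<Sum>n. form M T (f n) (g n))"
proof -
  obtain \<xi> \<eta> where *: "\<omega> = (\<lambda>T. \<Sum>n. vec_inner M (T (\<xi> n)) (\<eta> n))" "range \<xi> \<subseteq> L2 M" "range \<eta> \<subseteq> L2 M"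
    "summable (\<lambda>n. (vec_norm M (\<xi> n))\<^sup>2)" "summable (\<lambda>n. (vec_norm M (\<eta> n))\<^sup>2)"
    using assms unfolding normal_functionals_def by blast
  have xi: "rep (\<xi> n) \<in> square_integrable M" "ae_class M (rep (\<xi> n)) = \<xi> n" for n
    using *(2) rep_L2[of "\<xi> n"] by blast+
  have eta: "rep (\<eta> n) \<in> square_integrable M" "ae_class M (rep (\<eta> n)) = \<eta> n" for n
    using *(3) rep_L2[of "\<eta> n"] by blast+
  have n1: "vec_norm M (\<xi> n) = l2norm M (rep (\<xi> n))" for n by (simp add: vec_norm_def l2norm_def)
  have n2: "vec_norm M (\<eta> n) = l2norm M (rep (\<eta> n))" for n by (simp add: vec_norm_def l2norm_def)
  show ?thesis
  proof (rule that)
    show "rep (\<xi> n) \<in> square_integrable M" "rep (\<eta> n) \<in> square_integrable M" for n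
      by (rule xi eta)+
    show "summable (\<lambda>n. (l2norm M (rep (\<xi> n)))\<^sup>2)" "summable (\<lambda>n. (l2norm M (rep (\<eta> n)))\<^sup>2)"
      using *(4,5) by (simp_all add: n1 n2)
    show "\<omega> = (\<lambda>T. \<Sum>n. form M T (rep (\<xi> n)) (rep (\<eta> n)))"
      by (simp add: *(1) form_def xi eta)
  qed
qed

lemma summable_mult_of_squares:
  fixes a b :: "nat \<Rightarrow> real"
  assumes "summable (\<lambda>n. (a n)\<^sup>2)" "summable (\<lambda>n. (b n)\<^sup>2)"
  shows "summable (\<lambda>n. a n * b n)"
proof (rule summable_comparison_test'[of "\<lambda>n. (a n)\<^sup>2 + (b n)\<^sup>2" 0])
  show "summable (\<lambda>n. (a n)\<^sup>2 + (b n)\<^sup>2)" by (rule summable_add[OF assms])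
  have "2 * \<bar>a n * b n\<bar> \<le> (a n)\<^sup>2 + (b n)\<^sup>2" for n
    using sum_squares_bound[of "\<bar>a n\<bar>" "\<bar>b n\<bar>"] by (simp add: abs_mult)
  then show "norm (a n * b n) \<le> (a n)\<^sup>2 + (b n)\<^sup>2" for n
    unfolding real_norm_def by (smt (verit, best) abs_ge_zero)
qed

lemma form_norm_le_of_bound:
  assumes T: "T \<in> BH M" and K: "op_norm M T \<le> K" and f: "f \<in> square_integrable M" and g: "g \<in> square_integrable M"
  shows "cmod (form M T f g) \<le> K * (l2norm M f * l2norm M g)"
proof -
  have "cmod (form M T f g) \<le> op_norm M T * (l2norm M f * l2norm M g)"
    using form_bound[OF T f g] by (simp add: mult.assoc)
  also have "\<dots> \<le> K * (l2norm M f * l2norm M g)" using K by (intro mult_right_mono) auto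
  finally show ?thesis .
qed

lemma normal_functional_single:
  assumes f: "f \<in> square_integrable M" and g: "g \<in> square_integrable M"
  obtains \<omega> where "\<omega> \<in> normal_functionals M" "\<And>T. T \<in> BH M \<Longrightarrow> \<omega> T = form M T f g"
proof
  define F where "F = (\<lambda>n. if n = (0::nat) then f else (\<lambda>_. 0))"
  define G where "G = (\<lambda>n. if n = (0::nat) then g else (\<lambda>_. 0))"
  have z: "l2norm M (\<lambda>_. 0) = 0" by (simp add: l2norm_def)
  have sF: "summable (\<lambda>n. (l2norm M (F n))\<^sup>2)" and sG: "summable (\<lambda>n. (l2norm M (G n))\<^sup>2)"
    by (rule summable_finite[of "{0}"]; simp add: F_def G_def z)+
  show "(\<lambda>T. \<Sum>n. form M T (F n) (G n)) \<in> normal_functionals M"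
    by (rule normal_functionalI[OF _ _ sF sG]) (auto simp: F_def G_def f g zero_sqint)
  fix T assume T: "T \<in> BH M"
  have "form M T (\<lambda>_. 0) (\<lambda>_. 0) = 0"
    using form_bound[OF T zero_sqint zero_sqint] by (simp add: z)
  then have "(\<Sum>n. form M T (F n) (G n)) = (\<Sum>n\<in>{0}. form M T (F n) (G n))"
    by (intro suminf_finite) (auto simp: F_def G_def)
  then show "(\<Sum>n. form M T (F n) (G n)) = form M T f g" by (simp add: F_def G_def)
qed

lemma topspace_wstar: "topspace (wstar_topology M) = BH M"
proof -
  obtain \<omega> where \<omega>: "\<omega> \<in> normal_functionals M"
    using normal_functional_single[OF zero_sqint zero_sqint] by metis
  have "BH M = {T \<in> BH M. \<omega> T \<in> UNIV}" by simp
  then have "BH M \<in> {{T \<in> BH M. \<omega> T \<in> U} |\<omega> U. \<omega> \<in> normal_functionals M \<and> open U}"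
    using \<omega> open_UNIV by blast
  then show ?thesis
    unfolding wstar_topology_def topology_generated_by_topspace by blast
qed

lemma continuous_map_normal_functional:
  assumes "\<omega> \<in> normal_functionals M"
  shows "continuous_map (wstar_topology M) euclidean \<omega>"
proof -
  have "openin (wstar_topology M) {T \<in> BH M. \<omega> T \<in> U}" if "open U" for U
    unfolding wstar_topology_def by (rule topology_generated_by_Basis) (use that assms in blast)
  then show ?thesis by (simp add: continuous_map_def topspace_wstar)
qed

lemma limitin_wstar_normal_functional:
  assumes "limitin (wstar_topology M) S T F" "\<omega> \<in> normal_functionals M"
  shows "((\<lambda>n. \<omega> (S n)) \<longlongrightarrow> \<omega> T) F"
  using continuous_map_limit[OF continuous_map_normal_functional[OF assms(2)] assms(1)] by (simp add: o_def)

lemma limitin_wstar_form: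
  assumes lim: "limitin (wstar_topology M) S T sequentially" and S: "\<And>n. S n \<in> BH M"
    and f: "f \<in> square_integrable M" and g: "g \<in> square_integrable M"
  shows "(\<lambda>n. form M (S n) f g) \<longlonglongrightarrow> form M T f g"
proof -
  have T: "T \<in> BH M" using lim by (auto simp: limitin_def topspace_wstar)
  obtain \<omega> where \<omega>: "\<omega> \<in> normal_functionals M" "\<And>T. T \<in> BH M \<Longrightarrow> \<omega> T = form M T f g"
    using normal_functional_single[OF f g] by metis
  show ?thesis using limitin_wstar_normal_functional[OF lim \<omega>(1)] by (simp add: \<omega>(2) S T)
qed

lemma limitin_wstarI:
  assumes S: "\<And>n. S n \<in> BH M" and T: "T \<in> BH M"
    and lim: "\<And>\<omega>. \<omega> \<in> normal_functionals M \<Longrightarrow> (\<lambda>n. \<omega> (S n)) \<longlonglongrightarrow> \<omega> T"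
  shows "limitin (wstar_topology M) S T sequentially"
  unfolding limitin_def
proof (intro conjI allI impI)
  show "T \<in> topspace (wstar_topology M)" by (simp add: topspace_wstar T)
  fix U assume U: "openin (wstar_topology M) U \<and> T \<in> U"
  then have "generate_topology_on {{T \<in> BH M. \<omega> T \<in> U} |\<omega> U. \<omega> \<in> normal_functionals M \<and> open U} U"
    unfolding wstar_topology_def by (simp add: openin_topology_generated_by)
  then have "T \<in> U \<longrightarrow> (\<forall>\<^sub>F n in sequentially. S n \<in> U)"
  proof induction
    case Empty
    show ?case by simp
  next
    case (Int a b)
    then show ?case by (auto intro: eventually_conj)
  next
    case (UN K)
    show ?case
    proof
      assume "T \<in> \<Union>K"
      then obtain k where k: "k \<in> K" "T \<in> k" by blast
      then have "\<forall>\<^sub>F n in sequentially. S n \<in> k" using UN by blast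
      then show "\<forall>\<^sub>F n in sequentially. S n \<in> \<Union>K" by eventually_elim (use k in blast)
    qed
  next
    case (Basis s)
    then obtain \<omega> V where s: "s = {T \<in> BH M. \<omega> T \<in> V}" "\<omega> \<in> normal_functionals M" "open V" by blast
    show ?case
    proof
      assume "T \<in> s"
      then have "\<omega> T \<in> V" using s by simp
      then have "\<forall>\<^sub>F n in sequentially. \<omega> (S n) \<in> V"
        using topological_tendstoD[OF lim[OF s(2)] s(3)] by blast
      then show "\<forall>\<^sub>F n in sequentially. S n \<in> s" by eventually_elim (simp add: s S)
    qed
  qed
  then show "\<forall>\<^sub>F n in sequentially. S n \<in> U" using U by blast
qed

text \<open>On norm-bounded sequences the w*-topology is the weak operator topology: the series that
  defines a normal functional is then dominated uniformly along the sequence.\<close>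

lemma limitin_wstar_of_bounded:
  assumes S: "\<And>n. S n \<in> BH M" and T: "T \<in> BH M" and K: "\<And>n. op_norm M (S n) \<le> K"
    and lim: "\<And>f g. f \<in> square_integrable M \<Longrightarrow> g \<in> square_integrable M \<Longrightarrow>
      (\<lambda>n. form M (S n) f g) \<longlonglongrightarrow> form M T f g"
  shows "limitin (wstar_topology M) S T sequentially"
proof (rule limitin_wstarI[OF S T])
  fix \<omega> assume "\<omega> \<in> normal_functionals M"
  then obtain f g where f: "\<And>n. f n \<in> square_integrable M" and g: "\<And>n. g n \<in> square_integrable M"
    and sf: "summable (\<lambda>n. (l2norm M (f n))\<^sup>2)" and sg: "summable (\<lambda>n. (l2norm M (g n))\<^sup>2)"
    and om: "\<omega> = (\<lambda>T. \<Sum>n. form M T (f n) (g n))"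
    by (rule normal_functionalE) blast
  have "eventually (\<lambda>n. summable (\<lambda>k. norm (form M (S n) (f k) (g k)))) sequentially \<and>
    summable (\<lambda>k. norm (form M T (f k) (g k))) \<and>
    (\<lambda>n. \<Sum>k. form M (S n) (f k) (g k)) \<longlonglongrightarrow> (\<Sum>k. form M T (f k) (g k))"
  proof (rule tannerys_theorem[where M = "\<lambda>k. K * (l2norm M (f k) * l2norm M (g k))"])
    show "(\<lambda>n. form M (S n) (f k) (g k)) \<longlonglongrightarrow> form M T (f k) (g k)" for k
      by (rule lim[OF f g])
    show "\<forall>\<^sub>F (k, n) in sequentially \<times>\<^sub>F sequentially.
       norm (form M (S n) (f k) (g k)) \<le> K * (l2norm M (f k) * l2norm M (g k))"
      by (intro always_eventually) (auto intro: form_norm_le_of_bound[OF S K f g])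
    show "summable (\<lambda>k. K * (l2norm M (f k) * l2norm M (g k)))"
      by (intro summable_mult summable_mult_of_squares sf sg)
  qed simp
  then show "(\<lambda>n. \<omega> (S n)) \<longlonglongrightarrow> \<omega> T" by (simp add: om)
qed

section \<open>The Riesz representation theorem for square-integrable functions\<close>

context finite_measure
begin

text \<open>The bound by the square root of the measure makes \<open>\<kappa>\<close> continuous at the empty set, hence
  countably additive, and absolutely continuous, so that the Radon-Nikodym theorem applies.\<close>

lemma density_of_positive_set_function:
  assumes add: "\<And>A B. A \<in> sets M \<Longrightarrow> B \<in> sets M \<Longrightarrow> A \<inter> B = {} \<Longrightarrow> \<kappa> (A \<union> B) = \<kappa> A + \<kappa> B"
    and nn: "\<And>A. A \<in> sets M \<Longrightarrow> 0 \<le> \<kappa> A"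
    and bd: "\<And>A. A \<in> sets M \<Longrightarrow> \<kappa> A \<le> C * sqrt (measure M A)"
  obtains h :: "'a \<Rightarrow> real" where "integrable M h" "\<And>A. A \<in> sets M \<Longrightarrow> \<kappa> A = (\<integral>x. indicator A x * h x \<partial>M)"
proof -
  have k0: "\<kappa> {} = 0" using add[of "{}" "{}"] by simp
  define N where "N = measure_of (space M) (sets M) (\<lambda>A. ennreal (\<kappa> A))"
  have spN: "space N = space M" and seN: "sets N = sets M" by (simp_all add: N_def)
  have pos: "positive (sets M) (\<lambda>A. ennreal (\<kappa> A))" by (simp add: positive_def k0)
  have ca: "countably_additive (sets M) (\<lambda>A. ennreal (\<kappa> A))"
  proof (rule sets.empty_continuous_imp_countably_additive[OF pos])
    show "additive (sets M) (\<lambda>A. ennreal (\<kappa> A))"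
      by (auto simp: additive_def add nn simp flip: ennreal_plus)
    show "\<forall>A\<in>sets M. ennreal (\<kappa> A) \<noteq> \<infinity>" by simp
    fix A :: "nat \<Rightarrow> 'a set" assume A: "range A \<subseteq> sets M" "decseq A" "(\<Inter>i. A i) = {}"
    have "(\<lambda>i. measure M (A i)) \<longlonglongrightarrow> measure M (\<Inter>i. A i)"
      by (rule finite_Lim_measure_decseq[OF A(1,2)])
    then have "(\<lambda>i. C * sqrt (measure M (A i))) \<longlonglongrightarrow> C * sqrt 0"
      unfolding A(3) by (intro tendsto_mult tendsto_const tendsto_real_sqrt) simp
    then have *: "(\<lambda>i. C * sqrt (measure M (A i))) \<longlonglongrightarrow> 0" by simp
    have "(\<lambda>i. \<kappa> (A i)) \<longlonglongrightarrow> 0"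
      by (rule tendsto_sandwich[OF always_eventually always_eventually tendsto_const *])
         (use A(1) nn bd in blast)+
    then show "(\<lambda>i. ennreal (\<kappa> (A i))) \<longlonglongrightarrow> 0"
      using tendsto_ennrealI by fastforce
  qed
  have emN: "emeasure N A = ennreal (\<kappa> A)" if "A \<in> sets M" for A
    unfolding N_def by (rule emeasure_measure_of_sigma[OF sets.sigma_algebra_axioms pos ca that])
  have "absolutely_continuous M N"
    unfolding absolutely_continuous_def
  proof
    fix A assume A: "A \<in> null_sets M"
    then have "measure M A = 0" by (simp add: measure_def null_setsD1)
    then have "\<kappa> A = 0" using nn[of A] bd[of A] A by auto
    then show "A \<in> null_sets N" using A by (simp add: null_sets_def emN seN)
  qed
  then obtain g where g [measurable]: "g \<in> borel_measurable M" and gN: "density M g = N"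
    using Radon_Nikodym[OF _ seN] by blast
  have "(\<integral>\<^sup>+x. g x \<partial>M) = emeasure N (space M)"
    unfolding gN[symmetric] by (subst emeasure_density) (auto intro!: nn_integral_cong)
  also have "\<dots> < \<infinity>" by (simp add: emN)
  finally have fin: "(\<integral>\<^sup>+x. g x \<partial>M) < \<infinity>" .
  have AEg: "AE x in M. g x \<noteq> \<infinity>"
    by (rule nn_integral_PInf_AE[OF g]) (use fin in simp)
  define h where "h = (\<lambda>x. enn2real (g x))"
  have [measurable]: "h \<in> borel_measurable M" unfolding h_def by measurable
  have AEh: "AE x in M. ennreal (h x) = g x"
    using AEg by eventually_elim (simp add: h_def less_top)
  have h0: "0 \<le> h x" for x by (simp add: h_def)
  have "(\<integral>\<^sup>+x. ennreal (h x) \<partial>M) = (\<integral>\<^sup>+x. g x \<partial>M)" by (rule nn_integral_cong_AE[OF AEh])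
  then have inth: "integrable M h" using fin h0 by (intro integrableI_nonneg) auto
  moreover have "\<kappa> A = (\<integral>x. indicator A x * h x \<partial>M)" if A [measurable]: "A \<in> sets M" for A
  proof -
    have "ennreal (\<kappa> A) = (\<integral>\<^sup>+x. g x * indicator A x \<partial>M)"
      unfolding emN[OF A, symmetric] gN[symmetric] by (rule emeasure_density[OF g A])
    also have "\<dots> = (\<integral>\<^sup>+x. ennreal (indicator A x * h x) \<partial>M)"
      by (rule nn_integral_cong_AE) (use AEh in eventually_elim, auto simp: indicator_def)
    also have "\<dots> = ennreal (\<integral>x. indicator A x * h x \<partial>M)"
      by (rule nn_integral_eq_integral) (use integrable_real_mult_indicator[OF A inth] h0 in \<open>auto simp: mult.commute\<close>)
    finally show ?thesis using nn[OF A] h0 by (subst (asm) ennreal_inj) auto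
  qed
  ultimately show ?thesis by (rule that)
qed

text \<open>The Jordan decomposition: the supremum of \<open>\<nu>\<close> over the measurable subsets of a set is additive,
  nonnegative, and dominates \<open>\<nu>\<close>, so both it and its difference with \<open>\<nu>\<close> have densities.\<close>

lemma density_of_signed_set_function:
  assumes add: "\<And>A B. A \<in> sets M \<Longrightarrow> B \<in> sets M \<Longrightarrow> A \<inter> B = {} \<Longrightarrow> \<nu> (A \<union> B) = \<nu> A + \<nu> B"
    and bd: "\<And>A. A \<in> sets M \<Longrightarrow> \<bar>\<nu> A\<bar> \<le> C * sqrt (measure M A)" and C: "0 \<le> C"
  obtains h :: "'a \<Rightarrow> real" where "integrable M h" "\<And>A. A \<in> sets M \<Longrightarrow> \<nu> A = (\<integral>x. indicator A x * h x \<partial>M)"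
proof -
  have n0: "\<nu> {} = 0" using add[of "{}" "{}"] by simp
  define S where "S A = {D \<in> sets M. D \<subseteq> A}" for A
  define \<kappa> where "\<kappa> A = (SUP D\<in>S A. \<nu> D)" for A
  have le: "\<nu> D \<le> C * sqrt (measure M A)" if "D \<in> S A" "A \<in> sets M" for D A
  proof -
    have "\<nu> D \<le> C * sqrt (measure M D)" using bd[of D] that by (auto simp: S_def)
    also have "\<dots> \<le> C * sqrt (measure M A)"
      using that C by (intro mult_left_mono real_sqrt_le_mono finite_measure_mono) (auto simp: S_def)
    finally show ?thesis .
  qed
  have bdd: "bdd_above (\<nu> ` S A)" if "A \<in> sets M" for A
    using le[OF _ that] by (intro bdd_aboveI2) blast
  have up: "\<nu> D \<le> \<kappa> A" if "D \<in> S A" "A \<in> sets M" for D A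
    unfolding \<kappa>_def by (rule cSUP_upper[OF that(1) bdd[OF that(2)]])
  have ne: "S A \<noteq> {}" for A by (auto simp: S_def)
  have kadd: "\<kappa> (A \<union> B) = \<kappa> A + \<kappa> B" if A: "A \<in> sets M" and B: "B \<in> sets M" and AB: "A \<inter> B = {}" for A B
  proof (rule antisym)
    show "\<kappa> (A \<union> B) \<le> \<kappa> A + \<kappa> B"
      unfolding \<kappa>_def[of "A \<union> B"]
    proof (rule cSUP_least[OF ne])
      fix D assume D: "D \<in> S (A \<union> B)"
      then have Dm: "D \<in> sets M" by (simp add: S_def)
      have "\<nu> D = \<nu> ((D \<inter> A) \<union> (D \<inter> B))" using D by (intro arg_cong[of _ _ \<nu>]) (auto simp: S_def)
      also have "\<dots> = \<nu> (D \<inter> A) + \<nu> (D \<inter> B)" by (rule add) (use A B AB Dm in auto)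
      also have "\<dots> \<le> \<kappa> A + \<kappa> B" by (intro add_mono up) (use A B Dm in \<open>auto simp: S_def\<close>)
      finally show "\<nu> D \<le> \<kappa> A + \<kappa> B" .
    qed
    have "\<nu> D \<le> \<kappa> (A \<union> B) - \<nu> D'" if D: "D \<in> S A" and D': "D' \<in> S B" for D D'
    proof -
      have "\<nu> D + \<nu> D' = \<nu> (D \<union> D')" by (rule add[symmetric]) (use D D' AB in \<open>auto simp: S_def\<close>)
      also have "\<dots> \<le> \<kappa> (A \<union> B)" by (rule up) (use D D' A B in \<open>auto simp: S_def\<close>)
      finally show ?thesis by simp
    qed
    then have "\<kappa> A \<le> \<kappa> (A \<union> B) - \<nu> D'" if "D' \<in> S B" for D'
      unfolding \<kappa>_def[of A] using that by (intro cSUP_least[OF ne]) blast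
    then have "\<nu> D' \<le> \<kappa> (A \<union> B) - \<kappa> A" if "D' \<in> S B" for D' using that by force
    then have "\<kappa> B \<le> \<kappa> (A \<union> B) - \<kappa> A"
      unfolding \<kappa>_def[of B] by (intro cSUP_least[OF ne]) blast
    then show "\<kappa> A + \<kappa> B \<le> \<kappa> (A \<union> B)" by simp
  qed
  have kbd: "\<kappa> A \<le> C * sqrt (measure M A)" if "A \<in> sets M" for A
    unfolding \<kappa>_def using le[OF _ that] by (intro cSUP_least[OF ne]) blast
  have kn: "\<nu> A \<le> \<kappa> A" and k0: "0 \<le> \<kappa> A" if "A \<in> sets M" for A
    using up[of A A, OF _ that] up[of "{}" A, OF _ that] that by (auto simp: S_def n0)
  obtain h1 where h1: "integrable M h1" "\<And>A. A \<in> sets M \<Longrightarrow> \<kappa> A = (\<integral>x. indicator A x * h1 x \<partial>M)"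
    by (rule density_of_positive_set_function[of \<kappa> C]) (use kadd k0 kbd in blast)+
  have dadd: "\<kappa> (A \<union> B) - \<nu> (A \<union> B) = (\<kappa> A - \<nu> A) + (\<kappa> B - \<nu> B)"
    if "A \<in> sets M" "B \<in> sets M" "A \<inter> B = {}" for A B
    using kadd[OF that] add[OF that] by simp
  have dbd: "\<kappa> A - \<nu> A \<le> (2 * C) * sqrt (measure M A)" if "A \<in> sets M" for A
    using kbd[OF that] bd[OF that] by simp
  have d0: "0 \<le> \<kappa> A - \<nu> A" if "A \<in> sets M" for A using kn[OF that] by simp
  obtain h2 where h2: "integrable M h2" "\<And>A. A \<in> sets M \<Longrightarrow> \<kappa> A - \<nu> A = (\<integral>x. indicator A x * h2 x \<partial>M)"
    using density_of_positive_set_function[of "\<lambda>A. \<kappa> A - \<nu> A" "2 * C", OF dadd d0 dbd] by blast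
  show ?thesis
  proof (rule that)
    show "integrable M (\<lambda>x. h1 x - h2 x)" using h1 h2 by simp
    fix A assume A: "A \<in> sets M"
    have "integrable M (\<lambda>x. indicator A x * h1 x)" "integrable M (\<lambda>x. indicator A x * h2 x)"
      using integrable_real_mult_indicator[OF A h1(1)] integrable_real_mult_indicator[OF A h2(1)]
      by (simp_all add: mult.commute)
    then have "(\<integral>x. indicator A x * (h1 x - h2 x) \<partial>M)
        = (\<integral>x. indicator A x * h1 x \<partial>M) - (\<integral>x. indicator A x * h2 x \<partial>M)"
      by (simp add: right_diff_distrib)
    then show "\<nu> A = (\<integral>x. indicator A x * (h1 x - h2 x) \<partial>M)"
      using h1(2)[OF A] h2(2)[OF A] by linarith
  qed
qed

text \<open>The approximants are written as explicit finite sums of indicators, so that linear functionals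
  can be evaluated on them term by term.\<close>

lemma simple_approximation:
  fixes f :: "'a \<Rightarrow> complex"
  assumes f: "f \<in> borel_measurable M"
  obtains Y :: "nat \<Rightarrow> complex set" and A :: "nat \<Rightarrow> complex \<Rightarrow> 'a set"
  where "\<And>i. finite (Y i)" "\<And>i y. A i y \<in> sets M"
    "\<And>i x. x \<in> space M \<Longrightarrow> cmod (\<Sum>y\<in>Y i. y * indicator (A i y) x) \<le> cmod (2 * f x)"
    "\<And>x. x \<in> space M \<Longrightarrow> (\<lambda>i. \<Sum>y\<in>Y i. y * indicator (A i y) x) \<longlonglongrightarrow> f x"
proof -
  obtain s where s: "\<And>i. simple_function M (s i)" "\<And>x. x \<in> space M \<Longrightarrow> (\<lambda>i. s i x) \<longlonglongrightarrow> f x"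
    and sb: "\<And>i x. x \<in> space M \<Longrightarrow> dist (s i x) 0 \<le> 2 * dist (f x) 0"
    using borel_measurable_implies_sequence_metric[OF f, of 0] by metis
  have fin: "finite (s i ` space M)" and sm: "s i -` {y} \<inter> space M \<in> sets M" for i y
    by (rule simple_functionD[OF s(1)])+
  have rs: "(\<Sum>y\<in>s i ` space M. y * indicator (s i -` {y} \<inter> space M) x) = s i x" if x: "x \<in> space M" for i x
  proof -
    have "(\<Sum>y\<in>s i ` space M. y * indicator (s i -` {y} \<inter> space M) x) = (\<Sum>y\<in>s i ` space M. if y = s i x then y else 0)"
      using x by (intro sum.cong) (auto simp: indicator_def)
    then show ?thesis using fin[of i] x by simp
  qed
  show ?thesis
  proof (rule that[of "\<lambda>i. s i ` space M" "\<lambda>i y. s i -` {y} \<inter> space M"])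
    show "cmod (\<Sum>y\<in>s i ` space M. y * indicator (s i -` {y} \<inter> space M) x) \<le> cmod (2 * f x)" if "x \<in> space M" for i x
      using sb[OF that, of i] by (simp only: rs[OF that]) (simp add: norm_mult dist_norm)
    show "(\<lambda>i. \<Sum>y\<in>s i ` space M. y * indicator (s i -` {y} \<inter> space M) x) \<longlonglongrightarrow> f x" if "x \<in> space M" for x
      by (simp only: rs[OF that] s(2)[OF that])
  qed (rule fin sm)+
qed

text \<open>On indicators \<open>\<Lambda>\<close> is a complex set function, whose real and imaginary parts have densities;
  dominated convergence carries the formula to bounded functions. Testing \<open>\<Lambda>\<close> with truncations of
  the conjugate of \<open>\<phi>\<close> bounds their \<open>L\<^sup>2\<close>-norms by \<open>C\<close>.\<close>

theorem riesz_representation_L2: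
  fixes \<Lambda> :: "('a \<Rightarrow> complex) \<Rightarrow> complex"
  assumes add: "\<And>f g. f \<in> bmeas M \<Longrightarrow> g \<in> bmeas M \<Longrightarrow> \<Lambda> (\<lambda>x. f x + g x) = \<Lambda> f + \<Lambda> g"
    and scale: "\<And>c f. f \<in> bmeas M \<Longrightarrow> \<Lambda> (\<lambda>x. c * f x) = c * \<Lambda> f"
    and bd: "\<And>f. f \<in> bmeas M \<Longrightarrow> cmod (\<Lambda> f) \<le> C * l2norm M f" and C: "0 \<le> C"
  obtains \<phi> where "\<phi> \<in> square_integrable M" "\<And>f. f \<in> bmeas M \<Longrightarrow> \<Lambda> f = (\<integral>x. \<phi> x * f x \<partial>M)"
proof -
  have ind_Un: "indicator (A \<union> B) = (\<lambda>x. indicator A x + indicator B x :: complex)" if "A \<inter> B = {}" for A B :: "'a set"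
    using that by (auto simp: indicator_def fun_eq_iff)
  have ladd: "\<Lambda> (indicator (A \<union> B)) = \<Lambda> (indicator A) + \<Lambda> (indicator B)"
    if "A \<in> sets M" "B \<in> sets M" "A \<inter> B = {}" for A B
    unfolding ind_Un[OF that(3)] by (rule add) (use that in \<open>auto intro: bmeas_indicator\<close>)
  have lbd: "cmod (\<Lambda> (indicator A)) \<le> C * sqrt (measure M A)" if "A \<in> sets M" for A
    using bd[OF bmeas_indicator[OF that]] l2norm_indicator[OF that] by simp
  have re_bd: "\<bar>Re (\<Lambda> (indicator A))\<bar> \<le> C * sqrt (measure M A)" and im_bd: "\<bar>Im (\<Lambda> (indicator A))\<bar> \<le> C * sqrt (measure M A)"
    if "A \<in> sets M" for A
    using lbd[OF that] abs_Re_le_cmod[of "\<Lambda> (indicator A)"] abs_Im_le_cmod[of "\<Lambda> (indicator A)"] by linarith+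
  have re_add: "Re (\<Lambda> (indicator (A \<union> B))) = Re (\<Lambda> (indicator A)) + Re (\<Lambda> (indicator B))"
    and im_add: "Im (\<Lambda> (indicator (A \<union> B))) = Im (\<Lambda> (indicator A)) + Im (\<Lambda> (indicator B))"
    if "A \<in> sets M" "B \<in> sets M" "A \<inter> B = {}" for A B
    by (simp_all add: ladd[OF that])
  obtain h1 where h1: "integrable M h1" "\<And>A. A \<in> sets M \<Longrightarrow> Re (\<Lambda> (indicator A)) = (\<integral>x. indicator A x * h1 x \<partial>M)"
    using density_of_signed_set_function[of "\<lambda>A. Re (\<Lambda> (indicator A))" C, OF re_add re_bd C] by blast
  obtain h2 where h2: "integrable M h2" "\<And>A. A \<in> sets M \<Longrightarrow> Im (\<Lambda> (indicator A)) = (\<integral>x. indicator A x * h2 x \<partial>M)"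
    using density_of_signed_set_function[of "\<lambda>A. Im (\<Lambda> (indicator A))" C, OF im_add im_bd C] by blast
  define \<phi> where "\<phi> x = complex_of_real (h1 x) + \<i> * complex_of_real (h2 x)" for x
  have int\<phi>: "integrable M \<phi>" unfolding \<phi>_def[abs_def] using h1(1) h2(1) by simp
  have [measurable]: "\<phi> \<in> borel_measurable M" using int\<phi> by (rule borel_measurable_integrable)
  have int_mult: "integrable M (\<lambda>x. \<phi> x * f x)" if f: "f \<in> bmeas M" for f
  proof -
    obtain D where D: "f \<in> borel_measurable M" "0 \<le> D" "\<And>x. x \<in> space M \<Longrightarrow> cmod (f x) \<le> D"
      using f by (rule bmeasE) blast
    note [measurable] = D(1)
    show ?thesis
    proof (rule Bochner_Integration.integrable_bound)
      show "integrable M (\<lambda>x. complex_of_real D * \<phi> x)" using int\<phi> by simp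
      show "AE x in M. cmod (\<phi> x * f x) \<le> cmod (complex_of_real D * \<phi> x)"
      proof (rule AE_I2)
        fix x assume "x \<in> space M"
        then have "cmod (\<phi> x) * cmod (f x) \<le> cmod (\<phi> x) * D" using D by (intro mult_left_mono) auto
        then show "cmod (\<phi> x * f x) \<le> cmod (complex_of_real D * \<phi> x)" using D(2) by (simp add: norm_mult mult.commute)
      qed
    qed measurable
  qed
  have ind: "\<Lambda> (indicator A) = (\<integral>x. \<phi> x * indicator A x \<partial>M)" if A: "A \<in> sets M" for A
  proof -
    have i1: "integrable M (\<lambda>x. indicator A x * h1 x)" and i2: "integrable M (\<lambda>x. indicator A x * h2 x)"
      using integrable_real_mult_indicator[OF A h1(1)] integrable_real_mult_indicator[OF A h2(1)]
      by (simp_all add: mult.commute)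
    have "(\<integral>x. \<phi> x * indicator A x \<partial>M)
      = (\<integral>x. complex_of_real (indicator A x * h1 x) + \<i> * complex_of_real (indicator A x * h2 x) \<partial>M)"
      by (intro Bochner_Integration.integral_cong refl) (auto simp: \<phi>_def indicator_def)
    also have "\<dots> = complex_of_real (\<integral>x. indicator A x * h1 x \<partial>M) + \<i> * complex_of_real (\<integral>x. indicator A x * h2 x \<partial>M)"
      using i1 i2 by (subst Bochner_Integration.integral_add) (simp_all only: integrable_of_real integrable_mult_right
        integral_mult_right_zero integral_complex_of_real)
    also have "\<dots> = \<Lambda> (indicator A)"
      unfolding h1(2)[OF A, symmetric] h2(2)[OF A, symmetric] by (simp add: complex_eq_iff)
    finally show ?thesis by simp
  qed
  have cong: "\<Lambda> f = \<Lambda> g" if f: "f \<in> bmeas M" and g: "g \<in> bmeas M"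
    and eq: "\<And>x. x \<in> space M \<Longrightarrow> f x = g x" for f g
  proof -
    have "\<Lambda> (\<lambda>x. f x + (-1) * g x) = \<Lambda> f + (-1) * \<Lambda> g"
      by (simp only: add[OF f bmeas_scale[OF g]] scale[OF g])
    moreover have "cmod (\<Lambda> (\<lambda>x. f x + (-1) * g x)) \<le> C * l2norm M (\<lambda>x. f x + (-1) * g x)"
      by (rule bd[OF bmeas_add[OF f bmeas_scale[OF g]]])
    moreover have "l2norm M (\<lambda>x. f x + (-1) * g x) = 0"
    proof -
      have "(\<integral>x. (cmod (f x + (-1) * g x))\<^sup>2 \<partial>M) = (\<integral>x. 0 \<partial>M)"
        by (intro Bochner_Integration.integral_cong) (auto simp: eq)
      then show ?thesis by (simp add: l2norm_def)
    qed
    ultimately show ?thesis by simp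
  qed
  have sum_ind: "\<Lambda> (\<lambda>x. \<Sum>y\<in>Y. y * indicator (A y) x) = (\<integral>x. \<phi> x * (\<Sum>y\<in>Y. y * indicator (A y) x) \<partial>M)"
    if "finite Y" "\<And>y. A y \<in> sets M" for Y :: "complex set" and A
    using that(1)
  proof induction
    case empty
    show ?case using scale[OF bmeas_const[of 0], of 0] by simp
  next
    case (insert y Y)
    have b1: "(\<lambda>x. y * indicator (A y) x) \<in> bmeas M"
      by (intro bmeas_scale bmeas_indicator that)
    have b2: "(\<lambda>x. \<Sum>y\<in>Y. y * indicator (A y) x) \<in> bmeas M"
      by (intro bmeas_sum bmeas_scale bmeas_indicator that)
    have "\<Lambda> (\<lambda>x. \<Sum>y\<in>insert y Y. y * indicator (A y) x)
      = \<Lambda> (\<lambda>x. y * indicator (A y) x) + \<Lambda> (\<lambda>x. \<Sum>y\<in>Y. y * indicator (A y) x)"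
      by (simp only: sum.insert[OF insert.hyps] add[OF b1 b2])
    also have "\<Lambda> (\<lambda>x. y * indicator (A y) x) = (\<integral>x. \<phi> x * (y * indicator (A y) x) \<partial>M)"
      using scale[OF bmeas_indicator[OF that(2)[of y]], of y] ind[OF that(2)[of y]]
      by (simp add: mult.left_commute)
    also have "(\<integral>x. \<phi> x * (y * indicator (A y) x) \<partial>M) + \<Lambda> (\<lambda>x. \<Sum>y\<in>Y. y * indicator (A y) x)
      = (\<integral>x. \<phi> x * (y * indicator (A y) x) + \<phi> x * (\<Sum>y\<in>Y. y * indicator (A y) x) \<partial>M)"
      unfolding insert.IH by (rule Bochner_Integration.integral_add[symmetric]) (intro int_mult b1 b2)+
    also have "\<dots> = (\<integral>x. \<phi> x * (\<Sum>y\<in>insert y Y. y * indicator (A y) x) \<partial>M)"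
      by (simp only: sum.insert[OF insert.hyps] distrib_left)
    finally show ?case .
  qed
  have repr: "\<Lambda> f = (\<integral>x. \<phi> x * f x \<partial>M)" if f: "f \<in> bmeas M" for f
  proof -
    obtain D where D: "f \<in> borel_measurable M" "0 \<le> D" "\<And>x. x \<in> space M \<Longrightarrow> cmod (f x) \<le> D"
      using f by (rule bmeasE) blast
    obtain Y A where fin: "\<And>i. finite (Y i)" and sm: "\<And>i y. A i y \<in> sets M"
      and rle': "\<And>i x. x \<in> space M \<Longrightarrow> cmod (\<Sum>y\<in>Y i. y * indicator (A i y) x) \<le> cmod (2 * f x)"
      and rlim': "\<And>x. x \<in> space M \<Longrightarrow> (\<lambda>i. \<Sum>y\<in>Y i. y * indicator (A i y) x) \<longlonglongrightarrow> f x"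
      by (rule simple_approximation[OF D(1)]) blast
    define r where "r i x = (\<Sum>y\<in>Y i. y * indicator (A i y) x)" for i x
    have rb: "r i \<in> bmeas M" for i
      unfolding r_def[abs_def]
      by (intro bmeas_sum bmeas_scale bmeas_indicator sm)
    have mr [measurable]: "r i \<in> borel_measurable M" for i using rb[of i] by (simp add: bmeas_def)
    note [measurable] = D(1)
    note rle = rle'[folded r_def] and rlim = rlim'[folded r_def]
    have "(\<lambda>i. l2norm M (\<lambda>x. r i x - f x)) \<longlonglongrightarrow> 0"
      by (rule l2norm_dominated[where h = "\<lambda>x. 2 * f x"])
         (use f rle rlim in \<open>auto intro!: bmeas_sqint bmeas_scale AE_I2\<close>)
    then have c0: "(\<lambda>i. C * l2norm M (\<lambda>x. r i x - f x)) \<longlonglongrightarrow> 0" by (rule tendsto_mult_right_zero)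
    have "(\<lambda>i. \<Lambda> (r i) - \<Lambda> f) \<longlonglongrightarrow> 0"
    proof (rule Lim_null_comparison[OF always_eventually c0], rule allI)
      fix i
      have "\<Lambda> (\<lambda>x. r i x + (-1) * f x) = \<Lambda> (r i) + (-1) * \<Lambda> f"
        by (simp only: add[OF rb bmeas_scale[OF f]] scale[OF f])
      then show "norm (\<Lambda> (r i) - \<Lambda> f) \<le> C * l2norm M (\<lambda>x. r i x - f x)"
        using bd[OF bmeas_add[OF rb bmeas_scale[OF f]], of i "-1"] by simp
    qed
    then have l1: "(\<lambda>i. \<Lambda> (r i)) \<longlonglongrightarrow> \<Lambda> f" by (simp add: LIM_zero_iff)
    have "(\<lambda>i. \<integral>x. \<phi> x * r i x \<partial>M) \<longlonglongrightarrow> (\<integral>x. \<phi> x * f x \<partial>M)"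
    proof (rule integral_dominated_convergence[where w = "\<lambda>x. 2 * cmod (\<phi> x * f x)"])
      show "integrable M (\<lambda>x. 2 * cmod (\<phi> x * f x))"
        using integrable_norm[OF int_mult[OF f]] by simp
      show "AE x in M. (\<lambda>i. \<phi> x * r i x) \<longlonglongrightarrow> \<phi> x * f x"
        using rlim by (auto intro!: AE_I2 tendsto_mult)
      show "AE x in M. cmod (\<phi> x * r i x) \<le> 2 * cmod (\<phi> x * f x)" for i
      proof (rule AE_I2)
        fix x assume "x \<in> space M"
        then have "cmod (\<phi> x) * cmod (r i x) \<le> cmod (\<phi> x) * cmod (2 * f x)" by (intro mult_left_mono rle) auto
        then show "cmod (\<phi> x * r i x) \<le> 2 * cmod (\<phi> x * f x)" by (simp add: norm_mult mult.left_commute)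
      qed
    qed measurable
    moreover have "\<Lambda> (r i) = (\<integral>x. \<phi> x * r i x \<partial>M)" for i
      unfolding r_def[abs_def] by (rule sum_ind[OF fin sm])
    ultimately show ?thesis using l1 by (simp add: LIMSEQ_unique)
  qed
  have "\<phi> \<in> square_integrable M"
  proof -
    define k where "k n = truncate (\<lambda>x. cnj (\<phi> x)) n" for n
    have kb: "k n \<in> bmeas M" for n unfolding k_def by (rule truncate_bounded) measurable
    have km [measurable]: "k n \<in> borel_measurable M" for n using kb[of n] by (simp add: bmeas_def)
    have "(l2norm M (k n))\<^sup>2 \<le> C\<^sup>2" for n
    proof -
      have "\<Lambda> (k n) = (\<integral>x. k n x * cnj (k n x) \<partial>M)"
        unfolding repr[OF kb] by (intro Bochner_Integration.integral_cong) (auto simp: k_def truncate_def)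
      then have "(l2norm M (k n))\<^sup>2 = cmod (\<Lambda> (k n))" by (simp only: l2norm_power2_cmod)
      then have "l2norm M (k n) \<le> C"
        using bd[OF kb[of n]] C by (intro l2norm_le_of_power2_le) simp_all
      then show ?thesis by (intro power_mono) auto
    qed
    then have kC: "(\<integral>x. (cmod (k n x))\<^sup>2 \<partial>M) \<le> C\<^sup>2" for n by (simp add: l2norm_power2)
    have kint: "integrable M (\<lambda>x. (cmod (k n x))\<^sup>2)" for n
      using bmeas_sqint[OF kb] by (rule sqintD)
    have kmono: "mono (\<lambda>n. (cmod (k n x))\<^sup>2)" for x
      by (intro monoI power_mono) (auto simp: k_def truncate_def)
    have "mono (\<lambda>n. \<integral>x. (cmod (k n x))\<^sup>2 \<partial>M)"
      using kmono by (intro monoI integral_mono kint) (auto simp: mono_def)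
    then obtain L where L: "(\<lambda>n. \<integral>x. (cmod (k n x))\<^sup>2 \<partial>M) \<longlonglongrightarrow> L"
      using incseq_convergent[of "\<lambda>n. \<integral>x. (cmod (k n x))\<^sup>2 \<partial>M" "C\<^sup>2"] kC by blast
    have "integrable M (\<lambda>x. (cmod (\<phi> x))\<^sup>2)"
    proof (rule integrable_monotone_convergence[OF kint _ _ L])
      show "AE x in M. mono (\<lambda>n. (cmod (k n x))\<^sup>2)" using kmono by simp
      show "AE x in M. (\<lambda>n. (cmod (k n x))\<^sup>2) \<longlonglongrightarrow> (cmod (\<phi> x))\<^sup>2"
      proof (rule AE_I2, rule tendsto_eventually)
        fix x show "\<forall>\<^sub>F n in sequentially. (cmod (k n x))\<^sup>2 = (cmod (\<phi> x))\<^sup>2"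
          using truncate_eventually[of "\<lambda>x. cnj (\<phi> x)" x] unfolding k_def by eventually_elim simp
      qed
    qed measurable
    then show ?thesis by (simp add: square_integrable_def)
  qed
  then show ?thesis using repr by (rule that)
qed

section \<open>Adjoints\<close>

text \<open>For fixed \<open>g\<close>, the vector \<open>T\<^sup>* g\<close> is the conjugate of the Riesz representative of the functional
  \<open>f \<mapsto> \<langle>T f, g\<rangle>\<close>; linearity and boundedness in \<open>g\<close> follow from its uniqueness.\<close>

lemma adjoint_exists:
  assumes T: "T \<in> BH M"
  obtains S where "S \<in> BH M"
    "\<And>f g. f \<in> square_integrable M \<Longrightarrow> g \<in> square_integrable M \<Longrightarrow> form M S g f = cnj (form M T f g)"
proof -
  define adj where "adj g h \<longleftrightarrow> h \<in> square_integrable M \<and>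
    (\<forall>f\<in>square_integrable M. (\<integral>x. h x * cnj (f x) \<partial>M) = cnj (form M T f g))" for g h
  have ex: "\<exists>h. adj g h" if g: "g \<in> square_integrable M" for g
  proof -
    note bs = bmeas_sqint
    obtain \<phi> where phi: "\<phi> \<in> square_integrable M"
      "\<And>f. f \<in> bmeas M \<Longrightarrow> form M T f g = (\<integral>x. \<phi> x * f x \<partial>M)"
    proof (rule riesz_representation_L2[of "\<lambda>f. form M T f g" "op_norm M T * l2norm M g"])
      show "form M T (\<lambda>x. f x + k x) g = form M T f g + form M T k g"
        if "f \<in> bmeas M" "k \<in> bmeas M" for f k
        by (rule form_add_left[OF T bs[OF that(1)] bs[OF that(2)] g])
      show "form M T (\<lambda>x. c * f x) g = c * form M T f g" if "f \<in> bmeas M" for c f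
        by (rule form_scale_left[OF T bs[OF that] g])
      show "cmod (form M T f g) \<le> op_norm M T * l2norm M g * l2norm M f" if "f \<in> bmeas M" for f
        using form_bound[OF T bs[OF that] g] by (simp only: mult_ac)
      show "0 \<le> op_norm M T * l2norm M g" using op_norm_nonneg[OF T] by simp
    qed blast
    have "form M T f g = (\<integral>x. \<phi> x * f x \<partial>M)" if f: "f \<in> square_integrable M" for f
    proof -
      note sq = truncate_sqint[OF f]
      have "(\<lambda>n. form M T (truncate f n) g) \<longlonglongrightarrow> form M T f g"
        by (rule form_tendsto[OF T f g sq g truncate_l2_tendsto[OF f]]) (simp add: l2norm_def)
      moreover have "(\<lambda>n. \<integral>x. \<phi> x * truncate f n x \<partial>M) \<longlonglongrightarrow> (\<integral>x. \<phi> x * f x \<partial>M)"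
      proof -
        have c0: "(\<lambda>n. l2norm M \<phi> * l2norm M (\<lambda>x. truncate f n x - f x)) \<longlonglongrightarrow> 0"
          by (rule tendsto_mult_right_zero[OF truncate_l2_tendsto[OF f]])
        have "(\<lambda>n. (\<integral>x. \<phi> x * truncate f n x \<partial>M) - (\<integral>x. \<phi> x * f x \<partial>M)) \<longlonglongrightarrow> 0"
        proof (rule Lim_null_comparison[OF always_eventually c0], rule allI)
          fix n
          have "(\<integral>x. \<phi> x * truncate f n x \<partial>M) - (\<integral>x. \<phi> x * f x \<partial>M) = (\<integral>x. \<phi> x * (truncate f n x - f x) \<partial>M)"
            by (simp add: right_diff_distrib sqint_mult_integrable[OF phi(1) sq] sqint_mult_integrable[OF phi(1) f])
          then show "norm ((\<integral>x. \<phi> x * truncate f n x \<partial>M) - (\<integral>x. \<phi> x * f x \<partial>M)) \<le> l2norm M \<phi> * l2norm M (\<lambda>x. truncate f n x - f x)"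
            using cauchy_schwarz[OF phi(1) sqint_diff[OF sq f]] by simp
        qed
        then show ?thesis by (simp add: LIM_zero_iff)
      qed
      ultimately show ?thesis
        using phi(2)[OF truncate_bounded[OF sqintD(1)[OF f]]] by (simp add: LIMSEQ_unique)
    qed
    then have "(\<integral>x. cnj (\<phi> x) * cnj (f x) \<partial>M) = cnj (form M T f g)" if "f \<in> square_integrable M" for f
      using that by (simp only: complex_cnj_mult[symmetric] Bochner_Integration.integral_cnj)
    then have "adj g (\<lambda>x. cnj (\<phi> x))"
      unfolding adj_def using sqint_cnj[OF phi(1)] by blast
    then show ?thesis by blast
  qed
  define F where "F g = (SOME h. adj g h)" for g
  have F: "adj g (F g)" if "g \<in> square_integrable M" for g
    unfolding F_def using ex[OF that] by (rule someI_ex)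
  have Fs: "F g \<in> square_integrable M" and Ff: "\<And>f. f \<in> square_integrable M \<Longrightarrow> (\<integral>x. F g x * cnj (f x) \<partial>M) = cnj (form M T f g)"
    if "g \<in> square_integrable M" for g using F[OF that] by (auto simp: adj_def)
  define S where "S = (\<lambda>\<xi>\<in>L2 M. ae_class M (F (rep \<xi>)))"
  have S: "S \<in> BH M \<and> (\<forall>f. f \<in> square_integrable M \<longrightarrow> S (ae_class M f) = ae_class M (F f))"
  proof -
    note uniq = AE_eqI_inner
    have "AE x in M. F f x = F g x" if f: "f \<in> square_integrable M" and g: "g \<in> square_integrable M"
      and eq: "AE x in M. f x = g x" for f g
      by (rule uniq[OF Fs[OF f] Fs[OF g]]) (simp add: Ff f g form_cong_AE[OF _ eq])
    moreover have "AE x in M. F (\<lambda>x. f x + g x) x = F f x + F g x"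
      if f: "f \<in> square_integrable M" and g: "g \<in> square_integrable M" for f g
      by (rule uniq[OF Fs[OF sqint_add[OF f g]] sqint_add[OF Fs[OF f] Fs[OF g]]])
        (simp add: Ff sqint_add f g form_add_right[OF T f g] distrib_right Fs
          sqint_mult_integrable sqint_cnj)
    moreover have "AE x in M. F (\<lambda>x. c * f x) x = c * F f x" if f: "f \<in> square_integrable M" for c f
      by (rule uniq[OF Fs[OF sqint_scale[OF f]] sqint_scale[OF Fs[OF f]]])
        (simp add: Ff sqint_scale f form_scale_right[OF T f] mult.assoc)
    moreover have "l2norm M (F g) \<le> op_norm M T * l2norm M g" if g: "g \<in> square_integrable M" for g
    proof (rule l2norm_le_of_power2_le)
      have "(l2norm M (F g))\<^sup>2 = cmod (form M T (F g) g)"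
        unfolding l2norm_power2_cmod Ff[OF g Fs[OF g]] by simp
      then show "(l2norm M (F g))\<^sup>2 \<le> op_norm M T * l2norm M g * l2norm M (F g)"
        using form_bound[OF T Fs[OF g] g] by (simp only: mult_ac)
    qed (simp add: op_norm_nonneg[OF T])
    ultimately show ?thesis
      unfolding S_def using operator_of_function_map[of M F "op_norm M T", OF Fs] by blast
  qed
  show ?thesis
  proof (rule that)
    show "S \<in> BH M" using S by blast
    fix f g assume f: "f \<in> square_integrable M" and g: "g \<in> square_integrable M"
    have "S (ae_class M g) = ae_class M (F g)" using S g by blast
    then have "form M S g f = (\<integral>x. F g x * cnj (f x) \<partial>M)"
      unfolding form_def by (simp add: vec_inner_class[OF Fs[OF g] f])
    then show "form M S g f = cnj (form M T f g)" by (simp add: Ff[OF g f])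
  qed
qed

lemma op_adjoint:
  assumes T: "T \<in> BH M"
  shows op_adjoint_BH: "op_adjoint M T \<in> BH M"
    and form_op_adjoint: "\<And>f g. f \<in> square_integrable M \<Longrightarrow> g \<in> square_integrable M \<Longrightarrow>
      form M (op_adjoint M T) g f = cnj (form M T f g)"
proof -
  have sym: "vec_inner M \<xi> \<eta> = cnj (vec_inner M \<eta> \<xi>)" for \<xi> \<eta>
  proof -
    have "cnj (vec_inner M \<eta> \<xi>) = (\<integral>x. cnj (rep \<eta> x * cnj (rep \<xi> x)) \<partial>M)"
      unfolding vec_inner_def by (rule Bochner_Integration.integral_cnj[symmetric])
    then show ?thesis by (simp add: vec_inner_def mult.commute)
  qed
  let ?P = "\<lambda>S. S \<in> BH M \<and> (\<forall>\<xi>\<in>L2 M. \<forall>\<eta>\<in>L2 M. vec_inner M (T \<xi>) \<eta> = vec_inner M \<xi> (S \<eta>))"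
  have P_form: "form M S g f = cnj (form M T f g)" if "?P S" "f \<in> square_integrable M" "g \<in> square_integrable M" for S f g
  proof -
    have "vec_inner M (T (ae_class M f)) (ae_class M g) = vec_inner M (ae_class M f) (S (ae_class M g))"
      using that by (auto simp: ae_class_L2)
    then show ?thesis unfolding form_def by (simp add: sym[of "S (ae_class M g)"])
  qed
  obtain S where S: "S \<in> BH M"
    "\<And>f g. f \<in> square_integrable M \<Longrightarrow> g \<in> square_integrable M \<Longrightarrow> form M S g f = cnj (form M T f g)"
    using adjoint_exists[OF T] by blast
  have "?P S"
  proof (intro conjI S(1) ballI)
    fix \<xi> \<eta> assume "\<xi> \<in> L2 M" "\<eta> \<in> L2 M"
    obtain f where f: "f \<in> square_integrable M" "\<xi> = ae_class M f" using L2_E[OF \<open>\<xi> \<in> L2 M\<close>] by blast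
    obtain g where g: "g \<in> square_integrable M" "\<eta> = ae_class M g" using L2_E[OF \<open>\<eta> \<in> L2 M\<close>] by blast
    show "vec_inner M (T \<xi>) \<eta> = vec_inner M \<xi> (S \<eta>)"
      using S(2)[OF f(1) g(1)] unfolding form_def f(2) g(2) by (simp add: sym[of "ae_class M f"])
  qed
  moreover have "S' = S" if "?P S'" for S'
    by (rule op_eqI) (use that S P_form[OF that] in auto)
  ultimately have "?P (op_adjoint M T)"
    unfolding op_adjoint_def by (rule theI2[of ?P]) auto
  then show "op_adjoint M T \<in> BH M"
    and "\<And>f g. f \<in> square_integrable M \<Longrightarrow> g \<in> square_integrable M \<Longrightarrow>
      form M (op_adjoint M T) g f = cnj (form M T f g)"
    using P_form by blast+
qed

end

section \<open>Integral operators with bounded kernels\<close>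

definition kernel_op :: "'a measure \<Rightarrow> ('a \<times> 'a \<Rightarrow> complex) \<Rightarrow> 'a oper" where
  "kernel_op M k = (\<lambda>\<xi>\<in>L2 M. ae_class M (\<lambda>s. \<integral>t. k (s, t) * rep \<xi> t \<partial>M))"

context finite_measure
begin

abbreviation MM :: "('a \<times> 'a) measure" where
  "MM \<equiv> M \<Otimes>\<^sub>M M"

lemma pair_sigma_finite_self: "pair_sigma_finite M M"
  by unfold_locales

lemma finite_measure_pair_self: "finite_measure MM"
  by (intro finite_measure_pair_measure finite_measure_axioms)

lemma integrable_product:
  fixes u v :: "'a \<Rightarrow> 'b::{real_normed_field, banach, second_countable_topology}"
  assumes u: "integrable M u" and v: "integrable M v"
  shows "integrable MM (\<lambda>p. u (fst p) * v (snd p))"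
    and "(\<integral>p. u (fst p) * v (snd p) \<partial>MM) = (\<integral>x. u x \<partial>M) * (\<integral>x. v x \<partial>M)"
proof -
  interpret P: pair_sigma_finite M M by (rule pair_sigma_finite_self)
  have [measurable]: "u \<in> borel_measurable M" "v \<in> borel_measurable M" using u v by auto
  show int: "integrable MM (\<lambda>p. u (fst p) * v (snd p))"
  proof (rule P.Fubini_integrable)
    show "(\<lambda>p. u (fst p) * v (snd p)) \<in> borel_measurable MM" by measurable
    have "integrable M (\<lambda>x. norm (u x) * (\<integral>y. norm (v y) \<partial>M))" using u by simp
    then show "integrable M (\<lambda>x. \<integral>y. norm (u (fst (x, y)) * v (snd (x, y))) \<partial>M)"
      by (simp add: norm_mult)
    show "AE x in M. integrable M (\<lambda>y. u (fst (x, y)) * v (snd (x, y)))" using v by simp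
  qed
  show "(\<integral>p. u (fst p) * v (snd p) \<partial>MM) = (\<integral>x. u x \<partial>M) * (\<integral>x. v x \<partial>M)"
    using P.integral_fst'[OF int] by simp
qed

lemma sqint_product:
  assumes g: "g \<in> square_integrable M" and f: "f \<in> square_integrable M"
  shows "(\<lambda>p. g (fst p) * f (snd p)) \<in> square_integrable MM"
    and "l2norm MM (\<lambda>p. g (fst p) * f (snd p)) = l2norm M g * l2norm M f"
proof -
  note [measurable] = sqintD(1)[OF f] sqintD(1)[OF g]
  note * = integrable_product[OF sqintD(2)[OF g] sqintD(2)[OF f]]
  have eq: "(cmod (g a * f b))\<^sup>2 = (cmod (g a))\<^sup>2 * (cmod (f b))\<^sup>2" for a b
    by (simp add: norm_mult power_mult_distrib)
  have "(\<lambda>p. g (fst p) * f (snd p)) \<in> borel_measurable MM" by measurable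
  then show "(\<lambda>p. g (fst p) * f (snd p)) \<in> square_integrable MM"
    using *(1) by (simp add: square_integrable_def eq)
  show "l2norm MM (\<lambda>p. g (fst p) * f (snd p)) = l2norm M g * l2norm M f"
    using *(2) by (simp add: l2norm_def eq real_sqrt_mult)
qed

lemma bmeas_product:
  assumes "g \<in> bmeas M" "f \<in> bmeas M"
  shows "(\<lambda>p. g (fst p) * f (snd p)) \<in> bmeas MM"
proof (rule bmeas_mult)
  show "(\<lambda>p. g (fst p)) \<in> bmeas MM"
  proof -
    obtain C where C: "g \<in> borel_measurable M" "\<And>x. x \<in> space M \<Longrightarrow> cmod (g x) \<le> C"
      using assms(1) by (rule bmeasE) blast
    note [measurable] = C(1)
    show ?thesis by (rule bmeasI[of _ _ C]) (auto simp: space_pair_measure C(2))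
  qed
  obtain C where C: "f \<in> borel_measurable M" "\<And>x. x \<in> space M \<Longrightarrow> cmod (f x) \<le> C"
    using assms(2) by (rule bmeasE) blast
  note [measurable] = C(1)
  show "(\<lambda>p. f (snd p)) \<in> bmeas MM"
    by (rule bmeasI[of _ _ C]) (auto simp: space_pair_measure C(2))
qed

lemma bounded_kernel_sqint:
  "k \<in> bmeas MM \<Longrightarrow> k \<in> square_integrable MM"
  by (rule finite_measure.bmeas_sqint[OF finite_measure_pair_self])

lemma kernel_product_integrable:
  assumes k: "k \<in> bmeas MM"
    and f: "f \<in> square_integrable M" and g: "g \<in> square_integrable M"
  shows "integrable MM (\<lambda>p. k p * (cnj (g (fst p)) * f (snd p)))"
  by (rule sqint_mult_integrable[OF bounded_kernel_sqint[OF k]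
        sqint_product(1)[OF sqint_cnj[OF g] f]])

lemma kernel_section:
  assumes k: "k \<in> bmeas MM" and s: "s \<in> space M"
  shows "(\<lambda>t. k (s, t)) \<in> bmeas M"
proof -
  obtain C where C: "k \<in> borel_measurable MM" "\<And>x. x \<in> space MM \<Longrightarrow> cmod (k x) \<le> C"
    using k by (rule bmeasE) blast
  show ?thesis
  proof (rule bmeasI)
    show "(\<lambda>t. k (s, t)) \<in> borel_measurable M"
      using measurable_compose[OF measurable_Pair1'[OF s] C(1)] .
    show "cmod (k (s, t)) \<le> C" if "t \<in> space M" for t
      using C(2) s that by (auto simp: space_pair_measure)
  qed
qed

lemma kernel_image_bounded:
  assumes k: "k \<in> bmeas MM" and f: "f \<in> square_integrable M"
  shows "(\<lambda>s. \<integral>t. k (s, t) * f t \<partial>M) \<in> bmeas M"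
proof -
  obtain C where C: "k \<in> borel_measurable MM" "0 \<le> C" "\<And>x. x \<in> space MM \<Longrightarrow> cmod (k x) \<le> C"
    using k by (rule bmeasE) blast
  note [measurable] = C(1) sqintD(1)[OF f]
  show ?thesis
  proof (rule bmeasI)
    show "(\<lambda>s. \<integral>t. k (s, t) * f t \<partial>M) \<in> borel_measurable M" by measurable
    fix s assume s: "s \<in> space M"
    note ks = bmeas_sqint[OF kernel_section[OF k s]]
    have "cmod (\<integral>t. k (s, t) * f t \<partial>M) \<le> l2norm M (\<lambda>t. k (s, t)) * l2norm M f"
      by (rule cauchy_schwarz[OF ks f])
    also have "\<dots> \<le> l2norm M (\<lambda>_. complex_of_real C) * l2norm M f"
      using C(2,3) s by (intro mult_right_mono l2norm_mono ks bmeas_sqint bmeas_const AE_I2)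
        (auto simp: space_pair_measure)
    finally show "cmod (\<integral>t. k (s, t) * f t \<partial>M) \<le> l2norm M (\<lambda>_. complex_of_real C) * l2norm M f" .
  qed
qed

text \<open>The Hilbert-Schmidt bound: Cauchy-Schwarz in \<open>t\<close> for each \<open>s\<close>, then integration over \<open>s\<close>.\<close>

lemma kernel_image_norm:
  assumes k: "k \<in> bmeas MM" and f: "f \<in> square_integrable M"
  shows "l2norm M (\<lambda>s. \<integral>t. k (s, t) * f t \<partial>M) \<le> l2norm MM k * l2norm M f"
proof -
  interpret P: pair_sigma_finite M M by (rule pair_sigma_finite_self)
  let ?F = "\<lambda>s. \<integral>t. k (s, t) * f t \<partial>M"
  note ik = sqintD(2)[OF bounded_kernel_sqint[OF k]]
  have "(l2norm M ?F)\<^sup>2 = (\<integral>s. (cmod (?F s))\<^sup>2 \<partial>M)" by (rule l2norm_power2)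
  also have "\<dots> \<le> (\<integral>s. (\<integral>t. (cmod (k (s, t)))\<^sup>2 \<partial>M) * (l2norm M f)\<^sup>2 \<partial>M)"
  proof (rule integral_mono)
    show "integrable M (\<lambda>s. (cmod (?F s))\<^sup>2)"
      by (rule sqintD(2)[OF bmeas_sqint[OF kernel_image_bounded[OF k f]]])
    show "integrable M (\<lambda>s. (\<integral>t. (cmod (k (s, t)))\<^sup>2 \<partial>M) * (l2norm M f)\<^sup>2)"
      using P.integrable_fst'[OF ik] by simp
    fix s assume s: "s \<in> space M"
    have "(cmod (?F s))\<^sup>2 \<le> (l2norm M (\<lambda>t. k (s, t)) * l2norm M f)\<^sup>2"
      by (intro power_mono cauchy_schwarz bmeas_sqint[OF kernel_section[OF k s]] f) simp
    then show "(cmod (?F s))\<^sup>2 \<le> (\<integral>t. (cmod (k (s, t)))\<^sup>2 \<partial>M) * (l2norm M f)\<^sup>2"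
      by (simp only: power_mult_distrib l2norm_power2[of M "\<lambda>t. k (s, t)"])
  qed
  also have "\<dots> = (l2norm MM k * l2norm M f)\<^sup>2"
    using P.integral_fst'[OF ik] by (simp add: power_mult_distrib l2norm_power2[of "MM" k])
  finally show ?thesis by (rule power2_le_imp_le) simp
qed

lemma kernel_op:
  assumes k: "k \<in> bmeas MM"
  shows kernel_op_BH: "kernel_op M k \<in> BH M"
    and kernel_op_class: "\<And>f. f \<in> square_integrable M \<Longrightarrow>
      kernel_op M k (ae_class M f) = ae_class M (\<lambda>s. \<integral>t. k (s, t) * f t \<partial>M)"
proof -
  define F where "F f = (\<lambda>s. \<integral>t. k (s, t) * f t \<partial>M)" for f :: "'a \<Rightarrow> complex"
  have eq: "kernel_op M k = (\<lambda>\<xi>\<in>L2 M. ae_class M (F (rep \<xi>)))" by (simp add: kernel_op_def F_def)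
  note ks = bmeas_sqint[OF kernel_section[OF k]]
  have sq: "F f \<in> square_integrable M" if "f \<in> square_integrable M" for f
    unfolding F_def by (rule bmeas_sqint[OF kernel_image_bounded[OF k that]])
  have cong: "AE x in M. F f x = F g x"
    if f: "f \<in> square_integrable M" and g: "g \<in> square_integrable M" and eq: "AE x in M. f x = g x" for f g
    unfolding F_def
  proof (rule AE_I2, rule integral_cong_AE)
    fix s assume s: "s \<in> space M"
    note [measurable] = sqintD(1)[OF f] sqintD(1)[OF g] sqintD(1)[OF ks[OF s]]
    show "(\<lambda>t. k (s, t) * f t) \<in> borel_measurable M" "(\<lambda>t. k (s, t) * g t) \<in> borel_measurable M" by measurable
    show "AE t in M. k (s, t) * f t = k (s, t) * g t" using eq by eventually_elim simp
  qed
  have add: "AE x in M. F (\<lambda>x. f x + g x) x = F f x + F g x"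
    if f: "f \<in> square_integrable M" and g: "g \<in> square_integrable M" for f g
  proof (rule AE_I2)
    fix s assume s: "s \<in> space M"
    show "F (\<lambda>x. f x + g x) s = F f s + F g s"
      unfolding F_def distrib_left
      by (rule Bochner_Integration.integral_add) (rule sqint_mult_integrable[OF ks[OF s]], rule f g)+
  qed
  have scale: "AE x in M. F (\<lambda>x. c * f x) x = c * F f x" for c f
    by (rule AE_I2) (simp add: F_def mult.left_commute)
  have bd: "l2norm M (F f) \<le> l2norm MM k * l2norm M f" if "f \<in> square_integrable M" for f
    unfolding F_def by (rule kernel_image_norm[OF k that])
  note * = operator_of_function_map[of M F, OF sq cong add scale bd]
  show "kernel_op M k \<in> BH M" unfolding eq by (rule *(1))
  show "kernel_op M k (ae_class M f) = ae_class M (\<lambda>s. \<integral>t. k (s, t) * f t \<partial>M)"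
    if "f \<in> square_integrable M" for f
  proof -
    have "(\<lambda>\<xi>\<in>L2 M. ae_class M (F (rep \<xi>))) (ae_class M f) = ae_class M (F f)"
      by (rule *(2)) (use that in auto)
    then show ?thesis by (simp only: eq F_def)
  qed
qed

lemma form_kernel_op:
  assumes k: "k \<in> bmeas MM"
    and f: "f \<in> square_integrable M" and g: "g \<in> square_integrable M"
  shows "form M (kernel_op M k) f g = (\<integral>p. k p * (cnj (g (fst p)) * f (snd p)) \<partial>MM)"
proof -
  interpret P: pair_sigma_finite M M by (rule pair_sigma_finite_self)
  have "form M (kernel_op M k) f g = (\<integral>s. (\<integral>t. k (s, t) * f t \<partial>M) * cnj (g s) \<partial>M)"
    by (rule form_class[where T = "kernel_op M k", OF kernel_op_class[OF k f]
          bmeas_sqint[OF kernel_image_bounded[OF k f]] g])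
  also have "\<dots> = (\<integral>s. (\<integral>t. k (s, t) * (cnj (g s) * f t) \<partial>M) \<partial>M)"
  proof (rule Bochner_Integration.integral_cong[OF refl])
    fix s
    have "(\<integral>t. k (s, t) * (cnj (g s) * f t) \<partial>M) = (\<integral>t. (k (s, t) * f t) * cnj (g s) \<partial>M)"
      by (simp only: mult_ac)
    then show "(\<integral>t. k (s, t) * f t \<partial>M) * cnj (g s) = (\<integral>t. k (s, t) * (cnj (g s) * f t) \<partial>M)" by simp
  qed
  also have "\<dots> = (\<integral>p. k p * (cnj (g (fst p)) * f (snd p)) \<partial>MM)"
    using P.integral_fst'[OF kernel_product_integrable[OF k f g]] by simp
  finally show ?thesis .
qed

lemma op_norm_kernel_op:
  assumes k: "k \<in> bmeas MM"
  shows "op_norm M (kernel_op M k) \<le> l2norm MM k"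
proof (rule op_norm_leI[OF kernel_op_BH[OF k]])
  fix f g assume f: "f \<in> square_integrable M" and g: "g \<in> square_integrable M"
  have "cmod (form M (kernel_op M k) f g) \<le> l2norm MM k * (l2norm M (\<lambda>x. cnj (g x)) * l2norm M f)"
    unfolding form_kernel_op[OF k f g] sqint_product(2)[OF sqint_cnj[OF g] f, symmetric]
    by (rule cauchy_schwarz[OF bounded_kernel_sqint[OF k]
          sqint_product(1)[OF sqint_cnj[OF g] f]])
  then show "cmod (form M (kernel_op M k) f g) \<le> l2norm MM k * l2norm M f * l2norm M g"
    by (simp add: mult_ac)
qed simp

lemma kernel_op_add:
  assumes k: "k \<in> bmeas MM" and l: "l \<in> bmeas MM"
  shows "kernel_op M (\<lambda>p. k p + l p) = op_add M (kernel_op M k) (kernel_op M l)"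
proof (rule op_eqI)
  note kl = bmeas_add[OF k l]
  show "kernel_op M (\<lambda>p. k p + l p) \<in> BH M" by (rule kernel_op_BH[OF kl])
  show "op_add M (kernel_op M k) (kernel_op M l) \<in> BH M" by (intro op_add_BH kernel_op_BH k l)
  fix f g assume f: "f \<in> square_integrable M" and g: "g \<in> square_integrable M"
  show "form M (kernel_op M (\<lambda>p. k p + l p)) f g = form M (op_add M (kernel_op M k) (kernel_op M l)) f g"
    by (simp add: form_op_add kernel_op_BH k l f g form_kernel_op kl distrib_right kernel_product_integrable)
qed

lemma kernel_op_scale:
  assumes k: "k \<in> bmeas MM"
  shows "kernel_op M (\<lambda>p. c * k p) = op_scale M c (kernel_op M k)"
proof (rule op_eqI)
  note ck = bmeas_scale[OF k, of c]
  show "kernel_op M (\<lambda>p. c * k p) \<in> BH M" by (rule kernel_op_BH[OF ck])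
  show "op_scale M c (kernel_op M k) \<in> BH M" by (intro op_scale_BH kernel_op_BH k)
  fix f g assume f: "f \<in> square_integrable M" and g: "g \<in> square_integrable M"
  show "form M (kernel_op M (\<lambda>p. c * k p)) f g = form M (op_scale M c (kernel_op M k)) f g"
    by (simp add: form_op_scale kernel_op_BH k f g form_kernel_op ck mult.assoc)
qed

lemma kernel_op_cong_AE:
  assumes k: "k \<in> bmeas MM" and l: "l \<in> bmeas MM"
    and eq: "AE p in MM. k p = l p"
  shows "kernel_op M k = kernel_op M l"
proof (rule op_eqI[OF kernel_op_BH[OF k] kernel_op_BH[OF l]])
  fix f g assume f: "f \<in> square_integrable M" and g: "g \<in> square_integrable M"
  show "form M (kernel_op M k) f g = form M (kernel_op M l) f g"
    unfolding form_kernel_op[OF k f g] form_kernel_op[OF l f g]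
  proof (rule integral_cong_AE)
    show "AE p in MM. k p * (cnj (g (fst p)) * f (snd p)) = l p * (cnj (g (fst p)) * f (snd p))"
      using eq by eventually_elim simp
  qed (intro borel_measurable_integrable kernel_product_integrable k l f g)+
qed

text \<open>Through this identity the bimodule property of a map becomes a statement about kernels.\<close>

lemma kernel_op_bimodule:
  assumes k: "k \<in> bmeas MM" and a: "a \<in> bmeas M" and b: "b \<in> bmeas M"
  shows "kernel_op M (\<lambda>p. k p * (a (fst p) * b (snd p)))
    = op_mult M (mult_op M a) (op_mult M (kernel_op M k) (mult_op M b))"
proof (rule op_eqI)
  note k' = bmeas_mult[OF k bmeas_product[OF a b]]
  note ab = bmeas_Linfty[OF a] bmeas_Linfty[OF b]
  show "kernel_op M (\<lambda>p. k p * (a (fst p) * b (snd p))) \<in> BH M" by (rule kernel_op_BH[OF k'])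
  show "op_mult M (mult_op M a) (op_mult M (kernel_op M k) (mult_op M b)) \<in> BH M"
    by (intro op_mult_BH mult_op_BH kernel_op_BH k ab)
  fix f g assume f: "f \<in> square_integrable M" and g: "g \<in> square_integrable M"
  have "form M (op_mult M (mult_op M a) (op_mult M (kernel_op M k) (mult_op M b))) f g
    = form M (kernel_op M k) (\<lambda>x. b x * f x) (\<lambda>x. cnj (a x) * g x)"
    by (rule form_mult_op_both[OF kernel_op_BH[OF k] ab f g])
  also have "\<dots> = (\<integral>p. k p * (cnj (cnj (a (fst p)) * g (fst p)) * (b (snd p) * f (snd p))) \<partial>MM)"
    by (rule form_kernel_op[OF k]) (intro Linfty_mult_sqint Linfty_cnj ab f g)+
  also have "\<dots> = (\<integral>p. k p * (a (fst p) * b (snd p)) * (cnj (g (fst p)) * f (snd p)) \<partial>MM)"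
    by (rule Bochner_Integration.integral_cong) (simp_all add: mult_ac)
  finally show "form M (kernel_op M (\<lambda>p. k p * (a (fst p) * b (snd p)))) f g
    = form M (op_mult M (mult_op M a) (op_mult M (kernel_op M k) (mult_op M b))) f g"
    by (simp only: form_kernel_op[OF k' f g])
qed

end

section \<open>The symbol of a bounded bimodule map\<close>

locale bounded_bimodule_map = finite_measure M for M :: "'a measure" +
  fixes P :: "'a oper \<Rightarrow> 'a oper" and K :: real
  assumes linear: "linear_map M P" and bimodule: "bimodule_map M P"
    and K_nonneg: "0 \<le> K" and bounded: "\<And>T. T \<in> BH M \<Longrightarrow> op_norm M (P T) \<le> K * op_norm M T"
begin

lemma P_BH: "T \<in> BH M \<Longrightarrow> P T \<in> BH M"
  using linear by (auto simp: linear_map_def)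

lemma P_add: "S \<in> BH M \<Longrightarrow> T \<in> BH M \<Longrightarrow> P (op_add M S T) = op_add M (P S) (P T)"
  using linear by (auto simp: linear_map_def)

lemma P_scale: "T \<in> BH M \<Longrightarrow> P (op_scale M c T) = op_scale M c (P T)"
  using linear by (auto simp: linear_map_def)

lemma P_bimodule:
  assumes "T \<in> BH M" "a \<in> Linfty M" "b \<in> Linfty M"
  shows "P (op_mult M (mult_op M a) (op_mult M T (mult_op M b))) = op_mult M (mult_op M a) (op_mult M (P T) (mult_op M b))"
  using bimodule assms by (auto simp: bimodule_map_def mult_algebra_def)

text \<open>Riesz representation for \<open>k \<mapsto> \<langle>P (T\<^sub>k) 1, 1\<rangle>\<close>. The form at \<open>f\<close> and \<open>g\<close> is the same functional at the kernel
  \<open>k(s, t) g(s)\<^sup>* f(t)\<close>, because \<open>P\<close> commutes with multiplication operators on either side.\<close>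

lemma symbol_exists:
  obtains \<phi> where "\<phi> \<in> square_integrable MM"
    "\<And>k f g. k \<in> bmeas MM \<Longrightarrow> f \<in> bmeas M \<Longrightarrow> g \<in> bmeas M \<Longrightarrow>
      form M (P (kernel_op M k)) f g = (\<integral>p. \<phi> p * (k p * (cnj (g (fst p)) * f (snd p))) \<partial>MM)"
proof -
  let ?one = "\<lambda>_::'a. 1::complex"
  have one: "?one \<in> square_integrable M" by (intro bmeas_sqint bmeas_const)
  define \<Lambda> where "\<Lambda> k = form M (P (kernel_op M k)) ?one ?one" for k
  obtain \<phi> where phi: "\<phi> \<in> square_integrable MM"
    "\<And>k. k \<in> bmeas MM \<Longrightarrow> \<Lambda> k = (\<integral>p. \<phi> p * k p \<partial>MM)"
  proof (rule finite_measure.riesz_representation_L2[OF finite_measure_pair_self, of \<Lambda> "K * (l2norm M ?one)\<^sup>2"])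
    fix k l assume k: "k \<in> bmeas MM" and l: "l \<in> bmeas MM"
    show "\<Lambda> (\<lambda>x. k x + l x) = \<Lambda> k + \<Lambda> l"
      unfolding \<Lambda>_def by (simp add: kernel_op_add k l P_add kernel_op_BH form_op_add P_BH one)
  next
    fix c k assume k: "k \<in> bmeas MM"
    show "\<Lambda> (\<lambda>x. c * k x) = c * \<Lambda> k"
      unfolding \<Lambda>_def by (simp add: kernel_op_scale k P_scale kernel_op_BH form_op_scale P_BH one)
  next
    fix k assume k: "k \<in> bmeas MM"
    have "op_norm M (P (kernel_op M k)) \<le> K * l2norm MM k"
      using bounded[OF kernel_op_BH[OF k]] mult_left_mono[OF op_norm_kernel_op[OF k] K_nonneg] by linarith
    from form_norm_le_of_bound[OF P_BH[OF kernel_op_BH[OF k]] this one one]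
    show "cmod (\<Lambda> k) \<le> K * (l2norm M ?one)\<^sup>2 * l2norm MM k"
      unfolding \<Lambda>_def power2_eq_square by (simp only: mult_ac)
  qed (auto simp: K_nonneg)
  show ?thesis
  proof (rule that[OF phi(1)])
    fix k f g assume k: "k \<in> bmeas MM" and f: "f \<in> bmeas M" and g: "g \<in> bmeas M"
    note g' = bmeas_cnj[OF g]
    note L = bmeas_Linfty[OF g'] bmeas_Linfty[OF f]
    have "form M (P (kernel_op M k)) f g
      = form M (op_mult M (mult_op M (\<lambda>x. cnj (g x))) (op_mult M (P (kernel_op M k)) (mult_op M f))) ?one ?one"
      by (simp add: form_mult_op_both[OF P_BH[OF kernel_op_BH[OF k]] L one one])
    also have "\<dots> = \<Lambda> (\<lambda>p. k p * (cnj (g (fst p)) * f (snd p)))"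
      unfolding \<Lambda>_def by (simp only: kernel_op_bimodule[OF k g' f] P_bimodule[OF kernel_op_BH[OF k] L])
    also have "\<dots> = (\<integral>p. \<phi> p * (k p * (cnj (g (fst p)) * f (snd p))) \<partial>MM)"
      by (rule phi(2)[OF bmeas_mult[OF k bmeas_product[OF g' f]]])
    finally show "form M (P (kernel_op M k)) f g = (\<integral>p. \<phi> p * (k p * (cnj (g (fst p)) * f (snd p))) \<partial>MM)" .
  qed
qed

text \<open>\<open>P\<close> multiplies kernels by \<open>\<phi>\<close>, so applying it twice gives \<open>\<phi>\<^sup>2 = \<phi>\<close>. As \<open>\<phi>\<close> is only known to be
  square-integrable, this is tested with kernels supported where \<open>\<phi>\<close> is bounded, for which
  the product with \<open>\<phi>\<close> is a bounded kernel again.\<close>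

lemma idempotent_symbol:
  assumes idem: "\<And>T. T \<in> BH M \<Longrightarrow> P (P T) = P T"
  obtains E where "E \<in> sets MM"
    "\<And>k. k \<in> bmeas MM \<Longrightarrow> P (kernel_op M k) = kernel_op M (\<lambda>p. indicator E p * k p)"
proof -
  obtain \<phi> where phi: "\<phi> \<in> square_integrable MM"
    and P_phi: "\<And>k f g. k \<in> bmeas MM \<Longrightarrow> f \<in> bmeas M \<Longrightarrow> g \<in> bmeas M \<Longrightarrow>
      form M (P (kernel_op M k)) f g = (\<integral>p. \<phi> p * (k p * (cnj (g (fst p)) * f (snd p))) \<partial>MM)"
    using symbol_exists by blast
  note mphi [measurable] = sqintD(1)[OF phi]
  note sq = bmeas_sqint
  have P_kernel: "P (kernel_op M k) = kernel_op M l"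
    if k: "k \<in> bmeas MM" and l: "l \<in> bmeas MM"
      and eq: "AE p in MM. \<phi> p * k p = l p" for k l
  proof (rule op_eqI_bounded[OF P_BH[OF kernel_op_BH[OF k]] kernel_op_BH[OF l]])
    fix f g assume f: "f \<in> bmeas M" and g: "g \<in> bmeas M"
    show "form M (P (kernel_op M k)) f g = form M (kernel_op M l) f g"
      unfolding P_phi[OF k f g] form_kernel_op[OF l sq[OF f] sq[OF g]]
    proof (rule integral_cong_AE)
      have [measurable]: "k \<in> borel_measurable MM" "l \<in> borel_measurable MM"
        "f \<in> borel_measurable M" "g \<in> borel_measurable M"
        using k l f g by (auto simp: bmeas_def)
      show "(\<lambda>p. \<phi> p * (k p * (cnj (g (fst p)) * f (snd p)))) \<in> borel_measurable MM"
        "(\<lambda>p. l p * (cnj (g (fst p)) * f (snd p))) \<in> borel_measurable MM" by measurable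
      show "AE p in MM. \<phi> p * (k p * (cnj (g (fst p)) * f (snd p))) = l p * (cnj (g (fst p)) * f (snd p))"
        using eq by eventually_elim (simp add: mult.assoc[symmetric])
    qed
  qed
  let ?one = "\<lambda>_::'a. 1::complex"
  have one: "?one \<in> bmeas M" by (rule bmeas_const)
  have AEn: "AE p in MM. cmod (\<phi> p) \<le> real n \<longrightarrow> \<phi> p * \<phi> p - \<phi> p = 0" for n
  proof -
    \<comment> \<open>Apply \<open>P\<close> twice to the kernel \<open>k\<close>, the conjugate of \<open>\<phi>\<^sup>2 - \<phi>\<close> cut off where \<open>\<phi>\<close> is large.\<close>
    define d where "d p = (if cmod (\<phi> p) \<le> real n then \<phi> p * \<phi> p - \<phi> p else 0)" for p
    have [measurable]: "d \<in> borel_measurable MM" unfolding d_def[abs_def] by measurable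
    have d: "d \<in> bmeas MM"
    proof (rule bmeasI)
      show "cmod (d p) \<le> real n * real n + real n" for p
        by (auto simp: d_def norm_mult intro!: order_trans[OF norm_triangle_ineq4] add_mono mult_mono)
    qed measurable
    define k where "k p = cnj (d p)" for p
    have k: "k \<in> bmeas MM" unfolding k_def[abs_def] by (rule bmeas_cnj[OF d])
    have [measurable]: "k \<in> borel_measurable MM" using k by (simp add: bmeas_def)
    define l where "l p = \<phi> p * k p" for p
    have tr: "l = (\<lambda>p. truncate \<phi> n p * k p)"
      by (auto simp: l_def k_def d_def truncate_def)
    have l: "l \<in> bmeas MM"
      unfolding tr by (intro bmeas_mult truncate_bounded k mphi)
    have "P (kernel_op M k) = kernel_op M l" by (rule P_kernel[OF k l]) (simp add: l_def)
    then have "P (kernel_op M l) = P (kernel_op M k)" using idem[OF kernel_op_BH[OF k]] by simp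
    then have "(\<integral>p. \<phi> p * l p \<partial>MM) = (\<integral>p. \<phi> p * k p \<partial>MM)"
      using P_phi[OF l one one] P_phi[OF k one one] by simp
    moreover have "integrable MM (\<lambda>p. \<phi> p * l p)" "integrable MM (\<lambda>p. \<phi> p * k p)"
      by (intro sqint_mult_integrable phi bounded_kernel_sqint k l)+
    ultimately have "(\<integral>p. \<phi> p * l p - \<phi> p * k p \<partial>MM) = 0" by simp
    moreover have "\<phi> p * l p - \<phi> p * k p = d p * cnj (d p)" for p
      by (auto simp: l_def k_def d_def algebra_simps)
    ultimately have "complex_of_real ((l2norm MM d)\<^sup>2) = 0"
      by (simp only: integral_self_cnj[symmetric])
    then have "AE p in MM. d p = 0"
      by (intro l2norm_eq_0 bounded_kernel_sqint d) simp
    then show ?thesis by eventually_elim (auto simp: d_def)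
  qed
  have AE01: "AE p in MM. \<phi> p = 0 \<or> \<phi> p = 1"
  proof -
    have "AE p in MM. \<forall>n. cmod (\<phi> p) \<le> real n \<longrightarrow> \<phi> p * \<phi> p - \<phi> p = 0"
      unfolding AE_all_countable using AEn by blast
    then show ?thesis
    proof eventually_elim
      case (elim p)
      obtain n where "cmod (\<phi> p) \<le> real n" using real_arch_simple by blast
      then have "\<phi> p * \<phi> p - \<phi> p = 0" using elim by blast
      then show ?case by simp
    qed
  qed
  define E where "E = {p \<in> space MM. \<phi> p = 1}"
  have E [measurable]: "E \<in> sets MM" unfolding E_def by measurable
  show ?thesis
  proof (rule that[OF E])
    fix k assume k: "k \<in> bmeas MM"
    have eq: "AE p in MM. \<phi> p * k p = indicator E p * k p"
      using AE01 AE_space by eventually_elim (auto simp: E_def)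
    show "P (kernel_op M k) = kernel_op M (\<lambda>p. indicator E p * k p)"
      by (rule P_kernel[OF k bmeas_mult[OF bmeas_indicator[OF E] k] eq])
  qed
qed

end

section \<open>Approximation along a generating sequence of finite partitions\<close>

text \<open>Every open set is a countable union of members of a countable base, so the base generates the
  sigma-algebra.\<close>

lemma standard_borel_generator:
  assumes "standard_borel M"
  obtains B :: "nat \<Rightarrow> 'a set" where "range B \<subseteq> sets M" "sets M = sigma_sets (space M) (range B)"
proof -
  obtain T where T: "second_countable T" "topspace T = space M" "sets M = sigma_sets (space M) {U. openin T U}"
    using assms unfolding standard_borel_def by blast
  obtain \<B> where B: "countable \<B>" "\<And>V. V \<in> \<B> \<Longrightarrow> openin T V"
    "\<And>U x. openin T U \<Longrightarrow> x \<in> U \<Longrightarrow> \<exists>V\<in>\<B>. x \<in> V \<and> V \<subseteq> U"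
    using T(1) unfolding second_countable_def by metis
  define \<C> where "\<C> = insert {} \<B>"
  have C: "countable \<C>" "\<C> \<noteq> {}" "\<And>V. V \<in> \<C> \<Longrightarrow> openin T V"
    using B(1,2) by (auto simp: \<C>_def)
  have rng: "range (from_nat_into \<C>) = \<C>" using C by (simp add: range_from_nat_into)
  have "sigma_sets (space M) {U. openin T U} = sigma_sets (space M) \<C>"
  proof (rule sigma_sets_eqI)
    fix U assume "U \<in> {U. openin T U}"
    then have U: "openin T U" by simp
    have "U = \<Union>{V \<in> \<B>. V \<subseteq> U}" using B(3)[OF U] by blast
    moreover have "\<Union>{V \<in> \<B>. V \<subseteq> U} \<in> sigma_sets (space M) \<C>"
    proof (rule sigma_sets_UNION)
      show "countable {V \<in> \<B>. V \<subseteq> U}" by (rule countable_subset[OF _ B(1)]) blast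
      show "b \<in> sigma_sets (space M) \<C>" if "b \<in> {V \<in> \<B>. V \<subseteq> U}" for b
        using that by (intro sigma_sets.Basic) (auto simp: \<C>_def)
    qed
    ultimately show "U \<in> sigma_sets (space M) \<C>" by simp
  next
    fix V assume "V \<in> \<C>"
    then show "V \<in> sigma_sets (space M) {U. openin T U}" using C(3) by (auto intro: sigma_sets.Basic)
  qed
  then have "sets M = sigma_sets (space M) (range (from_nat_into \<C>))" by (simp add: T(3) rng)
  moreover have "range (from_nat_into \<C>) \<subseteq> sets M"
    unfolding rng using C(3) by (auto simp: T(3) intro: sigma_sets.Basic)
  ultimately show ?thesis using that by blast
qed

lemma form_sum_left:
  assumes T: "T \<in> BH M" and f: "\<And>i. i \<in> S \<Longrightarrow> f i \<in> square_integrable M" and g: "g \<in> square_integrable M"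
  shows "form M T (\<lambda>x. \<Sum>i\<in>S. f i x) g = (\<Sum>i\<in>S. form M T (f i) g)"
    and "(\<lambda>x. \<Sum>i\<in>S. f i x) \<in> square_integrable M"
proof -
  have z: "form M T (\<lambda>_. 0) g = 0" using form_scale_left[OF T zero_sqint g, of 0] by simp
  have "form M T (\<lambda>x. \<Sum>i\<in>S. f i x) g = (\<Sum>i\<in>S. form M T (f i) g) \<and> (\<lambda>x. \<Sum>i\<in>S. f i x) \<in> square_integrable M"
    using f
  proof (induction S rule: infinite_finite_induct)
    case (insert i S)
    then have *: "f i \<in> square_integrable M" "(\<lambda>x. \<Sum>i\<in>S. f i x) \<in> square_integrable M" by auto
    show ?case
      unfolding sum.insert[OF insert.hyps]
      using insert form_add_left[OF T * g] sqint_add[OF *] by auto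
  qed (auto simp: z zero_sqint)
  then show "form M T (\<lambda>x. \<Sum>i\<in>S. f i x) g = (\<Sum>i\<in>S. form M T (f i) g)"
    and "(\<lambda>x. \<Sum>i\<in>S. f i x) \<in> square_integrable M" by auto
qed

lemma form_sum_right:
  assumes T: "T \<in> BH M" and f: "\<And>i. i \<in> S \<Longrightarrow> f i \<in> square_integrable M" and g: "g \<in> square_integrable M"
  shows "form M T g (\<lambda>x. \<Sum>i\<in>S. f i x) = (\<Sum>i\<in>S. form M T g (f i))"
proof -
  have z: "form M T g (\<lambda>_. 0) = 0" using form_scale_right[OF T zero_sqint g, of 0] by simp
  show ?thesis
    using f
  proof (induction S rule: infinite_finite_induct)
    case (insert i S)
    then have "(\<lambda>x. \<Sum>i\<in>S. f i x) \<in> square_integrable M" by (intro form_sum_left(2)[OF T _ g]) auto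
    with insert show ?case
      unfolding sum.insert[OF insert.hyps] using form_add_right[OF T _ _ g, of "f i" "\<lambda>x. \<Sum>i\<in>S. f i x"] by simp
  qed (auto simp: z)
qed

lemma (in finite_measure) sqint_induct:
  assumes f: "f \<in> square_integrable M"
    and ind: "\<And>A. A \<in> sets M \<Longrightarrow> Q (indicator A)"
    and add: "\<And>f g. f \<in> square_integrable M \<Longrightarrow> g \<in> square_integrable M \<Longrightarrow> Q f \<Longrightarrow> Q g \<Longrightarrow> Q (\<lambda>x. f x + g x)"
    and scale: "\<And>c f. f \<in> square_integrable M \<Longrightarrow> Q f \<Longrightarrow> Q (\<lambda>x. c * f x)"
    and lim: "\<And>f F. f \<in> square_integrable M \<Longrightarrow> (\<And>n. F n \<in> square_integrable M) \<Longrightarrow> (\<And>n. Q (F n)) \<Longrightarrow>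
      (\<lambda>n. l2norm M (\<lambda>x. F n x - f x)) \<longlonglongrightarrow> 0 \<Longrightarrow> Q f"
  shows "Q f"
proof -
  obtain Y A where Y: "\<And>i. finite (Y i)" and A: "\<And>i y. A i y \<in> sets M"
    and le: "\<And>i x. x \<in> space M \<Longrightarrow> cmod (\<Sum>y\<in>Y i. y * indicator (A i y) x) \<le> cmod (2 * f x)"
    and ptw: "\<And>x. x \<in> space M \<Longrightarrow> (\<lambda>i. \<Sum>y\<in>Y i. y * indicator (A i y) x) \<longlonglongrightarrow> f x"
    by (rule simple_approximation[OF sqintD(1)[OF f]]) blast
  define r where "r i x = (\<Sum>y\<in>Y i. y * indicator (A i y) x)" for i x
  have si: "indicator B \<in> square_integrable M" if "B \<in> sets M" for B
    using that by (intro bmeas_sqint bmeas_indicator)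
  have step: "(\<lambda>x. \<Sum>y\<in>Z. y * indicator (A i y) x) \<in> square_integrable M \<and> Q (\<lambda>x. \<Sum>y\<in>Z. y * indicator (A i y) x)"
    if "finite Z" for i Z
    using that
  proof induction
    case empty
    show ?case using scale[OF si[of "{}"] ind[of "{}"], of 0] by (simp add: zero_sqint)
  next
    case (insert y Z)
    have *: "(\<lambda>x. y * indicator (A i y) x) \<in> square_integrable M"
      by (rule sqint_scale[OF si[OF A]])
    have Q: "Q (\<lambda>x. y * indicator (A i y) x)" by (rule scale[OF si[OF A] ind[OF A]])
    show ?case
      unfolding sum.insert[OF insert.hyps]
      using add[OF * _ Q] sqint_add[OF *] insert.IH by blast
  qed
  have r: "r i \<in> square_integrable M" "Q (r i)" for i
    unfolding r_def[abs_def] using step[OF Y] by blast+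
  have "(\<lambda>i. l2norm M (\<lambda>x. r i x - f x)) \<longlonglongrightarrow> 0"
  proof (rule l2norm_dominated[OF f sqint_scale[OF f, of 2]])
    show "r i \<in> borel_measurable M" for i using r(1) by (rule sqintD)
    show "AE x in M. cmod (r i x) \<le> cmod (2 * f x)" for i using le by (auto simp: r_def)
    show "AE x in M. (\<lambda>i. r i x) \<longlonglongrightarrow> f x" using ptw by (auto simp: r_def)
  qed
  then show ?thesis by (rule lim[OF f r])
qed

locale countably_generated_measure = finite_measure M for M :: "'a measure" +
  fixes B :: "nat \<Rightarrow> 'a set"
  assumes B_sets: "range B \<subseteq> sets M" and generated: "sets M = sigma_sets (space M) (range B)"
begin

text \<open>The first \<open>n\<close> generators cut the space into the cells on which \<open>code n\<close> is constant;
  \<open>cyl n F\<close> is the union of the cells with code in \<open>F\<close>.\<close>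

definition code :: "nat \<Rightarrow> 'a \<Rightarrow> nat set" where
  "code n x = {i. i < n \<and> x \<in> B i}"

definition cyl :: "nat \<Rightarrow> nat set set \<Rightarrow> 'a set" where
  "cyl n F = {x \<in> space M. code n x \<in> F}"

lemma code_Pow: "code n x \<in> Pow {..<n}"
  by (auto simp: code_def)

lemma cyl_sets [measurable]: "cyl n F \<in> sets M"
proof -
  have B [measurable]: "B i \<in> sets M" for i using B_sets by blast
  have single: "{x \<in> space M. code n x = a} \<in> sets M" if "a \<in> Pow {..<n}" for a
  proof -
    have "{x \<in> space M. code n x = a} = {x \<in> space M. \<forall>i\<in>{..<n}. x \<in> B i \<longleftrightarrow> i \<in> a}"
      using that by (auto simp: code_def)
    also have "\<dots> \<in> sets M" by measurable
    finally show ?thesis .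
  qed
  have "cyl n F = (\<Union>a\<in>F \<inter> Pow {..<n}. {x \<in> space M. code n x = a})"
    using code_Pow by (auto simp: cyl_def)
  also have "\<dots> \<in> sets M" using single by (intro sets.finite_UN) auto
  finally show ?thesis .
qed

lemma cyl_raise:
  assumes "n \<le> m" shows "cyl n F = cyl m {a. a \<inter> {..<n} \<in> F}"
proof -
  have "code m x \<inter> {..<n} = code n x" for x using assms by (auto simp: code_def)
  then show ?thesis by (auto simp: cyl_def)
qed

definition sdm :: "'a set \<Rightarrow> 'a set \<Rightarrow> real" where
  "sdm A C = measure M ((A - C) \<union> (C - A))"

lemma sdm_commute: "sdm A C = sdm C A"
  by (simp add: sdm_def Un_commute)

lemma sdm_nonneg: "0 \<le> sdm A C"
  by (simp add: sdm_def)

lemma sdm_triangle: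
  assumes [measurable]: "A \<in> sets M" "C \<in> sets M" "D \<in> sets M"
  shows "sdm A D \<le> sdm A C + sdm C D"
proof -
  have "sdm A D \<le> measure M (((A - C) \<union> (C - A)) \<union> ((C - D) \<union> (D - C)))"
    unfolding sdm_def by (rule finite_measure_mono) auto
  also have "\<dots> \<le> sdm A C + sdm C D"
    unfolding sdm_def by (rule measure_Un_le) auto
  finally show ?thesis .
qed

lemma l2norm_indicator_diff:
  assumes [measurable]: "A \<in> sets M" "C \<in> sets M"
  shows "l2norm M (\<lambda>x. indicator A x - indicator C x) = sqrt (sdm A C)"
proof -
  have "l2norm M (\<lambda>x. indicator A x - indicator C x) = l2norm M (indicator ((A - C) \<union> (C - A)))"
    unfolding l2norm_def
    by (intro arg_cong[of _ _ sqrt] Bochner_Integration.integral_cong) (auto simp: indicator_def)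
  also have "\<dots> = sqrt (sdm A C)" unfolding sdm_def by (rule l2norm_indicator) auto
  finally show ?thesis .
qed

text \<open>The sets that cylinders approximate in measure form a sigma-algebra containing the generators.\<close>

lemma cyl_dense:
  assumes "A \<in> sets M" "0 < \<epsilon>"
  obtains n F where "F \<subseteq> Pow {..<n}" "sdm A (cyl n F) < \<epsilon>"
proof -
  define \<D> where "\<D> A \<longleftrightarrow> A \<in> sets M \<and> (\<forall>\<epsilon>>0. \<exists>n F. sdm A (cyl n F) < \<epsilon>)" for A
  have D_un: "\<D> (A \<union> C)" if A: "\<D> A" and C: "\<D> C" for A C
    unfolding \<D>_def
  proof (intro conjI allI impI)
    show "A \<union> C \<in> sets M" using A C by (auto simp: \<D>_def)
    fix \<epsilon> :: real assume "0 < \<epsilon>"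
    then have "0 < \<epsilon> / 2" by simp
    obtain n F where F: "sdm A (cyl n F) < \<epsilon> / 2" using A \<open>0 < \<epsilon> / 2\<close> unfolding \<D>_def by blast
    obtain m G where G: "sdm C (cyl m G) < \<epsilon> / 2" using C \<open>0 < \<epsilon> / 2\<close> unfolding \<D>_def by blast
    let ?k = "max n m"
    let ?H = "{a. a \<inter> {..<n} \<in> F} \<union> {a. a \<inter> {..<m} \<in> G}"
    have H: "cyl ?k ?H = cyl n F \<union> cyl m G"
      using cyl_raise[of n ?k F] cyl_raise[of m ?k G] by (auto simp: cyl_def)
    have "sdm (A \<union> C) (cyl n F \<union> cyl m G) \<le> measure M (((A - cyl n F) \<union> (cyl n F - A)) \<union> ((C - cyl m G) \<union> (cyl m G - C)))"
      unfolding sdm_def using A C by (intro finite_measure_mono) (auto simp: \<D>_def)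
    also have "\<dots> \<le> sdm A (cyl n F) + sdm C (cyl m G)"
      unfolding sdm_def using A C by (intro measure_Un_le) (auto simp: \<D>_def)
    also have "\<dots> < \<epsilon>" using F G by simp
    finally show "\<exists>n F. sdm (A \<union> C) (cyl n F) < \<epsilon>" unfolding H[symmetric] by blast
  qed
  have D_empty: "\<D> {}"
    unfolding \<D>_def
  proof (intro conjI allI impI)
    fix \<epsilon> :: real assume "0 < \<epsilon>"
    have "sdm {} (cyl 0 {}) = 0" by (simp add: sdm_def cyl_def)
    then show "\<exists>n F. sdm {} (cyl n F) < \<epsilon>" using \<open>0 < \<epsilon>\<close> by metis
  qed simp
  have "\<D> A" if "A \<in> sigma_sets (space M) (range B)" for A
    using that
  proof induction
    case (Basic A)
    then obtain i where i: "A = B i" by blast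
    have Bi: "B i \<in> sets M" using B_sets by blast
    have "cyl (Suc i) {a. i \<in> a} = B i"
      using sets.sets_into_space[OF Bi] by (auto simp: cyl_def code_def)
    then have "sdm (B i) (cyl (Suc i) {a. i \<in> a}) = 0" by (simp add: sdm_def)
    then show ?case unfolding \<D>_def i using Bi by metis
  next
    case Empty
    show ?case by (rule D_empty)
  next
    case (Compl A)
    show ?case
      unfolding \<D>_def
    proof (intro conjI allI impI)
      have A: "A \<in> sets M" using Compl.IH by (simp add: \<D>_def)
      then show "space M - A \<in> sets M" by auto
      fix \<epsilon> :: real assume "0 < \<epsilon>"
      then obtain n F where F: "sdm A (cyl n F) < \<epsilon>" using Compl.IH unfolding \<D>_def by blast
      have "((space M - A) - cyl n (- F)) \<union> (cyl n (- F) - (space M - A)) = (A - cyl n F) \<union> (cyl n F - A)"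
        using sets.sets_into_space[OF A] by (auto simp: cyl_def)
      then have "sdm (space M - A) (cyl n (- F)) = sdm A (cyl n F)" by (simp only: sdm_def)
      then show "\<exists>n F. sdm (space M - A) (cyl n F) < \<epsilon>" using F by metis
    qed
  next
    case (Union A)
    have A [measurable]: "A i \<in> sets M" for i using Union.IH by (simp add: \<D>_def)
    have D_fin: "\<D> (\<Union>i<N. A i)" for N
    proof (induction N)
      case 0
      show ?case using D_empty by simp
    next
      case (Suc N)
      then show ?case using D_un[OF Suc Union.IH[of N]] by (simp add: lessThan_Suc Un_commute)
    qed
    let ?U = "\<Union>i. A i"
    have "(\<lambda>N. measure M (\<Union>i<N. A i)) \<longlonglongrightarrow> measure M (\<Union>N. \<Union>i<N. A i)"
      by (rule finite_Lim_measure_incseq) (auto simp: incseq_def intro: less_le_trans)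
    moreover have "(\<Union>N. \<Union>i<N. A i) = ?U" by auto
    ultimately have lim: "(\<lambda>N. measure M (\<Union>i<N. A i)) \<longlonglongrightarrow> measure M ?U" by simp
    show ?case
      unfolding \<D>_def
    proof (intro conjI allI impI)
      show "?U \<in> sets M" by auto
      fix \<epsilon> :: real assume "0 < \<epsilon>"
      then have e2: "0 < \<epsilon> / 2" by simp
      from LIMSEQ_D[OF lim e2] obtain N where N: "\<bar>measure M (\<Union>i<N. A i) - measure M ?U\<bar> < \<epsilon> / 2" by auto
      have "sdm ?U (\<Union>i<N. A i) = measure M (?U - (\<Union>i<N. A i))"
        unfolding sdm_def by (intro arg_cong[of _ _ "measure M"]) auto
      also have "\<dots> = measure M ?U - measure M (\<Union>i<N. A i)"
        by (rule finite_measure_Diff) auto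
      finally have s1: "sdm ?U (\<Union>i<N. A i) < \<epsilon> / 2" using N by linarith
      obtain n F where F: "sdm (\<Union>i<N. A i) (cyl n F) < \<epsilon> / 2" using D_fin[of N] e2 unfolding \<D>_def by blast
      have "sdm ?U (cyl n F) < \<epsilon>"
        using sdm_triangle[of ?U "\<Union>i<N. A i" "cyl n F"] s1 F by simp
      then show "\<exists>n F. sdm ?U (cyl n F) < \<epsilon>" by blast
    qed
  qed
  then have "\<D> A" using assms(1) generated by blast
  then obtain n F where F: "sdm A (cyl n F) < \<epsilon>" using assms(2) unfolding \<D>_def by blast
  have "cyl n (F \<inter> Pow {..<n}) = cyl n F" using code_Pow by (auto simp: cyl_def)
  then show ?thesis using that[of "F \<inter> Pow {..<n}" n] F by auto
qed

definition cell_integral :: "nat \<Rightarrow> ('a \<Rightarrow> complex) \<Rightarrow> nat set \<Rightarrow> complex" where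
  "cell_integral n f a = (\<integral>x. indicator (cyl n {a}) x * f x \<partial>M)"

definition cell_measure :: "nat \<Rightarrow> nat set \<Rightarrow> complex" where
  "cell_measure n a = complex_of_real (measure M (cyl n {a}))"

text \<open>Conditional expectation onto the cells of level \<open>n\<close>; cells of measure zero contribute \<open>0\<close>
  because division by zero yields zero.\<close>

definition avg :: "nat \<Rightarrow> ('a \<Rightarrow> complex) \<Rightarrow> 'a \<Rightarrow> complex" where
  "avg n f x = (\<Sum>a\<in>Pow {..<n}. cell_integral n f a / cell_measure n a * indicator (cyl n {a}) x)"

lemma avg_bounded: "avg n f \<in> bmeas M"
  unfolding avg_def[abs_def]
  by (intro bmeas_sum bmeas_scale bmeas_indicator cyl_sets)

lemma avg_sqint: "avg n f \<in> square_integrable M"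
  by (rule bmeas_sqint[OF avg_bounded])

lemma indicator_cyl_sqint: "indicator (cyl n F) \<in> square_integrable M"
  by (intro bmeas_sqint bmeas_indicator cyl_sets)

lemma cell_integrable:
  "f \<in> square_integrable M \<Longrightarrow> integrable M (\<lambda>x. indicator (cyl n {a}) x * f x)"
  by (rule sqint_mult_integrable[OF indicator_cyl_sqint])

lemma avg_linear:
  assumes "f \<in> square_integrable M" "g \<in> square_integrable M"
  shows "avg n (\<lambda>x. f x + g x) x = avg n f x + avg n g x"
    and "avg n (\<lambda>x. c * f x) x = c * avg n f x"
proof -
  have "cell_integral n (\<lambda>x. f x + g x) a = cell_integral n f a + cell_integral n g a" for a
    unfolding cell_integral_def using cell_integrable assms by (simp add: distrib_left)
  then show "avg n (\<lambda>x. f x + g x) x = avg n f x + avg n g x"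
    by (simp add: avg_def add_divide_distrib distrib_right sum.distrib)
  have "cell_integral n (\<lambda>x. c * f x) a = c * cell_integral n f a" for a
    unfolding cell_integral_def by (simp add: mult.left_commute[of _ c])
  then show "avg n (\<lambda>x. c * f x) x = c * avg n f x"
    by (simp add: avg_def sum_distrib_left mult.assoc)
qed

lemma avg_inner:
  assumes g: "g \<in> square_integrable M"
  shows "(\<integral>x. avg n f x * cnj (g x) \<partial>M)
    = (\<Sum>a\<in>Pow {..<n}. cell_integral n f a / cell_measure n a * cnj (cell_integral n g a))"
proof -
  have i: "integrable M (\<lambda>x. indicator (cyl n {a}) x * cnj (g x))" for a
    by (rule cell_integrable[OF sqint_cnj[OF g]])
  have c: "(\<integral>x. indicator (cyl n {a}) x * cnj (g x) \<partial>M) = cnj (cell_integral n g a)" for a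
    by (simp only: integral_indicator_cnj cell_integral_def)
  have "(\<integral>x. avg n f x * cnj (g x) \<partial>M)
    = (\<integral>x. (\<Sum>a\<in>Pow {..<n}. (cell_integral n f a / cell_measure n a) * (indicator (cyl n {a}) x * cnj (g x))) \<partial>M)"
    by (simp only: avg_def sum_distrib_right mult.assoc)
  also have "\<dots> = (\<Sum>a\<in>Pow {..<n}. (\<integral>x. (cell_integral n f a / cell_measure n a) * (indicator (cyl n {a}) x * cnj (g x)) \<partial>M))"
    by (rule Bochner_Integration.integral_sum) (intro integrable_mult_right i)
  also have "\<dots> = (\<Sum>a\<in>Pow {..<n}. cell_integral n f a / cell_measure n a * cnj (cell_integral n g a))"
    by (simp only: integral_mult_right_zero c)
  finally show ?thesis .
qed

lemma cyl_disjoint_indicator: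
  assumes "x \<in> space M"
  shows "indicator (cyl n {a}) x = (if a = code n x then 1 else 0 :: complex)"
  using assms by (auto simp: cyl_def indicator_def)

lemma avg_eq:
  assumes "x \<in> space M"
  shows "avg n f x = cell_integral n f (code n x) / cell_measure n (code n x)"
proof -
  have "avg n f x = (\<Sum>a\<in>Pow {..<n}. if a = code n x then cell_integral n f a / cell_measure n a else 0)"
    unfolding avg_def cyl_disjoint_indicator[OF assms] by (intro sum.cong) auto
  then show ?thesis using code_Pow[of n x] by (simp add: sum.delta)
qed

lemma integral_indicator_cyl: "(\<integral>x. indicator (cyl n {a}) x \<partial>M) = cell_measure n a"
proof -
  have "(\<integral>x. indicator (cyl n {a}) x \<partial>M) = (\<integral>x. complex_of_real (indicator (cyl n {a}) x) \<partial>M)"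
    by (intro Bochner_Integration.integral_cong) (auto simp: indicator_def)
  also have "\<dots> = complex_of_real (\<integral>x. indicator (cyl n {a}) x \<partial>M)" by (rule integral_complex_of_real)
  finally show ?thesis by (simp add: cell_measure_def sets.Int_space_eq2)
qed

lemma cell_integral_zero:
  assumes "cell_measure n a = 0" shows "cell_integral n f a = 0"
proof -
  have "emeasure M (cyl n {a}) = 0"
    using assms by (simp add: cell_measure_def emeasure_eq_measure)
  then have "cyl n {a} \<in> null_sets M" using cyl_sets by (simp add: null_sets_def)
  then have "AE x in M. x \<notin> cyl n {a}" by (rule AE_not_in)
  then have "AE x in M. indicator (cyl n {a}) x * f x = 0" by eventually_elim simp
  then show ?thesis unfolding cell_integral_def by (rule integral_eq_zero_AE)
qed

lemma cell_integral_avg: "cell_integral n (avg n f) a = (if a \<in> Pow {..<n} then cell_integral n f a else 0)"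
proof (cases "a \<in> Pow {..<n}")
  case True
  have "cell_integral n (avg n f) a = (\<integral>x. (cell_integral n f a / cell_measure n a) * indicator (cyl n {a}) x \<partial>M)"
    unfolding cell_integral_def[of n "avg n f"]
    by (intro Bochner_Integration.integral_cong) (auto simp: cyl_disjoint_indicator avg_eq)
  also have "\<dots> = cell_integral n f a"
    using cell_integral_zero[of n a f] by (simp add: integral_indicator_cyl)
  finally show ?thesis using True by simp
next
  case False
  then have "cyl n {a} = {}" using code_Pow by (auto simp: cyl_def)
  then show ?thesis using False by (simp add: cell_integral_def)
qed

text \<open>\<open>avg n\<close> is an orthogonal projection, hence a contraction.\<close>

lemma avg_contraction:
  assumes f: "f \<in> square_integrable M"
  shows "l2norm M (avg n f) \<le> l2norm M f"
proof -
  have "(l2norm M (avg n f))\<^sup>2 = cmod (\<integral>x. avg n f x * cnj (f x) \<partial>M)"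
    unfolding l2norm_power2_cmod avg_inner[OF avg_sqint] avg_inner[OF f] by (simp add: cell_integral_avg)
  also have "\<dots> \<le> l2norm M f * l2norm M (avg n f)"
    using cauchy_schwarz_cnj[OF avg_sqint f] by (simp only: mult.commute)
  finally show ?thesis by (rule l2norm_le_of_power2_le) simp
qed

lemma avg_cyl:
  assumes "n \<le> m" shows "AE x in M. avg m (indicator (cyl n F)) x = indicator (cyl n F) x"
proof -
  define G where "G = {a. a \<inter> {..<n} \<in> F}"
  have G: "cyl n F = cyl m G" unfolding G_def by (rule cyl_raise[OF assms])
  have "AE x in M. cell_measure m (code m x) \<noteq> 0"
  proof -
    have "AE x in M. x \<notin> cyl m {a}" if "cell_measure m a = 0" for a
    proof (rule AE_not_in)
      show "cyl m {a} \<in> null_sets M"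
        using that cyl_sets[of m "{a}"] by (simp add: null_sets_def cell_measure_def emeasure_eq_measure)
    qed
    then have "AE x in M. \<forall>a\<in>Pow {..<m}. cell_measure m a = 0 \<longrightarrow> x \<notin> cyl m {a}"
      by (intro AE_finite_allI) auto
    then show ?thesis
      using AE_space
    proof eventually_elim
      case (elim x)
      then show ?case using code_Pow[of m x] by (auto simp: cyl_def)
    qed
  qed
  then show ?thesis
    using AE_space
  proof eventually_elim
    case (elim x)
    let ?a = "code m x"
    have "cell_integral m (indicator (cyl m G)) ?a = (\<integral>y. indicator (cyl m G) x * indicator (cyl m {?a}) y \<partial>M)"
      unfolding cell_integral_def
      using elim by (intro Bochner_Integration.integral_cong) (auto simp: cyl_def indicator_def)
    also have "\<dots> = indicator (cyl m G) x * cell_measure m ?a"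
      by (simp add: integral_indicator_cyl)
    finally show ?case unfolding G avg_eq[OF elim(2)] using elim by simp
  qed
qed

lemma avg_diff_bound:
  assumes f: "f \<in> square_integrable M" and h: "h \<in> square_integrable M"
  shows "l2norm M (\<lambda>x. avg n f x - f x) \<le> 2 * l2norm M (\<lambda>x. f x - h x) + l2norm M (\<lambda>x. avg n h x - h x)"
proof -
  note d = sqint_diff[OF f h]
  have "avg n f x = avg n (\<lambda>x. f x - h x) x + avg n h x" for x
    using avg_linear(1)[OF d h, of n x] by simp
  then have "(\<lambda>x. avg n f x - f x) = (\<lambda>x. avg n (\<lambda>x. f x - h x) x + ((avg n h x - h x) + (h x - f x)))"
    by auto
  then have "l2norm M (\<lambda>x. avg n f x - f x)
    = l2norm M (\<lambda>x. avg n (\<lambda>x. f x - h x) x + ((avg n h x - h x) + (h x - f x)))" by simp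
  also have "\<dots> \<le> l2norm M (avg n (\<lambda>x. f x - h x)) + l2norm M (\<lambda>x. (avg n h x - h x) + (h x - f x))"
    by (intro l2norm_triangle avg_sqint sqint_add sqint_diff f h)
  also have "\<dots> \<le> l2norm M (\<lambda>x. f x - h x) + (l2norm M (\<lambda>x. avg n h x - h x) + l2norm M (\<lambda>x. h x - f x))"
    by (intro add_mono avg_contraction d l2norm_triangle avg_sqint sqint_diff f h)
  also have "l2norm M (\<lambda>x. h x - f x) = l2norm M (\<lambda>x. f x - h x)" by (rule l2norm_minus_commute)
  finally show ?thesis by simp
qed

text \<open>The averages are contractions, so convergence on a dense set suffices; the indicator of a
  cylinder is fixed from its level on, and cylinders approximate all measurable sets.\<close>

lemma avg_tendsto:
  assumes f: "f \<in> square_integrable M"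
  shows "(\<lambda>n. l2norm M (\<lambda>x. avg n f x - f x)) \<longlonglongrightarrow> 0"
  using f
proof (rule sqint_induct)
  fix A assume A: "A \<in> sets M"
  show "(\<lambda>n. l2norm M (\<lambda>x. avg n (indicator A) x - indicator A x)) \<longlonglongrightarrow> 0"
  proof (rule LIMSEQ_I)
    fix r :: real assume r: "0 < r"
    then have e: "0 < (r / 4)\<^sup>2" by simp
    obtain n0 F where "F \<subseteq> Pow {..<n0}" and F: "sdm A (cyl n0 F) < (r / 4)\<^sup>2"
      using A e by (rule cyl_dense)
    have "norm (l2norm M (\<lambda>x. avg n (indicator A) x - indicator A x) - 0) < r" if n: "n0 \<le> n" for n
    proof -
      have "l2norm M (\<lambda>x. avg n (indicator (cyl n0 F)) x - indicator (cyl n0 F) x) = l2norm M (\<lambda>_. 0)"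
      proof (rule l2norm_cong_AE)
        show "(\<lambda>x. avg n (indicator (cyl n0 F)) x - indicator (cyl n0 F) x) \<in> borel_measurable M"
          by (rule sqintD(1)[OF sqint_diff[OF avg_sqint indicator_cyl_sqint]])
        show "AE x in M. avg n (indicator (cyl n0 F)) x - indicator (cyl n0 F) x = 0"
          using avg_cyl[OF n] by eventually_elim simp
      qed simp
      then have z: "l2norm M (\<lambda>x. avg n (indicator (cyl n0 F)) x - indicator (cyl n0 F) x) = 0"
        by (simp add: l2norm_def)
      have "l2norm M (\<lambda>x. indicator A x - indicator (cyl n0 F) x) = sqrt (sdm A (cyl n0 F))"
        by (rule l2norm_indicator_diff[OF A cyl_sets])
      also have "\<dots> < sqrt ((r / 4)\<^sup>2)" using F by (simp only: real_sqrt_less_iff)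
      also have "\<dots> = r / 4" using r by simp
      finally have "l2norm M (\<lambda>x. indicator A x - indicator (cyl n0 F) x) < r / 4" .
      then show ?thesis
        using avg_diff_bound[OF bmeas_sqint[OF bmeas_indicator[OF A]]
            indicator_cyl_sqint, of n n0 F] z r by simp
    qed
    then show "\<exists>no. \<forall>n\<ge>no. norm (l2norm M (\<lambda>x. avg n (indicator A) x - indicator A x) - 0) < r" by blast
  qed
next
  fix f g assume f: "f \<in> square_integrable M" and g: "g \<in> square_integrable M"
    and lf: "(\<lambda>n. l2norm M (\<lambda>x. avg n f x - f x)) \<longlonglongrightarrow> 0"
    and lg: "(\<lambda>n. l2norm M (\<lambda>x. avg n g x - g x)) \<longlonglongrightarrow> 0"
  have le: "l2norm M (\<lambda>x. avg n (\<lambda>x. f x + g x) x - (f x + g x))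
      \<le> l2norm M (\<lambda>x. avg n f x - f x) + l2norm M (\<lambda>x. avg n g x - g x)" for n
  proof -
    have "(\<lambda>x. avg n (\<lambda>x. f x + g x) x - (f x + g x)) = (\<lambda>x. (avg n f x - f x) + (avg n g x - g x))"
      by (auto simp: avg_linear(1)[OF f g])
    then show ?thesis
      using l2norm_triangle[OF sqint_diff[OF avg_sqint[of n f] f]
        sqint_diff[OF avg_sqint[of n g] g]] by simp
  qed
  show "(\<lambda>n. l2norm M (\<lambda>x. avg n (\<lambda>x. f x + g x) x - (f x + g x))) \<longlonglongrightarrow> 0"
    by (rule tendsto_sandwich[OF always_eventually always_eventually tendsto_const tendsto_add_zero[OF lf lg]])
       (simp_all add: le)
next
  fix c f assume f: "f \<in> square_integrable M"
    and lf: "(\<lambda>n. l2norm M (\<lambda>x. avg n f x - f x)) \<longlonglongrightarrow> 0"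
  have "l2norm M (\<lambda>x. avg n (\<lambda>x. c * f x) x - c * f x) = cmod c * l2norm M (\<lambda>x. avg n f x - f x)" for n
    unfolding avg_linear(2)[OF f f] right_diff_distrib[symmetric] by (rule l2norm_scale)
  then show "(\<lambda>n. l2norm M (\<lambda>x. avg n (\<lambda>x. c * f x) x - c * f x)) \<longlonglongrightarrow> 0"
    using tendsto_mult_right_zero[OF lf] by simp
next
  fix f F assume f: "f \<in> square_integrable M" and F: "\<And>n. F n \<in> square_integrable M"
    and Q: "\<And>i. (\<lambda>n. l2norm M (\<lambda>x. avg n (F i) x - F i x)) \<longlonglongrightarrow> 0"
    and lim: "(\<lambda>n. l2norm M (\<lambda>x. F n x - f x)) \<longlonglongrightarrow> 0"
  show "(\<lambda>n. l2norm M (\<lambda>x. avg n f x - f x)) \<longlonglongrightarrow> 0"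
  proof (rule LIMSEQ_I)
    fix r :: real assume r: "0 < r"
    then have "0 < r / 4" by simp
    from LIMSEQ_D[OF lim this] obtain i where "\<forall>n\<ge>i. norm (l2norm M (\<lambda>x. F n x - f x) - 0) < r / 4" by blast
    then have i: "l2norm M (\<lambda>x. f x - F i x) < r / 4" by (simp add: l2norm_minus_commute[of M f])
    have "0 < r / 2" using r by simp
    from LIMSEQ_D[OF Q[of i] this] obtain N where
      N: "\<And>n. N \<le> n \<Longrightarrow> l2norm M (\<lambda>x. avg n (F i) x - F i x) < r / 2" by auto
    have "norm (l2norm M (\<lambda>x. avg n f x - f x) - 0) < r" if "N \<le> n" for n
      using avg_diff_bound[OF f F[of i], of n] i N[OF that] by simp
    then show "\<exists>no. \<forall>n\<ge>no. norm (l2norm M (\<lambda>x. avg n f x - f x) - 0) < r" by blast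
  qed
qed

text \<open>Compressing an operator to the functions that are constant on cells gives an integral operator with
  a step function as kernel.\<close>

lemma kernel_op_dense:
  assumes T: "T \<in> BH M"
  obtains k where "\<And>n. k n \<in> bmeas MM"
    "limitin (wstar_topology M) (\<lambda>n. kernel_op M (k n)) T sequentially"
proof -
  define step where "step n a = (indicator (cyl n {a}) :: 'a \<Rightarrow> complex)" for n a
  define t where "t n a b = form M T (step n b) (step n a) / (cell_measure n a * cell_measure n b)" for n a b
  define k where "k n p = (\<Sum>a\<in>Pow {..<n}. \<Sum>b\<in>Pow {..<n}. t n a b * (step n a (fst p) * step n b (snd p)))" for n and p :: "'a \<times> 'a"
  have chi: "step n a \<in> bmeas M" for n a
    unfolding step_def by (rule bmeas_indicator[OF cyl_sets])
  note chi2 = bmeas_sqint[OF chi]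
  have k: "k n \<in> bmeas MM" for n
    unfolding k_def[abs_def]
    by (intro bmeas_sum bmeas_scale bmeas_product chi)
  have form: "form M (kernel_op M (k n)) f g = form M T (avg n f) (avg n g)"
    if f: "f \<in> square_integrable M" and g: "g \<in> square_integrable M" for n f g
  proof -
    let ?S = "Pow {..<n}"
    have cI: "(\<integral>x. step n a x * cnj (g x) \<partial>M) = cnj (cell_integral n g a)" for a
      by (simp only: step_def integral_indicator_cnj cell_integral_def)
    have fI: "(\<integral>x. step n b x * f x \<partial>M) = cell_integral n f b" for b
      by (simp add: step_def cell_integral_def)
    have i1: "integrable M (\<lambda>x. step n a x * cnj (g x))" for a
      by (rule sqint_mult_integrable[OF chi2 sqint_cnj[OF g]])
    have i2: "integrable M (\<lambda>x. step n b x * f x)" for b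
      by (rule sqint_mult_integrable[OF chi2 f])
    note prod = integrable_product[OF i1 i2]
    have "form M (kernel_op M (k n)) f g = (\<integral>p. k n p * (cnj (g (fst p)) * f (snd p)) \<partial>MM)"
      by (rule form_kernel_op[OF k f g])
    also have "\<dots> = (\<integral>p. (\<Sum>a\<in>?S. \<Sum>b\<in>?S. t n a b * ((step n a (fst p) * cnj (g (fst p))) * (step n b (snd p) * f (snd p)))) \<partial>MM)"
      unfolding k_def sum_distrib_right
      by (intro Bochner_Integration.integral_cong sum.cong refl) (simp only: mult_ac)
    also have "\<dots> = (\<Sum>a\<in>?S. \<Sum>b\<in>?S. t n a b * (cnj (cell_integral n g a) * cell_integral n f b))"
      by (simp only: Bochner_Integration.integral_sum Bochner_Integration.integrable_sum integrable_mult_right prod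
          integral_mult_right_zero cI fI)
    also have "\<dots> = (\<Sum>a\<in>?S. \<Sum>b\<in>?S. cnj (cell_integral n g a / cell_measure n a) * (cell_integral n f b / cell_measure n b * form M T (step n b) (step n a)))"
      by (intro sum.cong refl) (simp add: t_def cell_measure_def divide_simps)
    also have "\<dots> = form M T (avg n f) (avg n g)"
    proof -
      have avg: "avg n h = (\<lambda>x. \<Sum>a\<in>?S. (cell_integral n h a / cell_measure n a) * step n a x)" for h
        by (auto simp: avg_def step_def)
      note sc = sqint_scale[OF chi2]
      have "form M T (avg n f) (avg n g) = (\<Sum>a\<in>?S. form M T (avg n f) (\<lambda>x. (cell_integral n g a / cell_measure n a) * step n a x))"
        unfolding avg[of g] by (rule form_sum_right[OF T sc avg_sqint])
      also have "\<dots> = (\<Sum>a\<in>?S. cnj (cell_integral n g a / cell_measure n a) * form M T (avg n f) (step n a))"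
        by (intro sum.cong refl form_scale_right[OF T chi2 avg_sqint])
      also have "\<dots> = (\<Sum>a\<in>?S. cnj (cell_integral n g a / cell_measure n a) * (\<Sum>b\<in>?S. cell_integral n f b / cell_measure n b * form M T (step n b) (step n a)))"
      proof (intro sum.cong refl arg_cong2[of _ _ _ _ "(*)"])
        fix a
        have "form M T (avg n f) (step n a) = (\<Sum>b\<in>?S. form M T (\<lambda>x. (cell_integral n f b / cell_measure n b) * step n b x) (step n a))"
          unfolding avg[of f] by (rule form_sum_left(1)[OF T sc chi2])
        also have "\<dots> = (\<Sum>b\<in>?S. cell_integral n f b / cell_measure n b * form M T (step n b) (step n a))"
          by (intro sum.cong refl form_scale_left[OF T chi2 chi2])
        finally show "form M T (avg n f) (step n a) = (\<Sum>b\<in>?S. cell_integral n f b / cell_measure n b * form M T (step n b) (step n a))" .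
      qed
      finally show ?thesis by (simp only: sum_distrib_left)
    qed
    finally show ?thesis .
  qed
  have norm: "op_norm M (kernel_op M (k n)) \<le> op_norm M T" for n
  proof (rule op_norm_leI[OF kernel_op_BH[OF k] op_norm_nonneg[OF T]])
    fix f g assume f: "f \<in> square_integrable M" and g: "g \<in> square_integrable M"
    have "cmod (form M T (avg n f) (avg n g)) \<le> op_norm M T * l2norm M (avg n f) * l2norm M (avg n g)"
      by (rule form_bound[OF T avg_sqint avg_sqint])
    also have "\<dots> \<le> op_norm M T * l2norm M f * l2norm M g"
      by (intro mult_mono avg_contraction f g mult_nonneg_nonneg op_norm_nonneg[OF T]) auto
    finally show "cmod (form M (kernel_op M (k n)) f g) \<le> op_norm M T * l2norm M f * l2norm M g"
      by (simp add: form[OF f g])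
  qed
  have "limitin (wstar_topology M) (\<lambda>n. kernel_op M (k n)) T sequentially"
  proof (rule limitin_wstar_of_bounded[OF kernel_op_BH[OF k] T norm])
    fix f g assume f: "f \<in> square_integrable M" and g: "g \<in> square_integrable M"
    show "(\<lambda>n. form M (kernel_op M (k n)) f g) \<longlonglongrightarrow> form M T f g"
      unfolding form[OF f g]
      by (rule form_tendsto[OF T f g avg_sqint avg_sqint avg_tendsto[OF f] avg_tendsto[OF g]])
  qed
  then show ?thesis using that k by blast
qed

end

section \<open>The norm estimate that excludes three full corners of four\<close>

lemma two_term_cauchy_schwarz:
  fixes a b c d :: real
  shows "a * c + b * d \<le> sqrt (a\<^sup>2 + b\<^sup>2) * sqrt (c\<^sup>2 + d\<^sup>2)"
proof -
  have "(a * c + b * d)\<^sup>2 + (a * d - b * c)\<^sup>2 = (a\<^sup>2 + b\<^sup>2) * (c\<^sup>2 + d\<^sup>2)"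
    by (simp add: power2_eq_square algebra_simps)
  then have "(a * c + b * d)\<^sup>2 \<le> (a\<^sup>2 + b\<^sup>2) * (c\<^sup>2 + d\<^sup>2)"
    using zero_le_power2[of "a * d - b * c"] by linarith
  then show ?thesis by (simp add: real_le_rsqrt flip: real_sqrt_mult)
qed

text \<open>The matrix with rows \<open>(p, q)\<close> and \<open>(q, -p)\<close> is orthogonal, hence a contraction.\<close>

lemma reflection_form_bound:
  fixes p q :: real and \<phi>1 \<phi>2 \<psi>1 \<psi>2 :: complex
  assumes pq: "p\<^sup>2 + q\<^sup>2 = 1"
  shows "cmod ((p * \<phi>1 + q * \<phi>2) * \<psi>1 + (q * \<phi>1 - p * \<phi>2) * \<psi>2)
    \<le> sqrt ((cmod \<phi>1)\<^sup>2 + (cmod \<phi>2)\<^sup>2) * sqrt ((cmod \<psi>1)\<^sup>2 + (cmod \<psi>2)\<^sup>2)"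
proof -
  let ?w1 = "p * \<phi>1 + q * \<phi>2" and ?w2 = "q * \<phi>1 - p * \<phi>2"
  have "(cmod ?w1)\<^sup>2 + (cmod ?w2)\<^sup>2 = (p\<^sup>2 + q\<^sup>2) * ((cmod \<phi>1)\<^sup>2 + (cmod \<phi>2)\<^sup>2)"
    unfolding cmod_power2 by (simp add: power2_eq_square algebra_simps)
  then have iso: "(cmod ?w1)\<^sup>2 + (cmod ?w2)\<^sup>2 = (cmod \<phi>1)\<^sup>2 + (cmod \<phi>2)\<^sup>2" using pq by simp
  have "cmod (?w1 * \<psi>1 + ?w2 * \<psi>2) \<le> cmod ?w1 * cmod \<psi>1 + cmod ?w2 * cmod \<psi>2"
    using norm_triangle_ineq[of "?w1 * \<psi>1" "?w2 * \<psi>2"] by (simp only: norm_mult)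
  also have "\<dots> \<le> sqrt ((cmod ?w1)\<^sup>2 + (cmod ?w2)\<^sup>2) * sqrt ((cmod \<psi>1)\<^sup>2 + (cmod \<psi>2)\<^sup>2)"
    by (rule two_term_cauchy_schwarz)
  finally show ?thesis unfolding iso .
qed

context finite_measure
begin

lemma indicator_sqint: "A \<in> sets M \<Longrightarrow> indicator A \<in> square_integrable M"
  by (intro bmeas_sqint bmeas_indicator)

text \<open>Bessel's inequality for the orthonormal pair of normalised indicators of \<open>B1\<close> and \<open>B2\<close>.\<close>

lemma bessel_two_sets:
  assumes B: "B1 \<in> sets M" "B2 \<in> sets M" "B1 \<inter> B2 = {}"
    and pos: "0 < measure M B1" "0 < measure M B2" and f: "f \<in> square_integrable M"
  shows "sqrt ((cmod ((\<integral>x. indicator B1 x * f x \<partial>M) / sqrt (measure M B1)))\<^sup>2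
      + (cmod ((\<integral>x. indicator B2 x * f x \<partial>M) / sqrt (measure M B2)))\<^sup>2) \<le> l2norm M f"
proof -
  have one: "(cmod ((\<integral>x. indicator C x * f x \<partial>M) / sqrt (measure M C)))\<^sup>2 \<le> (\<integral>x. indicator C x * (cmod (f x))\<^sup>2 \<partial>M)"
    if C: "C \<in> sets M" "0 < measure M C" for C
  proof -
    have "(\<integral>x. indicator C x * f x \<partial>M) = (\<integral>x. indicator C x * (indicator C x * f x) \<partial>M)"
      by (intro Bochner_Integration.integral_cong) (auto simp: indicator_def)
    then have "cmod (\<integral>x. indicator C x * f x \<partial>M) \<le> sqrt (measure M C) * l2norm M (\<lambda>x. indicator C x * f x)"
      using cauchy_schwarz[OF indicator_sqint[OF C(1)] sqint_indicator_mult[OF f C(1)]]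
      by (simp add: l2norm_indicator[OF C(1)])
    then have "cmod ((\<integral>x. indicator C x * f x \<partial>M) / sqrt (measure M C)) \<le> l2norm M (\<lambda>x. indicator C x * f x)"
      using C(2) by (simp add: norm_divide divide_le_eq mult.commute)
    then have "(cmod ((\<integral>x. indicator C x * f x \<partial>M) / sqrt (measure M C)))\<^sup>2 \<le> (l2norm M (\<lambda>x. indicator C x * f x))\<^sup>2"
      by (intro power_mono) auto
    also have "\<dots> = (\<integral>x. indicator C x * (cmod (f x))\<^sup>2 \<partial>M)"
      unfolding l2norm_power2 by (intro Bochner_Integration.integral_cong) (auto simp: indicator_def)
    finally show ?thesis .
  qed
  have int: "integrable M (\<lambda>x. indicator C x * (cmod (f x))\<^sup>2)" if "C \<in> sets M" for C
    using integrable_real_mult_indicator[OF that sqintD(2)[OF f]] by (simp add: mult.commute)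
  have "(cmod ((\<integral>x. indicator B1 x * f x \<partial>M) / sqrt (measure M B1)))\<^sup>2
      + (cmod ((\<integral>x. indicator B2 x * f x \<partial>M) / sqrt (measure M B2)))\<^sup>2
    \<le> (\<integral>x. indicator B1 x * (cmod (f x))\<^sup>2 \<partial>M) + (\<integral>x. indicator B2 x * (cmod (f x))\<^sup>2 \<partial>M)"
    by (intro add_mono one B pos)
  also have "\<dots> = (\<integral>x. indicator B1 x * (cmod (f x))\<^sup>2 + indicator B2 x * (cmod (f x))\<^sup>2 \<partial>M)"
    by (rule Bochner_Integration.integral_add[symmetric, OF int[OF B(1)] int[OF B(2)]])
  also have "\<dots> \<le> (\<integral>x. (cmod (f x))\<^sup>2 \<partial>M)"
    using B by (intro integral_mono Bochner_Integration.integrable_add int sqintD(2)[OF f])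
      (auto simp: indicator_def)
  finally show ?thesis unfolding l2norm_def by (rule real_sqrt_le_mono)
qed

lemma l2norm_two_step:
  assumes B: "B1 \<in> sets M" "B2 \<in> sets M" "B1 \<inter> B2 = {}"
  shows "l2norm M (\<lambda>x. complex_of_real u * indicator B1 x + complex_of_real v * indicator B2 x)
    = sqrt (u\<^sup>2 * measure M B1 + v\<^sup>2 * measure M B2)"
proof -
  have "(\<integral>x. (cmod (complex_of_real u * indicator B1 x + complex_of_real v * indicator B2 x))\<^sup>2 \<partial>M)
    = (\<integral>x. u\<^sup>2 * indicator B1 x + v\<^sup>2 * indicator B2 x \<partial>M)"
    using B(3) by (intro Bochner_Integration.integral_cong) (auto simp: indicator_def)
  also have "\<dots> = u\<^sup>2 * measure M B1 + v\<^sup>2 * measure M B2"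
    using B by (simp add: emeasure_eq_measure sets.Int_space_eq2)
  finally show ?thesis by (simp add: l2norm_def)
qed

end

context bounded_bimodule_map
begin

definition rectangle_op :: "'a set \<Rightarrow> 'a set \<Rightarrow> 'a oper" where
  "rectangle_op A C = kernel_op M (\<lambda>p. indicator A (fst p) * indicator C (snd p))"

lemma rectangle_kernel:
  "A \<in> sets M \<Longrightarrow> C \<in> sets M \<Longrightarrow> (\<lambda>p. indicator A (fst p) * indicator C (snd p)) \<in> bmeas MM"
  by (intro bmeas_product bmeas_indicator)

lemma rectangle_op_BH: "A \<in> sets M \<Longrightarrow> C \<in> sets M \<Longrightarrow> rectangle_op A C \<in> BH M"
  unfolding rectangle_op_def by (intro kernel_op_BH rectangle_kernel)

lemma form_rectangle_op:
  assumes A: "A \<in> sets M" and C: "C \<in> sets M" and f: "f \<in> square_integrable M" and g: "g \<in> square_integrable M"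
  shows "form M (rectangle_op A C) f g = cnj (\<integral>x. indicator A x * g x \<partial>M) * (\<integral>x. indicator C x * f x \<partial>M)"
proof -
  note i = sqint_mult_integrable[OF indicator_sqint[OF A] sqint_cnj[OF g]]
    sqint_mult_integrable[OF indicator_sqint[OF C] f]
  have "form M (rectangle_op A C) f g
    = (\<integral>p. (indicator A (fst p) * cnj (g (fst p))) * (indicator C (snd p) * f (snd p)) \<partial>MM)"
    unfolding rectangle_op_def form_kernel_op[OF rectangle_kernel[OF A C] f g]
    by (intro Bochner_Integration.integral_cong) (simp_all only: mult_ac)
  also have "\<dots> = (\<integral>x. indicator A x * cnj (g x) \<partial>M) * (\<integral>x. indicator C x * f x \<partial>M)"
    by (rule integrable_product(2)[OF i])
  finally show ?thesis by (simp only: integral_indicator_cnj)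
qed

text \<open>The fraction of the rectangle \<open>A \<times> C\<close> that \<open>E\<close> fills.\<close>

definition occupancy :: "('a \<times> 'a) set \<Rightarrow> 'a set \<Rightarrow> 'a set \<Rightarrow> real" where
  "occupancy E A C = measure MM (E \<inter> (A \<times> C)) / (measure M A * measure M C)"

lemma form_P_rectangle_op:
  assumes E: "E \<in> sets MM"
    and PE: "\<And>k. k \<in> bmeas MM \<Longrightarrow> P (kernel_op M k) = kernel_op M (\<lambda>p. indicator E p * k p)"
    and A: "A \<in> sets M" and C: "C \<in> sets M" and f: "f \<in> square_integrable M" and g: "g \<in> square_integrable M"
    and fc: "\<And>x. x \<in> C \<Longrightarrow> f x = complex_of_real \<delta>" and gc: "\<And>x. x \<in> A \<Longrightarrow> g x = complex_of_real \<gamma>"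
  shows "form M (P (rectangle_op A C)) f g = complex_of_real (\<gamma> * \<delta> * measure MM (E \<inter> (A \<times> C)))"
proof -
  note k = rectangle_kernel[OF A C]
  note k' = bmeas_mult[OF bmeas_indicator[OF E] k]
  have S: "E \<inter> (A \<times> C) \<in> sets MM" using E A C by auto
  have "form M (P (rectangle_op A C)) f g
    = (\<integral>p. indicator E p * (indicator A (fst p) * indicator C (snd p)) * (cnj (g (fst p)) * f (snd p)) \<partial>MM)"
    unfolding rectangle_op_def PE[OF k] by (rule form_kernel_op[OF k' f g])
  also have "\<dots> = (\<integral>p. complex_of_real (\<gamma> * \<delta> * indicator (E \<inter> (A \<times> C)) p) \<partial>MM)"
    by (intro Bochner_Integration.integral_cong) (auto simp: indicator_def fc gc)
  also have "\<dots> = complex_of_real (\<gamma> * \<delta> * measure MM (E \<inter> (A \<times> C)))"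
    unfolding integral_complex_of_real using S by (simp add: sets.Int_space_eq2)
  finally show ?thesis .
qed

text \<open>The Schur multiplier with entries \<open>1, 1, 1, 0\<close> attains its norm \<open>2 / sqrt 3\<close> at the reflection with rows
  \<open>(1, sqrt 2) / sqrt 3\<close> and \<open>(sqrt 2, -1) / sqrt 3\<close>, tested on the unit vector
  \<open>(sqrt 2, 1) / sqrt 3\<close> from both sides. Here this reflection is transported to the normalised
  indicators of the four sets, and \<open>P\<close> multiplies its entries by the occupancies. With
  occupancies \<open>1, 1, 1, 0\<close> the left-hand side is \<open>6 = 3 sqrt 3 (2 / sqrt 3)\<close>.\<close>

lemma four_corner_estimate:
  assumes E: "E \<in> sets MM"
    and PE: "\<And>k. k \<in> bmeas MM \<Longrightarrow> P (kernel_op M k) = kernel_op M (\<lambda>p. indicator E p * k p)"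
    and A: "A1 \<in> sets M" "A2 \<in> sets M" "A1 \<inter> A2 = {}" "0 < measure M A1" "0 < measure M A2"
    and C: "C1 \<in> sets M" "C2 \<in> sets M" "C1 \<inter> C2 = {}" "0 < measure M C1" "0 < measure M C2"
  shows "2 * occupancy E A1 C1 + 2 * occupancy E A1 C2 + 2 * occupancy E A2 C1 - occupancy E A2 C2 \<le> 3 * sqrt 3 * K"
proof -
  define a1 a2 c1 c2 where "a1 = sqrt (measure M A1)" and "a2 = sqrt (measure M A2)"
    and "c1 = sqrt (measure M C1)" and "c2 = sqrt (measure M C2)"
  have pos: "0 < a1" "0 < a2" "0 < c1" "0 < c2" using A C by (auto simp: a1_def a2_def c1_def c2_def)
  have sq: "measure M A1 = a1\<^sup>2" "measure M A2 = a2\<^sup>2" "measure M C1 = c1\<^sup>2" "measure M C2 = c2\<^sup>2"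
    by (auto simp: a1_def a2_def c1_def c2_def)
  define p q :: real where "p = 1 / sqrt 3" and "q = sqrt 2 / sqrt 3"
  have pq: "p\<^sup>2 + q\<^sup>2 = 1" by (simp add: p_def q_def power_divide)
  let ?r = complex_of_real
  define T where "T = op_add M
     (op_add M (op_scale M (?r (p / (a1 * c1))) (rectangle_op A1 C1)) (op_scale M (?r (q / (a1 * c2))) (rectangle_op A1 C2)))
     (op_add M (op_scale M (?r (q / (a2 * c1))) (rectangle_op A2 C1)) (op_scale M (?r (- p / (a2 * c2))) (rectangle_op A2 C2)))"
  note R = rectangle_op_BH[OF A(1) C(1)] rectangle_op_BH[OF A(1) C(2)] rectangle_op_BH[OF A(2) C(1)] rectangle_op_BH[OF A(2) C(2)]
  have T: "T \<in> BH M" unfolding T_def by (intro op_add_BH op_scale_BH R)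
  have "op_norm M T \<le> 1"
  proof (rule op_norm_leI[OF T])
    fix f g assume f: "f \<in> square_integrable M" and g: "g \<in> square_integrable M"
    define \<phi>1 \<phi>2 \<psi>1 \<psi>2 where "\<phi>1 = (\<integral>x. indicator C1 x * f x \<partial>M) / c1" and "\<phi>2 = (\<integral>x. indicator C2 x * f x \<partial>M) / c2"
      and "\<psi>1 = (\<integral>x. indicator A1 x * g x \<partial>M) / a1" and "\<psi>2 = (\<integral>x. indicator A2 x * g x \<partial>M) / a2"
    have "form M T f g = (p * \<phi>1 + q * \<phi>2) * cnj \<psi>1 + (q * \<phi>1 - p * \<phi>2) * cnj \<psi>2"
      unfolding T_def \<phi>1_def \<phi>2_def \<psi>1_def \<psi>2_def using pos
      by (simp add: form_op_add form_op_scale op_add_BH op_scale_BH R f g form_rectangle_op A C field_simps)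
    then have "cmod (form M T f g) \<le> sqrt ((cmod \<phi>1)\<^sup>2 + (cmod \<phi>2)\<^sup>2) * sqrt ((cmod (cnj \<psi>1))\<^sup>2 + (cmod (cnj \<psi>2))\<^sup>2)"
      using reflection_form_bound[OF pq, of \<phi>1 \<phi>2 "cnj \<psi>1" "cnj \<psi>2"] by simp
    also have "\<dots> \<le> l2norm M f * l2norm M g"
      using bessel_two_sets[OF C f] bessel_two_sets[OF A g]
      unfolding \<phi>1_def \<phi>2_def \<psi>1_def \<psi>2_def c1_def c2_def a1_def a2_def complex_mod_cnj
      by (intro mult_mono) auto
    finally show "cmod (form M T f g) \<le> 1 * l2norm M f * l2norm M g" by simp
  qed simp
  then have PT: "op_norm M (P T) \<le> K"
    using bounded[OF T] mult_left_mono[OF _ K_nonneg, of "op_norm M T" 1] by simp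
  \<comment> \<open>The vectors \<open>f\<close> and \<open>g\<close> have coordinates \<open>(x, y)\<close> in the normalised indicators.\<close>
  define x y where "x = sqrt 2 / sqrt 3" and "y = 1 / sqrt 3"
  define f where "f = (\<lambda>t. ?r (x / c1) * indicator C1 t + ?r (y / c2) * indicator C2 t)"
  define g where "g = (\<lambda>t. ?r (x / a1) * indicator A1 t + ?r (y / a2) * indicator A2 t)"
  have f: "f \<in> square_integrable M" and g: "g \<in> square_integrable M"
    unfolding f_def g_def
    by (intro sqint_add sqint_scale indicator_sqint A C)+
  have fc: "\<And>t. t \<in> C1 \<Longrightarrow> f t = ?r (x / c1)" "\<And>t. t \<in> C2 \<Longrightarrow> f t = ?r (y / c2)"
    and gc: "\<And>t. t \<in> A1 \<Longrightarrow> g t = ?r (x / a1)" "\<And>t. t \<in> A2 \<Longrightarrow> g t = ?r (y / a2)"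
    using A(3) C(3) by (auto simp: f_def g_def indicator_def)
  have xy: "x\<^sup>2 + y\<^sup>2 = 1" by (simp add: x_def y_def power_divide)
  have nf: "l2norm M f = 1" and ng: "l2norm M g = 1"
    unfolding f_def g_def l2norm_two_step[OF C(1-3)] l2norm_two_step[OF A(1-3)] sq
    using pos xy by (simp_all add: power_divide)
  define m11 m12 m21 m22 where "m11 = measure MM (E \<inter> (A1 \<times> C1))" and "m12 = measure MM (E \<inter> (A1 \<times> C2))"
    and "m21 = measure MM (E \<inter> (A2 \<times> C1))" and "m22 = measure MM (E \<inter> (A2 \<times> C2))"
  define \<sigma> where "\<sigma> = p / (a1 * c1) * (x / a1 * (x / c1) * m11) + q / (a1 * c2) * (x / a1 * (y / c2) * m12)
    + (q / (a2 * c1) * (y / a2 * (x / c1) * m21) + - p / (a2 * c2) * (y / a2 * (y / c2) * m22))"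
  have "form M (P T) f g = ?r \<sigma>"
    unfolding T_def \<sigma>_def m11_def m12_def m21_def m22_def
    by (simp only: P_add P_scale op_add_BH op_scale_BH R P_BH form_op_add form_op_scale f g
        form_P_rectangle_op[OF E PE A(1) C(1) f g fc(1) gc(1)] form_P_rectangle_op[OF E PE A(1) C(2) f g fc(2) gc(1)]
        form_P_rectangle_op[OF E PE A(2) C(1) f g fc(1) gc(2)] form_P_rectangle_op[OF E PE A(2) C(2) f g fc(2) gc(2)]
        of_real_add of_real_mult)
  then have "\<bar>\<sigma>\<bar> \<le> K"
    using form_norm_le_of_bound[OF P_BH[OF T] PT f g] by (simp add: nf ng)
  then have "\<sigma> \<le> K" by simp
  moreover have "\<sigma> = (p * x\<^sup>2) * occupancy E A1 C1 + (q * x * y) * occupancy E A1 C2 + (q * x * y) * occupancy E A2 C1 - (p * y\<^sup>2) * occupancy E A2 C2"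
    unfolding \<sigma>_def occupancy_def sq m11_def[symmetric] m12_def[symmetric] m21_def[symmetric] m22_def[symmetric]
    by (simp add: power2_eq_square mult_ac)
  moreover have "p * x\<^sup>2 = 2 / (3 * sqrt 3)" "q * x * y = 2 / (3 * sqrt 3)" "p * y\<^sup>2 = 1 / (3 * sqrt 3)"
    by (simp_all add: p_def q_def x_def y_def power_divide)
  ultimately have "(2 * occupancy E A1 C1 + 2 * occupancy E A1 C2 + 2 * occupancy E A2 C1 - occupancy E A2 C2) / (3 * sqrt 3) \<le> K"
    by (simp add: add_divide_distrib diff_divide_distrib)
  then show ?thesis by (simp add: divide_le_eq mult.commute)
qed

end

section \<open>Sets without three full corners of four are unions of disjoint rectangles\<close>

text \<open>\<open>N\<close> is the union of the null members of the countable family.\<close>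

lemma (in finite_measure) essential_points:
  assumes "countable \<U>" "\<U> \<subseteq> sets M"
  obtains N where "N \<in> null_sets M" "\<And>U s. U \<in> \<U> \<Longrightarrow> s \<in> U \<Longrightarrow> s \<notin> N \<Longrightarrow> 0 < measure M U"
proof
  let ?N = "\<Union>{U \<in> \<U>. U \<in> null_sets M}"
  have c: "countable {U \<in> \<U>. U \<in> null_sets M}" by (rule countable_subset[OF _ assms(1)]) blast
  have "(\<Union>U\<in>{U \<in> \<U>. U \<in> null_sets M}. U) \<in> null_sets M"
    by (rule null_sets_UN'[OF c]) blast
  then show "?N \<in> null_sets M" by simp
  fix U s assume U: "U \<in> \<U>" and "s \<in> U" "s \<notin> ?N"
  then have "U \<notin> null_sets M" by blast
  then have "emeasure M U \<noteq> 0" using U assms(2) by (auto simp: null_sets_def)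
  then have "measure M U \<noteq> 0" by (simp add: emeasure_eq_measure)
  then show "0 < measure M U" by (simp add: less_le)
qed

context countably_generated_measure
begin

abbreviation sec :: "('a \<times> 'a) set \<Rightarrow> 'a \<Rightarrow> 'a set" where
  "sec E s \<equiv> Pair s -` E"

lemma sdm_section_measurable:
  assumes E [measurable]: "E \<in> sets MM" and Q [measurable]: "Q \<in> sets M"
  shows "(\<lambda>s. sdm (sec E s) Q) \<in> borel_measurable M"
proof -
  let ?D = "(E - space M \<times> Q) \<union> (space M \<times> Q - E)"
  have D: "?D \<in> sets MM" by measurable
  have "(\<lambda>s. enn2real (emeasure M (Pair s -` ?D))) \<in> borel_measurable M"
    using measurable_emeasure_Pair[OF D] by measurable
  moreover have "enn2real (emeasure M (Pair s -` ?D)) = sdm (sec E s) Q" if s: "s \<in> space M" for s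
  proof -
    have "Pair s -` ?D = (sec E s - Q) \<union> (Q - sec E s)" using s by auto
    then show ?thesis by (simp add: sdm_def measure_def)
  qed
  ultimately show ?thesis by (simp cong: measurable_cong)
qed

lemma measure_rectangle_sections:
  assumes E: "E \<in> sets MM" and A [measurable]: "A \<in> sets M" and C [measurable]: "C \<in> sets M"
  shows "integrable M (\<lambda>s. indicator A s * measure M (sec E s \<inter> C))"
    and "measure MM (E \<inter> (A \<times> C)) = (\<integral>s. indicator A s * measure M (sec E s \<inter> C) \<partial>M)"
proof -
  interpret P: pair_sigma_finite M M by (rule pair_sigma_finite_self)
  interpret PM: finite_measure "MM" by (rule finite_measure_pair_self)
  let ?D = "E \<inter> (A \<times> C)"
  have D: "?D \<in> sets MM" using E A C by auto
  have int: "integrable MM (indicator ?D :: _ \<Rightarrow> real)"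
    using D by (simp add: PM.emeasure_eq_measure)
  have sec: "(\<integral>t. (indicator ?D (s, t) :: real) \<partial>M) = indicator A s * measure M (sec E s \<inter> C)" for s
  proof -
    have S: "sec E s \<inter> C \<in> sets M" using sets_Pair1[OF E] C by auto
    have "(\<integral>t. (indicator ?D (s, t) :: real) \<partial>M) = (\<integral>t. indicator A s * indicator (sec E s \<inter> C) t \<partial>M)"
      by (intro Bochner_Integration.integral_cong) (auto simp: indicator_def)
    also have "\<dots> = indicator A s * measure M (sec E s \<inter> C)"
      using S by (simp add: sets.Int_space_eq2)
    finally show ?thesis .
  qed
  show "integrable M (\<lambda>s. indicator A s * measure M (sec E s \<inter> C))"
    using P.integrable_fst'[OF int] by (simp only: sec)
  have "measure MM ?D = (\<integral>p. indicator ?D p \<partial>MM)"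
    using D by (simp add: sets.Int_space_eq2)
  also have "\<dots> = (\<integral>s. indicator A s * measure M (sec E s \<inter> C) \<partial>M)"
    using P.integral_fst'[OF int] by (simp only: sec)
  finally show "measure MM ?D = (\<integral>s. indicator A s * measure M (sec E s \<inter> C) \<partial>M)" .
qed

lemma measure_rectangle_ge:
  assumes E: "E \<in> sets MM" and A: "A \<in> sets M" and C: "C \<in> sets M"
    and c: "\<And>s. s \<in> A \<Longrightarrow> c \<le> measure M (sec E s \<inter> C)"
  shows "c * measure M A \<le> measure MM (E \<inter> (A \<times> C))"
proof -
  have int: "integrable M (\<lambda>s. indicator A s * c)" using A by (simp add: emeasure_eq_measure)
  have "c * measure M A = (\<integral>s. indicator A s * c \<partial>M)" using A by (simp add: sets.Int_space_eq2)
  also have "\<dots> \<le> (\<integral>s. indicator A s * measure M (sec E s \<inter> C) \<partial>M)"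
    using c by (intro integral_mono int measure_rectangle_sections(1)[OF E A C]) (simp add: indicator_def)
  finally show ?thesis by (simp only: measure_rectangle_sections(2)[OF E A C])
qed

lemma measure_rectangle_le:
  assumes E: "E \<in> sets MM" and A: "A \<in> sets M" and C: "C \<in> sets M"
    and c: "\<And>s. s \<in> A \<Longrightarrow> measure M (sec E s \<inter> C) \<le> c"
  shows "measure MM (E \<inter> (A \<times> C)) \<le> c * measure M A"
proof -
  have int: "integrable M (\<lambda>s. indicator A s * c)" using A by (simp add: emeasure_eq_measure)
  have "(\<integral>s. indicator A s * measure M (sec E s \<inter> C) \<partial>M) \<le> (\<integral>s. indicator A s * c \<partial>M)"
    using c by (intro integral_mono int measure_rectangle_sections(1)[OF E A C]) (simp add: indicator_def)
  also have "\<dots> = c * measure M A" using A by (simp add: sets.Int_space_eq2)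
  finally show ?thesis by (simp only: measure_rectangle_sections(2)[OF E A C])
qed

lemma countable_dense_sets:
  "\<exists>Q :: nat \<Rightarrow> 'a set. range Q \<subseteq> sets M \<and> (\<forall>A\<in>sets M. \<forall>\<epsilon>>0. \<exists>j. sdm A (Q j) < \<epsilon>)"
proof -
  define \<Q> where "\<Q> = (\<lambda>(n, F). cyl n F) ` (SIGMA n:UNIV. Pow (Pow {..<n}))"
  have "countable \<Q>" unfolding \<Q>_def by (intro countable_image countable_SIGMA) (auto intro: countable_finite)
  moreover have "cyl 0 {} \<in> \<Q>" unfolding \<Q>_def by force
  ultimately have rng: "range (from_nat_into \<Q>) = \<Q>" by (intro range_from_nat_into) auto
  show ?thesis
  proof (intro exI[of _ "from_nat_into \<Q>"] conjI ballI allI impI)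
    have "\<Q> \<subseteq> sets M" by (auto simp: \<Q>_def)
    then show "range (from_nat_into \<Q>) \<subseteq> sets M" unfolding rng .
    fix A and \<epsilon> :: real assume "A \<in> sets M" "0 < \<epsilon>"
    then obtain n F where F: "F \<subseteq> Pow {..<n}" "sdm A (cyl n F) < \<epsilon>" by (rule cyl_dense)
    have "cyl n F \<in> \<Q>" unfolding \<Q>_def using F(1) by force
    then obtain j where "cyl n F = from_nat_into \<Q> j" using rng by (metis rangeE)
    then show "\<exists>j. sdm A (from_nat_into \<Q> j) < \<epsilon>" using F(2) by metis
  qed
qed

text \<open>The distance from \<open>E\<^sub>s\<close> to a fixed set is measurable in \<open>s\<close>. The points whose sections are close to
  a given member of a countable dense family therefore form measurable sets, and these
  countably many sets have positive measure at all points outside a null set.\<close>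

lemma essential_sections:
  assumes E: "E \<in> sets MM"
  obtains N where "N \<in> null_sets M"
    "\<And>s \<delta>. s \<in> space M \<Longrightarrow> s \<notin> N \<Longrightarrow> 0 < \<delta> \<Longrightarrow>
      \<exists>A\<in>sets M. 0 < measure M A \<and> (\<forall>u\<in>A. sdm (sec E u) (sec E s) < \<delta>)"
proof -
  obtain Q :: "nat \<Rightarrow> 'a set" where "range Q \<subseteq> sets M \<and> (\<forall>A\<in>sets M. \<forall>\<epsilon>>0. \<exists>j. sdm A (Q j) < \<epsilon>)"
    using countable_dense_sets ..
  then have Q: "\<And>j. Q j \<in> sets M" "\<And>A \<epsilon>. A \<in> sets M \<Longrightarrow> 0 < \<epsilon> \<Longrightarrow> \<exists>j. sdm A (Q j) < \<epsilon>"
    by blast+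
  define U where "U j k = {s \<in> space M. sdm (sec E s) (Q j) < 1 / real (Suc k)}" for j k :: nat
  have U: "U j k \<in> sets M" for j k
    unfolding U_def using sdm_section_measurable[OF E Q(1)] by measurable
  have cnt: "countable (range (\<lambda>(j, k). U j k))" by simp
  have sub: "range (\<lambda>(j, k). U j k) \<subseteq> sets M" using U by auto
  obtain N where N: "N \<in> null_sets M"
    "\<And>V s. V \<in> range (\<lambda>(j, k). U j k) \<Longrightarrow> s \<in> V \<Longrightarrow> s \<notin> N \<Longrightarrow> 0 < measure M V"
    by (rule essential_points[OF cnt sub]) blast
  show ?thesis
  proof (rule that[OF N(1)])
    fix s and \<delta> :: real assume s: "s \<in> space M" "s \<notin> N" and \<delta>: "0 < \<delta>"
    then have "0 < \<delta> / 2" by simp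
    then obtain k where k: "1 / real (Suc k) < \<delta> / 2" using nat_approx_posE by blast
    have Es: "sec E u \<in> sets M" for u by (rule sets_Pair1[OF E])
    obtain j where j: "sdm (sec E s) (Q j) < 1 / real (Suc k)" using Q(2)[OF Es, of "1 / real (Suc k)" s] by auto
    have "s \<in> U j k" using s j by (simp add: U_def)
    then have "0 < measure M (U j k)" using N(2)[of "U j k" s] s(2) by blast
    moreover have "sdm (sec E u) (sec E s) < \<delta>" if "u \<in> U j k" for u
    proof -
      have "sdm (sec E u) (sec E s) \<le> sdm (sec E u) (Q j) + sdm (Q j) (sec E s)"
        by (rule sdm_triangle[OF Es Q(1) Es])
      also have "\<dots> < \<delta>" using that j k by (simp add: U_def sdm_commute[of "Q j"])
      finally show ?thesis .
    qed
    ultimately show "\<exists>A\<in>sets M. 0 < measure M A \<and> (\<forall>u\<in>A. sdm (sec E u) (sec E s) < \<delta>)"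
      using U by blast
  qed
qed

lemma measure_le_sdm:
  assumes "A \<in> sets M" "C \<in> sets M" "D \<in> sets M" "D \<subseteq> A - C \<or> D \<subseteq> C - A"
  shows "measure M D \<le> sdm A C"
  unfolding sdm_def by (rule finite_measure_mono) (use assms in auto)

text \<open>Agreement up to a null set is an equivalence relation on the points whose section has positive
  measure. It has countably many classes, because each member of a countable dense family of sets
  is close to the sections of at most one class. The set \<open>I m\<close> is such a class and \<open>J m\<close> a section from it.\<close>

lemma rectangles_of_sections:
  assumes E: "E \<in> sets MM" and N: "N \<in> null_sets M"
    and dich: "\<And>s s'. s \<in> space M \<Longrightarrow> s \<notin> N \<Longrightarrow> s' \<in> space M \<Longrightarrow> s' \<notin> N \<Longrightarrow>
      measure M (sec E s \<inter> sec E s') = 0 \<or> sdm (sec E s) (sec E s') = 0"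
  obtains I J :: "nat \<Rightarrow> 'a set" where "range I \<subseteq> sets M" "range J \<subseteq> sets M" "disjoint_family I" "disjoint_family J"
    "AE p in MM. p \<in> E \<longleftrightarrow> p \<in> (\<Union>m. I m \<times> J m)"
proof -
  interpret P: pair_sigma_finite M M by (rule pair_sigma_finite_self)
  have Es: "sec E u \<in> sets M" for u by (rule sets_Pair1[OF E])
  obtain Q :: "nat \<Rightarrow> 'a set" where "range Q \<subseteq> sets M \<and> (\<forall>A\<in>sets M. \<forall>\<epsilon>>0. \<exists>j. sdm A (Q j) < \<epsilon>)"
    using countable_dense_sets ..
  then have Q: "\<And>j. Q j \<in> sets M" "\<And>A \<epsilon>. A \<in> sets M \<Longrightarrow> 0 < \<epsilon> \<Longrightarrow> \<exists>j. sdm A (Q j) < \<epsilon>"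
    by blast+
  define X where "X = space M - N"
  have X: "X \<in> sets M" using N by (auto simp: X_def)
  define eqv where "eqv s s' \<longleftrightarrow> sdm (sec E s) (sec E s') = 0" for s s'
  have eqv_sym: "eqv s s' \<Longrightarrow> eqv s' s" for s s' by (simp add: eqv_def sdm_commute)
  have eqv_trans: "eqv s s''" if "eqv s s'" "eqv s' s''" for s s' s''
    using sdm_triangle[OF Es Es Es, of s s'' s'] sdm_nonneg[of "sec E s" "sec E s''"] that by (simp add: eqv_def)
  define W where "W j = {s \<in> X. 0 < measure M (sec E s) \<and> sdm (sec E s) (Q j) < measure M (sec E s) / 4}" for j
  \<comment> \<open>Two sections within a quarter of their measures of the same set are at distance less than the
    sum of their measures, so they cannot be disjoint.\<close>
  have W_eqv: "eqv s s'" if "s \<in> W j" "s' \<in> W j" for s s' j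
  proof (rule ccontr)
    assume "\<not> eqv s s'"
    then have z: "measure M (sec E s \<inter> sec E s') = 0"
      using dich[of s s'] that by (auto simp: eqv_def W_def X_def)
    have "sec E s \<union> sec E s' = (((sec E s - sec E s') \<union> (sec E s' - sec E s)) \<union> (sec E s \<inter> sec E s'))" by blast
    then have "measure M (sec E s \<union> sec E s') \<le> sdm (sec E s) (sec E s') + measure M (sec E s \<inter> sec E s')"
      unfolding sdm_def using Es measure_Un_le[of "(sec E s - sec E s') \<union> (sec E s' - sec E s)" M "sec E s \<inter> sec E s'"]
      by auto
    moreover have "measure M (sec E s) \<le> measure M (sec E s \<union> sec E s')" "measure M (sec E s') \<le> measure M (sec E s \<union> sec E s')"
      by (intro finite_measure_mono; use Es in auto)+
    moreover have "sdm (sec E s) (sec E s') \<le> sdm (sec E s) (Q j) + sdm (sec E s') (Q j)"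
      using sdm_triangle[OF Es Q(1) Es, of s s' j] by (simp add: sdm_commute[of "Q j"])
    ultimately show False using z that by (simp add: W_def)
  qed
  define \<sigma> where "\<sigma> j = (SOME s. s \<in> W j)" for j
  have \<sigma>: "\<sigma> j \<in> W j" if "W j \<noteq> {}" for j
    unfolding \<sigma>_def using that by (auto intro: someI_ex)
  \<comment> \<open>Several \<open>j\<close> can lead to the same class; only the first one is kept.\<close>
  define new where "new j \<longleftrightarrow> W j \<noteq> {} \<and> (\<forall>i<j. W i \<noteq> {} \<longrightarrow> \<not> eqv (\<sigma> i) (\<sigma> j))" for j
  have new_W: "\<sigma> j \<in> W j" if "new j" for j using that \<sigma> by (auto simp: new_def)
  have new_neqv: "\<not> eqv (\<sigma> i) (\<sigma> j)" if "new i" "new j" "i \<noteq> j" for i j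
  proof (cases "i < j")
    case True
    then show ?thesis using that by (auto simp: new_def)
  next
    case False
    then have "\<not> eqv (\<sigma> j) (\<sigma> i)" using that by (auto simp: new_def)
    then show ?thesis using eqv_sym by blast
  qed
  define I where "I j = (if new j then {u \<in> X. eqv u (\<sigma> j)} else {})" for j
  \<comment> \<open>Distinct classes have sections that overlap in a null set, which is removed here.\<close>
  define J where "J j = (if new j then sec E (\<sigma> j) - (\<Union>i\<in>{i. i < j \<and> new i}. sec E (\<sigma> i)) else {})" for j
  have I_sets: "I j \<in> sets M" for j
  proof -
    have "{u \<in> space M. sdm (sec E u) (sec E (\<sigma> j)) = 0} \<in> sets M"
      using sdm_section_measurable[OF E Es] by measurable
    moreover have "{u \<in> X. eqv u (\<sigma> j)} = X \<inter> {u \<in> space M. sdm (sec E u) (sec E (\<sigma> j)) = 0}"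
      by (auto simp: X_def eqv_def)
    ultimately show ?thesis using X by (simp add: I_def sets.Int)
  qed
  have J_sets: "J j \<in> sets M" for j
    unfolding J_def using Es by auto
  have I_disj: "disjoint_family I"
    unfolding disjoint_family_on_def
  proof (intro ballI impI)
    fix i j :: nat assume "i \<noteq> j"
    show "I i \<inter> I j = {}"
    proof (rule ccontr)
      assume "I i \<inter> I j \<noteq> {}"
      then obtain u where "new i" "new j" "eqv u (\<sigma> i)" "eqv u (\<sigma> j)" by (auto simp: I_def split: if_splits)
      then have "eqv (\<sigma> i) (\<sigma> j)" using eqv_sym eqv_trans by blast
      then show False using new_neqv[OF \<open>new i\<close> \<open>new j\<close> \<open>i \<noteq> j\<close>] by blast
    qed
  qed
  have J_disj: "disjoint_family J"
    unfolding disjoint_family_on_def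
  proof (intro ballI impI)
    fix i j :: nat assume "i \<noteq> j"
    then consider "i < j" | "j < i" by linarith
    then show "J i \<inter> J j = {}" by cases (auto simp: J_def)
  qed
  have J_eq: "sdm (sec E (\<sigma> j)) (J j) = 0" if j: "new j" for j
  proof -
    have null: "sec E (\<sigma> j) \<inter> sec E (\<sigma> i) \<in> null_sets M" if i: "i \<in> {i. i < j \<and> new i}" for i
    proof -
      have "measure M (sec E (\<sigma> j) \<inter> sec E (\<sigma> i)) = 0"
        using dich[of "\<sigma> j" "\<sigma> i"] new_W[OF j] new_W[of i] i new_neqv[of j i] j
        by (auto simp: W_def X_def eqv_def)
      then show ?thesis using Es by (simp add: null_sets_def emeasure_eq_measure)
    qed
    have "(\<Union>i\<in>{i. i < j \<and> new i}. sec E (\<sigma> j) \<inter> sec E (\<sigma> i)) \<in> null_sets M"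
      by (rule null_sets_UN'[OF _ null]) auto
    moreover have "(sec E (\<sigma> j) - J j) \<union> (J j - sec E (\<sigma> j)) = (\<Union>i\<in>{i. i < j \<and> new i}. sec E (\<sigma> j) \<inter> sec E (\<sigma> i))"
      using j by (auto simp: J_def)
    ultimately show ?thesis by (simp add: sdm_def measure_def null_setsD1)
  qed
  let ?R = "\<Union>m. I m \<times> J m"
  have R [measurable]: "?R \<in> sets MM" using I_sets J_sets by auto
  have sec_R: "sec ?R u = J j" if uj: "u \<in> I j" for u j
  proof -
    have uniq: "m = j" if "u \<in> I m" for m
      using I_disj uj that by (auto simp: disjoint_family_on_def)
    show ?thesis
    proof (rule set_eqI)
      fix t
      have "(u, t) \<in> ?R \<longleftrightarrow> (\<exists>m. u \<in> I m \<and> t \<in> J m)" by simp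
      also have "\<dots> \<longleftrightarrow> t \<in> J j" using uj uniq by metis
      finally show "t \<in> sec ?R u \<longleftrightarrow> t \<in> J j" by simp
    qed
  qed
  have sec_R0: "sec ?R u = {}" if "\<forall>j. u \<notin> I j" for u using that by auto
  have main: "sdm (sec E u) (sec ?R u) = 0" if u: "u \<in> X" for u
  proof (cases "\<exists>j. u \<in> I j")
    case True
    then obtain j where j: "u \<in> I j" by blast
    then have nj: "new j" and ej: "eqv u (\<sigma> j)" by (auto simp: I_def split: if_splits)
    have "sdm (sec E u) (J j) \<le> sdm (sec E u) (sec E (\<sigma> j)) + sdm (sec E (\<sigma> j)) (J j)"
      by (rule sdm_triangle[OF Es Es J_sets])
    then show ?thesis
      using J_eq[OF nj] ej sdm_nonneg[of "sec E u" "J j"] by (simp add: sec_R[OF j] eqv_def)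
  next
    case False
    have "measure M (sec E u) = 0"
    proof (rule ccontr)
      assume "measure M (sec E u) \<noteq> 0"
      then have pos: "0 < measure M (sec E u)" by (simp add: less_le)
      then obtain j0 where "sdm (sec E u) (Q j0) < measure M (sec E u) / 4"
        using Q(2)[OF Es, of "measure M (sec E u) / 4" u] by auto
      then have "u \<in> W j0" using u pos by (simp add: W_def)
      then have ex: "W j0 \<noteq> {} \<and> eqv u (\<sigma> j0)" using W_eqv \<sigma> by blast
      define j where "j = (LEAST j. W j \<noteq> {} \<and> eqv u (\<sigma> j))"
      have j: "W j \<noteq> {}" "eqv u (\<sigma> j)" unfolding j_def using LeastI[of "\<lambda>j. W j \<noteq> {} \<and> eqv u (\<sigma> j)", OF ex] by auto
      have "new j"
        unfolding new_def
      proof (intro conjI j(1) allI impI notI)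
        fix i assume "i < j" "W i \<noteq> {}" "eqv (\<sigma> i) (\<sigma> j)"
        then have "eqv u (\<sigma> i)" using j(2) eqv_sym eqv_trans by blast
        then have "j \<le> i" unfolding j_def using \<open>W i \<noteq> {}\<close> by (intro Least_le) blast
        then show False using \<open>i < j\<close> by simp
      qed
      then have "u \<in> I j" using u j by (simp add: I_def)
      then show False using False by blast
    qed
    moreover have "sdm (sec E u) {} = measure M (sec E u)" by (simp add: sdm_def)
    ultimately show ?thesis using sec_R0[of u] False by simp
  qed
  have "AE p in MM. p \<in> E \<longleftrightarrow> p \<in> ?R"
  proof (rule P.AE_pair_measure)
    show "{x \<in> space MM. (x \<in> E) = (x \<in> ?R)} \<in> sets MM" using E by measurable
    have "AE s in M. s \<notin> N" by (rule AE_not_in[OF N])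
    then show "AE s in M. AE t in M. ((s, t) \<in> E) = ((s, t) \<in> ?R)"
      using AE_space
    proof eventually_elim
      case (elim s)
      then have "s \<in> X" by (simp add: X_def)
      let ?D = "(sec E s - sec ?R s) \<union> (sec ?R s - sec E s)"
      have D: "?D \<in> sets M" using Es sets_Pair1[OF R] by auto
      have "emeasure M ?D = 0" using main[OF \<open>s \<in> X\<close>] by (simp add: sdm_def emeasure_eq_measure)
      then have "?D \<in> null_sets M" using D by (simp add: null_sets_def)
      then have "AE t in M. t \<notin> ?D" by (rule AE_not_in)
      then show ?case by eventually_elim blast
    qed
  qed
  then show ?thesis using that[of I J] I_sets J_sets I_disj J_disj by blast
qed

end

locale small_idempotent = bounded_bimodule_map M P K + countably_generated_measure M B
  for M :: "'a measure" and P K B +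
  assumes idempotent: "\<And>T. T \<in> BH M \<Longrightarrow> P (P T) = P T" and small: "K < 2 / sqrt 3"
begin

text \<open>Rows near \<open>s\<close> and rows near \<open>s'\<close>, against the columns in \<open>E\<^sub>s \<inter> E\<^sub>s\<^sub>'\<close> and those in \<open>E\<^sub>s - E\<^sub>s\<^sub>'\<close>, form four
  rectangles that \<open>E\<close> almost fills, except that it almost avoids the one of the rows near \<open>s'\<close> and
  the columns outside \<open>E\<^sub>s\<^sub>'\<close>.\<close>

lemma section_dichotomy:
  assumes E: "E \<in> sets MM"
    and PE: "\<And>k. k \<in> bmeas MM \<Longrightarrow> P (kernel_op M k) = kernel_op M (\<lambda>p. indicator E p * k p)"
    and s: "\<And>\<delta>. 0 < \<delta> \<Longrightarrow> \<exists>A\<in>sets M. 0 < measure M A \<and> (\<forall>u\<in>A. sdm (sec E u) (sec E s) < \<delta>)"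
    and s': "\<And>\<delta>. 0 < \<delta> \<Longrightarrow> \<exists>A\<in>sets M. 0 < measure M A \<and> (\<forall>u\<in>A. sdm (sec E u) (sec E s') < \<delta>)"
    and meet: "measure M (sec E s \<inter> sec E s') \<noteq> 0"
  shows "measure M (sec E s - sec E s') = 0"
proof (rule ccontr)
  assume neq: "measure M (sec E s - sec E s') \<noteq> 0"
  have Es: "sec E u \<in> sets M" for u by (rule sets_Pair1[OF E])
  define C1 where "C1 = sec E s \<inter> sec E s'"
  define C2 where "C2 = sec E s - sec E s'"
  have C: "C1 \<in> sets M" "C2 \<in> sets M" "C1 \<inter> C2 = {}" "0 < measure M C1" "0 < measure M C2"
    using Es meet neq by (auto simp: C1_def C2_def less_le)
  \<comment> \<open>If the occupancies of three corners exceed \<open>1 - \<epsilon>\<close> and the fourth is below \<open>\<epsilon>\<close>, the four-corner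
    estimate bounds \<open>6 - 7 \<epsilon>\<close> by \<open>3 sqrt 3 K < 6\<close>.\<close>
  have "3 * sqrt 3 * K < 3 * sqrt 3 * (2 / sqrt 3)" using small by (intro mult_strict_left_mono) auto
  then have K6: "3 * sqrt 3 * K < 6" by simp
  define \<epsilon> where "\<epsilon> = (6 - 3 * sqrt 3 * K) / 8"
  have e: "0 < \<epsilon>" using K6 by (simp add: \<epsilon>_def)
  define \<delta> where "\<delta> = min (\<epsilon> * min (measure M C1) (measure M C2)) (measure M C2 / 2)"
  have d: "0 < \<delta>" using e C by (simp add: \<delta>_def)
  have d1: "\<delta> \<le> \<epsilon> * measure M C1" and d2: "\<delta> \<le> \<epsilon> * measure M C2" and d3: "2 * \<delta> \<le> measure M C2"
    using e by (auto simp: \<delta>_def min_le_iff_disj mult_le_cancel_left)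
  obtain A1 where A1: "A1 \<in> sets M" "0 < measure M A1" "\<And>u. u \<in> A1 \<Longrightarrow> sdm (sec E u) (sec E s) < \<delta>" using s[OF d] by blast
  obtain A2 where A2: "A2 \<in> sets M" "0 < measure M A2" "\<And>u. u \<in> A2 \<Longrightarrow> sdm (sec E u) (sec E s') < \<delta>" using s'[OF d] by blast
  have disj: "A1 \<inter> A2 = {}"
  proof (rule ccontr)
    assume "A1 \<inter> A2 \<noteq> {}"
    then obtain u where u: "u \<in> A1" "u \<in> A2" by blast
    have "measure M C2 \<le> sdm (sec E s) (sec E s')" by (rule measure_le_sdm[OF Es Es C(2)]) (simp add: C2_def)
    also have "\<dots> \<le> sdm (sec E s) (sec E u) + sdm (sec E u) (sec E s')" by (rule sdm_triangle[OF Es Es Es])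
    also have "\<dots> < 2 * \<delta>" using A1(3)[OF u(1)] A2(3)[OF u(2)] by (simp add: sdm_commute[of "sec E s"])
    finally show False using d3 by simp
  qed
  have full: "1 - \<epsilon> \<le> occupancy E A D"
    if A: "A \<in> sets M" "0 < measure M A" "\<And>u. u \<in> A \<Longrightarrow> sdm (sec E u) (sec E r) < \<delta>"
      and D: "D \<in> sets M" "0 < measure M D" "D \<subseteq> sec E r" "\<delta> \<le> \<epsilon> * measure M D" for A D r
  proof -
    have "(1 - \<epsilon>) * measure M D \<le> measure M (sec E u \<inter> D)" if u: "u \<in> A" for u
    proof -
      have "measure M (D - sec E u) \<le> sdm (sec E u) (sec E r)"
        by (rule measure_le_sdm[OF Es Es]) (use D Es in auto)
      moreover have "measure M D = measure M (sec E u \<inter> D) + measure M (D - sec E u)"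
        using finite_measure_Diff'[OF D(1) Es, of u] by (simp add: Int_commute)
      ultimately show ?thesis using A(3)[OF u] D(4) by (simp add: left_diff_distrib)
    qed
    from measure_rectangle_ge[OF E A(1) D(1) this]
    show ?thesis using A(2) D(2) by (simp add: occupancy_def le_divide_eq mult_ac)
  qed
  have empty: "occupancy E A2 C2 \<le> \<epsilon>"
  proof -
    have "measure M (sec E u \<inter> C2) \<le> \<epsilon> * measure M C2" if u: "u \<in> A2" for u
    proof -
      have "measure M (sec E u \<inter> C2) \<le> sdm (sec E u) (sec E s')"
        by (rule measure_le_sdm[OF Es Es]) (use C Es in \<open>auto simp: C2_def\<close>)
      then show ?thesis using A2(3)[OF u] d2 by simp
    qed
    from measure_rectangle_le[OF E A2(1) C(2) this]
    show ?thesis using A2(2) C(5) by (simp add: occupancy_def divide_le_eq mult_ac)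
  qed
  have "1 - \<epsilon> \<le> occupancy E A1 C1" by (rule full[OF A1 C(1,4) _ d1]) (auto simp: C1_def)
  moreover have "1 - \<epsilon> \<le> occupancy E A1 C2" by (rule full[OF A1 C(2,5) _ d2]) (auto simp: C2_def)
  moreover have "1 - \<epsilon> \<le> occupancy E A2 C1" by (rule full[OF A2 C(1,4) _ d1]) (auto simp: C1_def)
  moreover have "2 * occupancy E A1 C1 + 2 * occupancy E A1 C2 + 2 * occupancy E A2 C1 - occupancy E A2 C2 \<le> 3 * sqrt 3 * K"
    by (rule four_corner_estimate[OF E PE A1(1) A2(1) disj A1(2) A2(2) C])
  ultimately have "6 - 7 * \<epsilon> \<le> 3 * sqrt 3 * K" using empty by linarith
  moreover have "3 * sqrt 3 * K = 6 - 8 * \<epsilon>" unfolding \<epsilon>_def by (simp add: field_simps)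
  ultimately show False using e by linarith
qed

lemma rectangle_structure:
  obtains I J :: "nat \<Rightarrow> 'a set" where "range I \<subseteq> sets M" "range J \<subseteq> sets M" "disjoint_family I" "disjoint_family J"
    "\<And>k. k \<in> bmeas MM \<Longrightarrow> P (kernel_op M k) = kernel_op M (\<lambda>p. indicator (\<Union>m. I m \<times> J m) p * k p)"
proof -
  obtain E where E: "E \<in> sets MM"
    and PE: "\<And>k. k \<in> bmeas MM \<Longrightarrow> P (kernel_op M k) = kernel_op M (\<lambda>p. indicator E p * k p)"
    by (rule idempotent_symbol[OF idempotent]) (assumption | rule that | simp)+
  have Es: "sec E u \<in> sets M" for u by (rule sets_Pair1[OF E])
  obtain N where N: "N \<in> null_sets M"
    and ess: "\<And>s \<delta>. s \<in> space M \<Longrightarrow> s \<notin> N \<Longrightarrow> 0 < \<delta> \<Longrightarrow>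
      \<exists>A\<in>sets M. 0 < measure M A \<and> (\<forall>u\<in>A. sdm (sec E u) (sec E s) < \<delta>)"
    by (rule essential_sections[OF E]) blast
  have dich: "measure M (sec E s \<inter> sec E s') = 0 \<or> sdm (sec E s) (sec E s') = 0"
    if s: "s \<in> space M" "s \<notin> N" and s': "s' \<in> space M" "s' \<notin> N" for s s'
  proof (rule disj_imp[THEN iffD2], rule impI)
    assume neq: "measure M (sec E s \<inter> sec E s') \<noteq> 0"
    have "measure M (sec E s - sec E s') = 0"
      by (rule section_dichotomy[OF E PE ess[OF s] ess[OF s'] neq])
    moreover have "measure M (sec E s' - sec E s) = 0"
      by (rule section_dichotomy[OF E PE ess[OF s'] ess[OF s] neq[unfolded Int_commute[of "sec E s"]]])
    ultimately have "sdm (sec E s) (sec E s') \<le> 0"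
      unfolding sdm_def using measure_Un_le[of "sec E s - sec E s'" M "sec E s' - sec E s"] Es by auto
    then show "sdm (sec E s) (sec E s') = 0" using sdm_nonneg[of "sec E s" "sec E s'"] by simp
  qed
  obtain I J :: "nat \<Rightarrow> 'a set" where IJ: "range I \<subseteq> sets M" "range J \<subseteq> sets M" "disjoint_family I" "disjoint_family J"
    and AE: "AE p in MM. p \<in> E \<longleftrightarrow> p \<in> (\<Union>m. I m \<times> J m)"
    by (rule rectangles_of_sections[OF E N dich])
  have R: "(\<Union>m. I m \<times> J m) \<in> sets MM" using IJ(1,2) by auto
  show ?thesis
  proof (rule that[OF IJ])
    fix k assume k: "k \<in> bmeas MM"
    have "kernel_op M (\<lambda>p. indicator E p * k p) = kernel_op M (\<lambda>p. indicator (\<Union>m. I m \<times> J m) p * k p)"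
    proof (rule kernel_op_cong_AE)
      show "AE p in MM. indicator E p * k p = indicator (\<Union>m. I m \<times> J m) p * k p"
        using AE by eventually_elim (simp add: indicator_def)
    qed (intro bmeas_mult bmeas_indicator k E R)+
    then show "P (kernel_op M k) = kernel_op M (\<lambda>p. indicator (\<Union>m. I m \<times> J m) p * k p)"
      using PE[OF k] by simp
  qed
qed

end

section \<open>The block formula for the idempotent\<close>

lemma series_cauchy_schwarz:
  fixes a b :: "nat \<Rightarrow> real"
  assumes a: "summable (\<lambda>n. (a n)\<^sup>2)" and b: "summable (\<lambda>n. (b n)\<^sup>2)"
    and A: "(\<Sum>n. (a n)\<^sup>2) \<le> A\<^sup>2" and B: "(\<Sum>n. (b n)\<^sup>2) \<le> B\<^sup>2" and nn: "0 \<le> A" "0 \<le> B"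
  shows "(\<Sum>n<N. a n * b n) \<le> A * B" and "(\<Sum>n. a n * b n) \<le> A * B"
proof -
  show fin: "(\<Sum>n<N. a n * b n) \<le> A * B" for N
  proof -
    have "(\<Sum>n<N. a n * b n)\<^sup>2 \<le> (\<Sum>n<N. (a n)\<^sup>2) * (\<Sum>n<N. (b n)\<^sup>2)"
      by (rule Cauchy_Schwarz_ineq_sum)
    also have "\<dots> \<le> A\<^sup>2 * B\<^sup>2"
      by (intro mult_mono order_trans[OF sum_le_suminf[OF a] A] order_trans[OF sum_le_suminf[OF b] B])
        (auto intro: sum_nonneg)
    also have "\<dots> = (A * B)\<^sup>2" by (simp add: power_mult_distrib)
    finally show ?thesis by (rule power2_le_imp_le) (use nn in simp)
  qed
  show "(\<Sum>n. a n * b n) \<le> A * B"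
    by (rule suminf_le_const[OF summable_mult_of_squares[OF a b] fin])
qed

context finite_measure
begin

lemma block_squares:
  assumes I: "range I \<subseteq> sets M" and disj: "disjoint_family I" and f: "f \<in> square_integrable M"
  shows "summable (\<lambda>m. (l2norm M (\<lambda>x. indicator (I m) x * f x))\<^sup>2)"
    and "(\<Sum>m. (l2norm M (\<lambda>x. indicator (I m) x * f x))\<^sup>2) \<le> (l2norm M f)\<^sup>2"
proof -
  have Im: "I m \<in> sets M" for m using I by blast
  have sq: "(l2norm M (\<lambda>x. indicator (I m) x * f x))\<^sup>2 = (\<integral>x. indicator (I m) x * (cmod (f x))\<^sup>2 \<partial>M)" for m
    unfolding l2norm_power2 by (intro Bochner_Integration.integral_cong) (auto simp: indicator_def)
  have int: "integrable M (\<lambda>x. indicator (I m) x * (cmod (f x))\<^sup>2)" for m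
    using integrable_real_mult_indicator[OF Im sqintD(2)[OF f]] by (simp add: mult.commute)
  have bd: "(\<Sum>m<n. (l2norm M (\<lambda>x. indicator (I m) x * f x))\<^sup>2) \<le> (l2norm M f)\<^sup>2" for n
  proof -
    have "(\<Sum>m<n. (l2norm M (\<lambda>x. indicator (I m) x * f x))\<^sup>2) = (\<integral>x. (\<Sum>m<n. indicator (I m) x * (cmod (f x))\<^sup>2) \<partial>M)"
      unfolding sq by (rule Bochner_Integration.integral_sum[symmetric]) (rule int)
    also have "\<dots> \<le> (\<integral>x. (cmod (f x))\<^sup>2 \<partial>M)"
    proof (rule integral_mono)
      fix x
      have "(\<Sum>m<n. indicator (I m) x) = (indicator (\<Union>m<n. I m) x :: real)"
        by (rule indicator_UN_disjoint[symmetric]) (use disj in \<open>auto simp: disjoint_family_on_def\<close>)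
      then have "(\<Sum>m<n. indicator (I m) x) \<le> (1 :: real)" by (simp add: indicator_def)
      then show "(\<Sum>m<n. indicator (I m) x * (cmod (f x))\<^sup>2) \<le> (cmod (f x))\<^sup>2"
        unfolding sum_distrib_right[symmetric] by (simp add: mult_left_le_one_le sum_nonneg)
    qed (intro Bochner_Integration.integrable_sum int sqintD(2)[OF f])+
    finally show ?thesis by (simp add: l2norm_power2)
  qed
  show s: "summable (\<lambda>m. (l2norm M (\<lambda>x. indicator (I m) x * f x))\<^sup>2)"
    by (rule summableI_nonneg_bounded[OF _ bd]) simp
  show "(\<Sum>m. (l2norm M (\<lambda>x. indicator (I m) x * f x))\<^sup>2) \<le> (l2norm M f)\<^sup>2"
    by (rule suminf_le_const[OF s bd])
qed

lemma op_norm_eq_0: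
  assumes T: "T \<in> BH M" and 0: "op_norm M T = 0" shows "T = op_zero M"
proof (rule op_eqI[OF T op_zero_BH])
  fix f g assume f: "f \<in> square_integrable M" and g: "g \<in> square_integrable M"
  show "form M T f g = form M (op_zero M) f g"
    using form_bound[OF T f g] by (simp add: 0 form_op_zero f g)
qed

lemma op_norm_scale:
  assumes T: "T \<in> BH M" shows "op_norm M (op_scale M c T) = cmod c * op_norm M T"
proof -
  have le: "op_norm M (op_scale M d S) \<le> cmod d * op_norm M S" if S: "S \<in> BH M" for d S
  proof (rule op_norm_leI[OF op_scale_BH[OF S]])
    fix f g assume f: "f \<in> square_integrable M" and g: "g \<in> square_integrable M"
    show "cmod (form M (op_scale M d S) f g) \<le> cmod d * op_norm M S * l2norm M f * l2norm M g"
      using mult_left_mono[OF form_bound[OF S f g], of "cmod d"]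
      by (simp add: form_op_scale S f g norm_mult mult.assoc)
  qed (simp add: op_norm_nonneg S)
  show ?thesis
  proof (cases "c = 0")
    case True
    then show ?thesis using le[OF T, of c] op_norm_nonneg[OF op_scale_BH[OF T, of c]] by simp
  next
    case False
    have "op_scale M (1 / c) (op_scale M c T) = T"
    proof (rule op_eqI[OF _ T])
      show "op_scale M (1 / c) (op_scale M c T) \<in> BH M" by (intro op_scale_BH T)
      fix f g assume f: "f \<in> square_integrable M" and g: "g \<in> square_integrable M"
      show "form M (op_scale M (1 / c) (op_scale M c T)) f g = form M T f g"
        using False by (simp add: form_op_scale op_scale_BH T f g)
    qed
    then have "op_norm M T \<le> cmod (1 / c) * op_norm M (op_scale M c T)"
      using le[OF op_scale_BH[OF T], of "1 / c" c] by simp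
    then have "cmod c * op_norm M T \<le> op_norm M (op_scale M c T)"
      using False by (simp add: norm_divide field_simps)
    then show ?thesis using le[OF T, of c] by simp
  qed
qed

end

locale rectangle_idempotent = bounded_bimodule_map M P K + countably_generated_measure M B
  for M :: "'a measure" and P K B +
  fixes I J :: "nat \<Rightarrow> 'a set"
  assumes normal: "wstar_continuous M P" and idempotent: "\<And>T. T \<in> BH M \<Longrightarrow> P (P T) = P T"
    and I_sets: "range I \<subseteq> sets M" and J_sets: "range J \<subseteq> sets M"
    and I_disj: "disjoint_family I" and J_disj: "disjoint_family J"
    and P_kernel_op: "\<And>k. k \<in> bmeas MM \<Longrightarrow>
      P (kernel_op M k) = kernel_op M (\<lambda>p. indicator (\<Union>m. I m \<times> J m) p * k p)"
begin

lemma I_meas: "I m \<in> sets M" and J_meas: "J m \<in> sets M"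
  using I_sets J_sets by blast+

abbreviation cutI :: "nat \<Rightarrow> ('a \<Rightarrow> complex) \<Rightarrow> 'a \<Rightarrow> complex" where
  "cutI m g \<equiv> (\<lambda>x. indicator (I m) x * g x)"

abbreviation cutJ :: "nat \<Rightarrow> ('a \<Rightarrow> complex) \<Rightarrow> 'a \<Rightarrow> complex" where
  "cutJ m f \<equiv> (\<lambda>x. indicator (J m) x * f x)"

lemma cutI_sq: "g \<in> square_integrable M \<Longrightarrow> cutI m g \<in> square_integrable M"
  by (rule sqint_indicator_mult[OF _ I_meas])

lemma cutJ_sq: "f \<in> square_integrable M \<Longrightarrow> cutJ m f \<in> square_integrable M"
  by (rule sqint_indicator_mult[OF _ J_meas])

lemma rectangles_measurable: "(\<Union>m. I m \<times> J m) \<in> sets MM"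
  using I_meas J_meas by auto

lemma rectangles_disjoint: "disjoint_family (\<lambda>m. I m \<times> J m)"
  using I_disj by (auto simp: disjoint_family_on_def)

lemma block_normal:
  assumes f: "f \<in> square_integrable M" and g: "g \<in> square_integrable M"
  shows "(\<lambda>T. \<Sum>m. form M T (cutJ m f) (cutI m g)) \<in> normal_functionals M"
  by (rule normal_functionalI[OF cutJ_sq[OF f] cutI_sq[OF g] block_squares(1)[OF J_sets J_disj f]
        block_squares(1)[OF I_sets I_disj g]])

text \<open>On kernels \<open>P\<close> is the restriction to the union of the rectangles, and the integral over this
  disjoint union is the sum of the integrals.\<close>

lemma block_formula_kernel:
  assumes k: "k \<in> bmeas MM" and f: "f \<in> square_integrable M" and g: "g \<in> square_integrable M"
  shows "form M (P (kernel_op M k)) f g = (\<Sum>m. form M (kernel_op M k) (cutJ m f) (cutI m g))"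
proof -
  let ?h = "\<lambda>p. k p * (cnj (g (fst p)) * f (snd p))"
  let ?R = "\<lambda>m. I m \<times> J m"
  have int: "integrable MM ?h" by (rule kernel_product_integrable[OF k f g])
  have R: "?R m \<in> sets MM" for m using I_meas J_meas by auto
  have "set_integrable MM (\<Union>m. ?R m) ?h"
    unfolding set_integrable_def by (rule integrable_mult_indicator[OF rectangles_measurable int])
  then have "(LINT p:(\<Union>m. ?R m)|MM. ?h p) = (\<Sum>m. (LINT p:?R m|MM. ?h p))"
    using rectangles_disjoint by (intro lebesgue_integral_countable_add R) (auto simp: disjoint_family_on_def)
  moreover have "(LINT p:(\<Union>m. ?R m)|MM. ?h p) = form M (P (kernel_op M k)) f g"
    unfolding P_kernel_op[OF k] set_lebesgue_integral_def
      form_kernel_op[OF bmeas_mult[OF bmeas_indicator[OF rectangles_measurable] k] f g]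
    by (intro Bochner_Integration.integral_cong) (auto simp: indicator_def)
  moreover have "(LINT p:?R m|MM. ?h p) = form M (kernel_op M k) (cutJ m f) (cutI m g)" for m
    unfolding set_lebesgue_integral_def form_kernel_op[OF k cutJ_sq[OF f] cutI_sq[OF g]]
    by (intro Bochner_Integration.integral_cong) (auto simp: indicator_def)
  ultimately show ?thesis by simp
qed

lemma P_limitin:
  assumes "limitin (wstar_topology M) S T F"
  shows "limitin (wstar_topology M) (\<lambda>n. P (S n)) (P T) F"
  using continuous_map_limit[OF normal[unfolded wstar_continuous_def] assms] by (simp add: o_def)

text \<open>Both sides are w*-continuous in \<open>T\<close>, and integral operators with bounded kernels are w*-dense.\<close>

lemma block_formula:
  assumes T: "T \<in> BH M" and f: "f \<in> square_integrable M" and g: "g \<in> square_integrable M"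
  shows "form M (P T) f g = (\<Sum>m. form M T (cutJ m f) (cutI m g))"
proof -
  obtain k :: "nat \<Rightarrow> 'a \<times> 'a \<Rightarrow> complex" where k: "\<And>n. k n \<in> bmeas MM"
    and lim: "limitin (wstar_topology M) (\<lambda>n. kernel_op M (k n)) T sequentially"
    by (rule kernel_op_dense[OF T]) blast
  have "(\<lambda>n. form M (P (kernel_op M (k n))) f g) \<longlonglongrightarrow> form M (P T) f g"
    by (rule limitin_wstar_form[OF P_limitin[OF lim] P_BH[OF kernel_op_BH[OF k]] f g])
  moreover have "(\<lambda>n. \<Sum>m. form M (kernel_op M (k n)) (cutJ m f) (cutI m g)) \<longlonglongrightarrow> (\<Sum>m. form M T (cutJ m f) (cutI m g))"
    by (rule limitin_wstar_normal_functional[OF lim block_normal[OF f g]])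
  ultimately show ?thesis
    unfolding block_formula_kernel[OF k f g] by (rule LIMSEQ_unique)
qed

lemma block_terms_summable:
  assumes T: "T \<in> BH M" and f: "f \<in> square_integrable M" and g: "g \<in> square_integrable M"
  shows "summable (\<lambda>m. form M T (cutJ m f) (cutI m g))"
    and "cmod (\<Sum>m<N. form M T (cutJ m f) (cutI m g)) \<le> op_norm M T * l2norm M f * l2norm M g"
    and "cmod (\<Sum>m. form M T (cutJ m f) (cutI m g)) \<le> op_norm M T * l2norm M f * l2norm M g"
proof -
  let ?a = "\<lambda>m. l2norm M (cutJ m f)" and ?b = "\<lambda>m. l2norm M (cutI m g)"
  note bf = block_squares[OF J_sets J_disj f] and bg = block_squares[OF I_sets I_disj g]
  note cs = series_cauchy_schwarz[OF bf(1) bg(1) bf(2) bg(2) l2norm_nonneg l2norm_nonneg]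
  have term_le: "norm (form M T (cutJ m f) (cutI m g)) \<le> op_norm M T * (?a m * ?b m)" for m
    using form_bound[OF T cutJ_sq[OF f] cutI_sq[OF g], of m m] by (simp add: mult.assoc)
  have sm: "summable (\<lambda>m. op_norm M T * (?a m * ?b m))"
    by (intro summable_mult summable_mult_of_squares bf bg)
  show "summable (\<lambda>m. form M T (cutJ m f) (cutI m g))"
    by (rule summable_comparison_test'[OF sm term_le])
  have "cmod (\<Sum>m<N. form M T (cutJ m f) (cutI m g)) \<le> (\<Sum>m<N. op_norm M T * (?a m * ?b m))" for N
    by (rule order_trans[OF norm_sum sum_mono[OF term_le]])
  also have "(\<Sum>m<N. op_norm M T * (?a m * ?b m)) \<le> op_norm M T * (l2norm M f * l2norm M g)" for N
    unfolding sum_distrib_left[symmetric] by (rule mult_left_mono[OF cs(1) op_norm_nonneg[OF T]])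
  finally show fin: "cmod (\<Sum>m<N. form M T (cutJ m f) (cutI m g)) \<le> op_norm M T * l2norm M f * l2norm M g" for N
    by (simp add: mult.assoc)
  have "(\<lambda>N. \<Sum>m<N. form M T (cutJ m f) (cutI m g)) \<longlonglongrightarrow> (\<Sum>m. form M T (cutJ m f) (cutI m g))"
    using summable_LIMSEQ[OF \<open>summable (\<lambda>m. form M T (cutJ m f) (cutI m g))\<close>] .
  then show "cmod (\<Sum>m. form M T (cutJ m f) (cutI m g)) \<le> op_norm M T * l2norm M f * l2norm M g"
    by (rule LIMSEQ_le_const2[OF tendsto_norm]) (use fin in blast)
qed

text \<open>The series is bounded by \<open>\<parallel>T\<parallel>\<close> times the inner product of the sequences of norms of the pieces of
  \<open>f\<close> and \<open>g\<close>, which are square-summable with sums at most \<open>\<parallel>f\<parallel>\<^sup>2\<close> and \<open>\<parallel>g\<parallel>\<^sup>2\<close>.\<close>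

lemma contraction:
  assumes T: "T \<in> BH M" shows "op_norm M (P T) \<le> op_norm M T"
  by (rule op_norm_leI[OF P_BH[OF T] op_norm_nonneg[OF T]])
     (simp only: block_formula[OF T] block_terms_summable(3)[OF T])

definition block :: "'a oper \<Rightarrow> nat \<Rightarrow> 'a oper" where
  "block T m = op_mult M (mult_op M (indicator (I m))) (op_mult M T (mult_op M (indicator (J m))))"

lemma indicator_Linfty: "A \<in> sets M \<Longrightarrow> indicator A \<in> Linfty M"
  by (intro bmeas_Linfty bmeas_indicator)

lemma block_BH: "T \<in> BH M \<Longrightarrow> block T m \<in> BH M"
  unfolding block_def by (intro op_mult_BH mult_op_BH indicator_Linfty I_meas J_meas)

lemma form_block:
  assumes "T \<in> BH M" "f \<in> square_integrable M" "g \<in> square_integrable M"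
  shows "form M (block T m) f g = form M T (cutJ m f) (cutI m g)"
proof -
  have "(\<lambda>x. cnj (indicator (I m) x) * g x) = cutI m g" by (auto simp: indicator_def)
  then show ?thesis
    unfolding block_def
    using form_mult_op_both[OF assms(1) indicator_Linfty[OF I_meas] indicator_Linfty[OF J_meas] assms(2,3), of m m]
    by simp
qed

lemma block_sum_limitin:
  assumes T: "T \<in> BH M"
  shows "limitin (wstar_topology M) (op_sum M (block T)) (P T) sequentially"
proof (rule limitin_wstar_of_bounded)
  have form: "form M (op_sum M (block T) n) f g = (\<Sum>m<n. form M T (cutJ m f) (cutI m g))"
    if "f \<in> square_integrable M" "g \<in> square_integrable M" for n f g
    using that by (simp add: form_op_sum block_BH form_block T)
  show S: "op_sum M (block T) n \<in> BH M" for n by (rule op_sum_BH[OF block_BH[OF T]])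
  show "P T \<in> BH M" by (rule P_BH[OF T])
  show "op_norm M (op_sum M (block T) n) \<le> op_norm M T" for n
    by (rule op_norm_leI[OF S op_norm_nonneg[OF T]]) (simp only: form block_terms_summable(2)[OF T])
  fix f g assume f: "f \<in> square_integrable M" and g: "g \<in> square_integrable M"
  show "(\<lambda>n. form M (op_sum M (block T) n) f g) \<longlonglongrightarrow> form M (P T) f g"
    unfolding form[OF f g] block_formula[OF T f g] by (rule summable_LIMSEQ[OF block_terms_summable(1)[OF T f g]])
qed

section \<open>The range of the idempotent\<close>

lemma range_eq_fixed: "P ` BH M = {T \<in> BH M. P T = T}"
  using P_BH idempotent by (auto intro: image_eqI[OF sym])

lemma form_zero_left: "T \<in> BH M \<Longrightarrow> g \<in> square_integrable M \<Longrightarrow> form M T (\<lambda>_. 0) g = 0"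
  using form_scale_left[OF _ zero_sqint, of T M g 0] by simp

text \<open>Cutting either argument leaves a single term of the block formula.\<close>

lemma block_formula_cut:
  assumes T: "T \<in> BH M" and f: "f \<in> square_integrable M" and g: "g \<in> square_integrable M"
  shows "form M (P T) (cutJ n f) g = form M T (cutJ n f) (cutI n g)"
    and "form M (P T) f (cutI n g) = form M T (cutJ n f) (cutI n g)"
proof -
  have J0: "cutJ m (cutJ n f) = (if m = n then cutJ n f else (\<lambda>_. 0))" for m
    using J_disj by (auto simp: indicator_def disjoint_family_on_def fun_eq_iff)
  have I0: "cutI m (cutI n g) = (if m = n then cutI n g else (\<lambda>_. 0))" for m
    using I_disj by (auto simp: indicator_def disjoint_family_on_def fun_eq_iff)
  have z: "form M T f' (\<lambda>_. 0) = 0" if "f' \<in> square_integrable M" for f'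
    using form_scale_right[OF T zero_sqint that, of 0] by simp
  have "(\<lambda>m. form M T (cutJ m (cutJ n f)) (cutI m g)) = (\<lambda>m. if m = n then form M T (cutJ n f) (cutI n g) else 0)"
    by (auto simp: J0 form_zero_left[OF T cutI_sq[OF g]])
  then have "(\<lambda>m. form M T (cutJ m (cutJ n f)) (cutI m g)) sums form M T (cutJ n f) (cutI n g)"
    using sums_single[of n "\<lambda>_. form M T (cutJ n f) (cutI n g)"] by simp
  then show "form M (P T) (cutJ n f) g = form M T (cutJ n f) (cutI n g)"
    unfolding block_formula[OF T cutJ_sq[OF f] g] by (rule sums_unique[symmetric])
  have "(\<lambda>m. form M T (cutJ m f) (cutI m (cutI n g))) = (\<lambda>m. if m = n then form M T (cutJ n f) (cutI n g) else 0)"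
    by (auto simp: I0 z[OF cutJ_sq[OF f]])
  then have "(\<lambda>m. form M T (cutJ m f) (cutI m (cutI n g))) sums form M T (cutJ n f) (cutI n g)"
    using sums_single[of n "\<lambda>_. form M T (cutJ n f) (cutI n g)"] by simp
  then show "form M (P T) f (cutI n g) = form M T (cutJ n f) (cutI n g)"
    unfolding block_formula[OF T f cutI_sq[OF g]] by (rule sums_unique[symmetric])
qed

lemma corner_subset_range: "corner M (I n) (J n) \<subseteq> P ` BH M"
proof
  fix S assume "S \<in> corner M (I n) (J n)"
  then obtain T where T: "T \<in> BH M" and S: "S = block T n" by (auto simp: corner_def block_def)
  have "P S = S"
    unfolding S
  proof (rule op_eqI[OF P_BH[OF block_BH[OF T]] block_BH[OF T]])
    fix f g assume f: "f \<in> square_integrable M" and g: "g \<in> square_integrable M"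
    have "P (block T n) = block (P T) n"
      unfolding block_def by (rule P_bimodule[OF T indicator_Linfty[OF I_meas] indicator_Linfty[OF J_meas]])
    then have "form M (P (block T n)) f g = form M (P T) (cutJ n f) (cutI n g)"
      by (simp add: form_block P_BH T f g)
    also have "\<dots> = form M T (cutJ n f) (cutI n (cutI n g))"
      by (rule block_formula_cut(1)[OF T f cutI_sq[OF g]])
    also have "cutI n (cutI n g) = cutI n g" by (auto simp: indicator_def)
    finally show "form M (P (block T n)) f g = form M (block T n) f g" by (simp add: form_block T f g)
  qed
  then show "S \<in> P ` BH M" unfolding range_eq_fixed using S block_BH[OF T] by simp
qed

lemma P_zero: "P (op_zero M) = op_zero M"
proof -
  show ?thesis using P_scale[OF op_zero_BH, of 0] by (simp add: op_scale_0 op_zero_BH P_BH)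
qed

lemma range_subspace: "op_subspace M (P ` BH M)"
  unfolding op_subspace_def range_eq_fixed
  by (auto simp: op_zero_BH P_zero op_add_BH P_add op_scale_BH P_scale)

text \<open>The range is the fixed-point set of a continuous map, and normal functionals separate points.\<close>

lemma range_closed: "wstar_topology M closure_of A \<subseteq> P ` BH M" if A: "A \<subseteq> P ` BH M"
proof
  fix T assume T: "T \<in> wstar_topology M closure_of A"
  then have TB: "T \<in> BH M" by (simp add: in_closure_of topspace_wstar)
  have cl: "\<exists>S. S \<in> A \<and> S \<in> U" if "T \<in> U" "openin (wstar_topology M) U" for U
    using T that by (simp add: in_closure_of)
  have cP: "continuous_map (wstar_topology M) (wstar_topology M) P" using normal by (simp add: wstar_continuous_def)
  have "P T = T"
  proof (rule op_eqI[OF P_BH[OF TB] TB])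
    fix f g assume f: "f \<in> square_integrable M" and g: "g \<in> square_integrable M"
    obtain \<omega> where \<omega>: "\<omega> \<in> normal_functionals M" "\<And>T. T \<in> BH M \<Longrightarrow> \<omega> T = form M T f g"
      by (rule normal_functional_single[OF f g]) blast
    let ?d = "\<lambda>T. \<omega> (P T) - \<omega> T"
    note c\<omega> = continuous_map_normal_functional[OF \<omega>(1)]
    have "continuous_map (wstar_topology M) euclidean ?d"
      using continuous_map_diff[OF continuous_map_compose[OF cP c\<omega>] c\<omega>] by (simp add: o_def)
    then have op: "openin (wstar_topology M) {S \<in> topspace (wstar_topology M). ?d S \<in> - {0}}"
      by (rule openin_continuous_map_preimage) (simp add: open_Compl flip: open_openin)
    have "?d T = 0"
    proof (rule ccontr)
      assume "?d T \<noteq> 0"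
      then have "T \<in> {S \<in> topspace (wstar_topology M). ?d S \<in> - {0}}" using TB by (simp add: topspace_wstar)
      from cl[OF this op] obtain S where "S \<in> A" "?d S \<noteq> 0" by auto
      then show False using A by (auto simp: range_eq_fixed)
    qed
    then show "form M (P T) f g = form M T f g" by (simp add: \<omega>(2) TB P_BH)
  qed
  then show "T \<in> P ` BH M" unfolding range_eq_fixed using TB by simp
qed

text \<open>The range contains the corners and is a closed subspace; conversely \<open>P T\<close> is the limit of the
  block sums of \<open>T\<close>.\<close>

lemma range_eq_closure:
  "P ` BH M = wstar_topology M closure_of op_span M (\<Union>m. corner M (I m) (J m))"
proof
  let ?A = "\<Union>m. corner M (I m) (J m)"
  have A: "?A \<subseteq> P ` BH M" using corner_subset_range by blast
  have "op_span M ?A \<subseteq> P ` BH M"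
    unfolding op_span_def by (rule hull_minimal[where S = "op_subspace M", OF A range_subspace])
  then show "wstar_topology M closure_of op_span M ?A \<subseteq> P ` BH M" by (rule range_closed)
  show "P ` BH M \<subseteq> wstar_topology M closure_of op_span M ?A"
  proof
    fix S assume "S \<in> P ` BH M"
    then obtain T where T: "T \<in> BH M" "S = P T" by blast
    have span: "op_sum M (block T) n \<in> op_span M ?A" for n
      unfolding op_span_def hull_def
    proof (rule InterI)
      fix V assume "V \<in> {V. op_subspace M V \<and> ?A \<subseteq> V}"
      then have V: "op_subspace M V" "?A \<subseteq> V" by auto
      have "block T m \<in> V" for m using V(2) T(1) by (auto simp: corner_def block_def)
      then show "op_sum M (block T) n \<in> V"
        using V(1) by (induction n) (auto simp: op_subspace_def)
    qed
    show "S \<in> wstar_topology M closure_of op_span M ?A"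
      unfolding in_closure_of
    proof (intro conjI allI impI)
      show "S \<in> topspace (wstar_topology M)" using T P_BH by (simp add: topspace_wstar)
      fix U assume U: "S \<in> U \<and> openin (wstar_topology M) U"
      then have "\<forall>\<^sub>F n in sequentially. op_sum M (block T) n \<in> U"
        using block_sum_limitin[OF T(1)] T(2) by (auto simp: limitin_def)
      then obtain n where "op_sum M (block T) n \<in> U" by (auto simp: eventually_sequentially)
      then show "\<exists>y. y \<in> op_span M ?A \<and> y \<in> U" using span by blast
    qed
  qed
qed

lemma range_intertwines:
  assumes S: "S \<in> P ` BH M" and f: "f \<in> square_integrable M" and g: "g \<in> square_integrable M"
  shows "form M S (cutJ n f) g = form M S f (cutI n g)"
proof -
  have "S \<in> BH M" "P S = S" using S by (auto simp: range_eq_fixed)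
  then show ?thesis using block_formula_cut[OF _ f g, of S n] by simp
qed

text \<open>Elements of the range carry the cut \<open>J n\<close> on the right over to the cut \<open>I n\<close> on the left, adjoints
  do the reverse, and so products \<open>m\<^sub>1 m\<^sub>2\<^sup>* m\<^sub>3\<close> have block form again.\<close>

lemma range_ternary:
  assumes m: "m\<^sub>1 \<in> P ` BH M" "m\<^sub>2 \<in> P ` BH M" "m\<^sub>3 \<in> P ` BH M"
  shows "op_mult M m\<^sub>1 (op_mult M (op_adjoint M m\<^sub>2) m\<^sub>3) \<in> P ` BH M"
proof -
  have B: "m\<^sub>1 \<in> BH M" "m\<^sub>2 \<in> BH M" "m\<^sub>3 \<in> BH M" and fixed: "P m\<^sub>1 = m\<^sub>1" using m by (auto simp: range_eq_fixed)
  note Badj = op_adjoint_BH[OF B(2)]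
  define R where "R = op_mult M m\<^sub>1 (op_mult M (op_adjoint M m\<^sub>2) m\<^sub>3)"
  have R: "R \<in> BH M" unfolding R_def by (intro op_mult_BH B Badj)
  have cnj_ind: "cnj (indicator A x) = indicator A x" for A and x :: 'a by (simp add: indicator_def)
  have cutI_adj: "(\<integral>x. cutI n u x * cnj (v x) \<partial>M) = (\<integral>x. u x * cnj (cutI n v x) \<partial>M)"
    and cutJ_adj: "(\<integral>x. cutJ n u x * cnj (v x) \<partial>M) = (\<integral>x. u x * cnj (cutJ n v x) \<partial>M)" for n u v
    by (simp_all add: cnj_ind mult_ac)
  have form_R: "form M R f g = form M m\<^sub>1 (op_fun M (op_adjoint M m\<^sub>2) (op_fun M m\<^sub>3 f)) g"
    if f: "f \<in> square_integrable M" and g: "g \<in> square_integrable M" for f g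
  proof -
    have "form M R f g = form M m\<^sub>1 (op_fun M (op_mult M (op_adjoint M m\<^sub>2) m\<^sub>3) f) g"
      unfolding R_def by (rule form_op_mult[OF op_mult_BH[OF Badj B(3)] f])
    also have "op_fun M (op_mult M (op_adjoint M m\<^sub>2) m\<^sub>3) f = op_fun M (op_adjoint M m\<^sub>2) (op_fun M m\<^sub>3 f)"
      by (simp add: op_fun_def op_mult_class[OF B(3) f])
    finally show ?thesis .
  qed
  have m3: "AE x in M. op_fun M m\<^sub>3 (cutJ n f) x = cutI n (op_fun M m\<^sub>3 f) x" if f: "f \<in> square_integrable M" for n f
  proof (rule AE_eqI_inner)
    show "op_fun M m\<^sub>3 (cutJ n f) \<in> square_integrable M" "cutI n (op_fun M m\<^sub>3 f) \<in> square_integrable M"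
      by (intro op_fun_sqint B cutJ_sq cutI_sq f)+
    fix w assume w: "w \<in> square_integrable M"
    show "(\<integral>x. op_fun M m\<^sub>3 (cutJ n f) x * cnj (w x) \<partial>M) = (\<integral>x. cutI n (op_fun M m\<^sub>3 f) x * cnj (w x) \<partial>M)"
      using range_intertwines[OF m(3) f w, of n]
      unfolding cutI_adj form_op_fun[OF B(3) cutJ_sq[OF f] w] form_op_fun[OF B(3) f cutI_sq[OF w]] .
  qed
  have m2: "AE x in M. op_fun M (op_adjoint M m\<^sub>2) (cutI n f) x = cutJ n (op_fun M (op_adjoint M m\<^sub>2) f) x"
    if f: "f \<in> square_integrable M" for n f
  proof (rule AE_eqI_inner)
    show "op_fun M (op_adjoint M m\<^sub>2) (cutI n f) \<in> square_integrable M"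
      "cutJ n (op_fun M (op_adjoint M m\<^sub>2) f) \<in> square_integrable M"
      by (intro op_fun_sqint Badj cutJ_sq cutI_sq f)+
    fix w assume w: "w \<in> square_integrable M"
    have "form M (op_adjoint M m\<^sub>2) (cutI n f) w = cnj (form M m\<^sub>2 w (cutI n f))"
      by (rule form_op_adjoint[OF B(2) w cutI_sq[OF f]])
    also have "\<dots> = cnj (form M m\<^sub>2 (cutJ n w) f)" by (simp only: range_intertwines[OF m(2) w f])
    also have "\<dots> = form M (op_adjoint M m\<^sub>2) f (cutJ n w)"
      by (rule form_op_adjoint[OF B(2) cutJ_sq[OF w] f, symmetric])
    finally show "(\<integral>x. op_fun M (op_adjoint M m\<^sub>2) (cutI n f) x * cnj (w x) \<partial>M)
        = (\<integral>x. cutJ n (op_fun M (op_adjoint M m\<^sub>2) f) x * cnj (w x) \<partial>M)"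
      unfolding cutJ_adj form_op_fun[OF Badj cutI_sq[OF f] w] form_op_fun[OF Badj f cutJ_sq[OF w]] .
  qed
  have "P R = R"
  proof (rule op_eqI[OF P_BH[OF R] R])
    fix f g assume f: "f \<in> square_integrable M" and g: "g \<in> square_integrable M"
    let ?u = "op_fun M (op_adjoint M m\<^sub>2) (op_fun M m\<^sub>3 f)"
    note s3 = op_fun_sqint[OF B(3) f]
    have u: "?u \<in> square_integrable M" by (rule op_fun_sqint[OF Badj s3])
    have "form M R (cutJ n f) (cutI n g) = form M m\<^sub>1 (cutJ n ?u) (cutI n g)" for n
      unfolding form_R[OF cutJ_sq[OF f] cutI_sq[OF g]] op_fun_cong[OF m3[OF f]]
      by (rule form_cong_AE[OF m2[OF s3]]) simp
    then have "form M (P R) f g = form M (P m\<^sub>1) ?u g"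
      unfolding block_formula[OF R f g] block_formula[OF B(1) u g] by simp
    then show "form M (P R) f g = form M R f g" by (simp add: fixed form_R[OF f g])
  qed
  then show ?thesis unfolding range_eq_fixed using R R_def by simp
qed

section \<open>The norm\<close>

text \<open>A nonzero fixed point scaled to norm one shows that the norm is at least one.\<close>

lemma map_norm_eq_1:
  assumes nonzero: "T \<in> BH M" "P T \<noteq> op_zero M"
  shows "map_norm M P = 1"
proof (rule antisym)
  show "map_norm M P \<le> 1"
    unfolding map_norm_def
  proof (rule SUP_least)
    fix T assume "T \<in> {T \<in> BH M. op_norm M T \<le> 1}"
    then have "op_norm M (P T) \<le> 1" using contraction[of T] by auto
    then show "ereal (op_norm M (P T)) \<le> 1" by simp
  qed
  define S where "S = P T"
  have S: "S \<in> BH M" "P S = S" unfolding S_def using P_BH[OF nonzero(1)] idempotent[OF nonzero(1)] by auto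
  have pos: "0 < op_norm M S"
    using op_norm_eq_0[OF S(1)] nonzero(2) op_norm_nonneg[OF S(1)] unfolding S_def[symmetric] by (auto simp: less_le)
  define S' where "S' = op_scale M (complex_of_real (1 / op_norm M S)) S"
  have S': "S' \<in> BH M" "P S' = S'" unfolding S'_def by (simp_all add: op_scale_BH S P_scale)
  have n: "op_norm M S' = 1" unfolding S'_def op_norm_scale[OF S(1)] using pos by (simp add: norm_divide)
  have "ereal (op_norm M (P S')) \<le> map_norm M P"
    unfolding map_norm_def by (rule SUP_upper) (simp add: S' n)
  then show "1 \<le> map_norm M P" by (simp add: S' n one_ereal_def)
qed

end

section \<open>Uniqueness of the symbol\<close>

lemma complex_series_cauchy_schwarz:
  fixes a b :: "nat \<Rightarrow> complex"
  assumes a: "summable (\<lambda>n. (cmod (a n))\<^sup>2)" and b: "summable (\<lambda>n. (cmod (b n))\<^sup>2)"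
    and A: "(\<Sum>n. (cmod (a n))\<^sup>2) \<le> A\<^sup>2" and B: "(\<Sum>n. (cmod (b n))\<^sup>2) \<le> B\<^sup>2" and nn: "0 \<le> A" "0 \<le> B"
  shows "summable (\<lambda>n. a n * b n)" and "cmod (\<Sum>n<N. a n * b n) \<le> A * B" and "cmod (\<Sum>n. a n * b n) \<le> A * B"
proof -
  have sm: "summable (\<lambda>n. cmod (a n) * cmod (b n))" by (rule summable_mult_of_squares[OF a b])
  have sn: "summable (\<lambda>n. cmod (a n * b n))" using sm by (simp add: norm_mult)
  then show "summable (\<lambda>n. a n * b n)" by (rule summable_norm_cancel)
  have "cmod (\<Sum>n<N. a n * b n) \<le> (\<Sum>n<N. cmod (a n) * cmod (b n))"
    using norm_sum[of "\<lambda>n. a n * b n" "{..<N}"] by (simp add: norm_mult)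
  also have "\<dots> \<le> A * B" by (rule series_cauchy_schwarz(1)[OF a b A B nn])
  finally show "cmod (\<Sum>n<N. a n * b n) \<le> A * B" .
  have "cmod (\<Sum>n. a n * b n) \<le> (\<Sum>n. cmod (a n) * cmod (b n))"
    using summable_norm[OF sn] by (simp add: norm_mult)
  also have "\<dots> \<le> A * B" by (rule series_cauchy_schwarz(2)[OF a b A B nn])
  finally show "cmod (\<Sum>n. a n * b n) \<le> A * B" .
qed

lemma summable_cmod_square_diff:
  fixes a b :: "nat \<Rightarrow> complex"
  assumes a: "summable (\<lambda>n. (cmod (a n))\<^sup>2)" and b: "summable (\<lambda>n. (cmod (b n))\<^sup>2)"
  shows "summable (\<lambda>n. (cmod (a n - b n))\<^sup>2)"
    and "(\<Sum>n. (cmod (a n - b n))\<^sup>2) \<le> 2 * (\<Sum>n. (cmod (a n))\<^sup>2) + 2 * (\<Sum>n. (cmod (b n))\<^sup>2)"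
proof -
  have le: "(cmod (a n - b n))\<^sup>2 \<le> 2 * (cmod (a n))\<^sup>2 + 2 * (cmod (b n))\<^sup>2" for n
  proof -
    have "(cmod (a n - b n))\<^sup>2 \<le> (cmod (a n) + cmod (b n))\<^sup>2" by (intro power_mono norm_triangle_ineq4) auto
    also have "\<dots> \<le> 2 * (cmod (a n))\<^sup>2 + 2 * (cmod (b n))\<^sup>2"
      using sum_squares_bound[of "cmod (a n)" "cmod (b n)"] by (simp add: power2_sum)
    finally show ?thesis .
  qed
  have s: "summable (\<lambda>n. 2 * (cmod (a n))\<^sup>2 + 2 * (cmod (b n))\<^sup>2)" by (intro summable_add summable_mult a b)
  show d: "summable (\<lambda>n. (cmod (a n - b n))\<^sup>2)"
    by (rule summable_comparison_test'[OF s]) (use le in simp)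
  have "(\<Sum>n. (cmod (a n - b n))\<^sup>2) \<le> (\<Sum>n. 2 * (cmod (a n))\<^sup>2 + 2 * (cmod (b n))\<^sup>2)"
    by (rule suminf_le[OF le d s])
  also have "\<dots> = 2 * (\<Sum>n. (cmod (a n))\<^sup>2) + 2 * (\<Sum>n. (cmod (b n))\<^sup>2)"
    by (simp add: suminf_add[symmetric] suminf_mult summable_mult a b)
  finally show "(\<Sum>n. (cmod (a n - b n))\<^sup>2) \<le> 2 * (\<Sum>n. (cmod (a n))\<^sup>2) + 2 * (\<Sum>n. (cmod (b n))\<^sup>2)" .
qed

lemma countable_dense_complex:
  obtains D :: "complex set" where "countable D" "\<And>z e. 0 < e \<Longrightarrow> \<exists>q\<in>D. (cmod (z - q))\<^sup>2 < e"
proof -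
  obtain D :: "complex set" where D: "countable D" "\<And>X. open X \<Longrightarrow> X \<noteq> {} \<Longrightarrow> \<exists>d\<in>D. d \<in> X"
    by (erule countable_dense_setE)
  show ?thesis
  proof (rule that[OF D(1)])
    fix z :: complex and e :: real assume e: "0 < e"
    have "z \<in> ball z (sqrt e)" using e by simp
    then obtain q where q: "q \<in> D" "q \<in> ball z (sqrt e)" using D(2)[OF open_ball, of z "sqrt e"] by blast
    then have "(cmod (z - q))\<^sup>2 < (sqrt e)\<^sup>2"
      by (intro power_strict_mono) (auto simp: dist_norm)
    then show "\<exists>q\<in>D. (cmod (z - q))\<^sup>2 < e" using q(1) e by auto
  qed
qed

text \<open>A square-summable sequence of functions is a map into \<open>\<ell>\<^sup>2\<close>; separability of \<open>\<ell>\<^sup>2\<close> provides countably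
  many measurable sets on which this map varies little.\<close>

lemma square_summable_separable:
  assumes f: "bounded_square_sums M f"
  obtains \<U> where "countable \<U>" "\<U> \<subseteq> sets M"
    "\<And>s \<delta>. s \<in> space M \<Longrightarrow> 0 < \<delta> \<Longrightarrow> \<exists>U\<in>\<U>. s \<in> U \<and> (\<forall>u\<in>U. (\<Sum>n. (cmod (f n u - f n s))\<^sup>2) < \<delta>)"
proof -
  have fm [measurable]: "f n \<in> borel_measurable M" for n using f by (simp add: bounded_square_sums_def)
  have fs: "summable (\<lambda>n. (cmod (f n s))\<^sup>2)" if "s \<in> space M" for s using f that by (simp add: bounded_square_sums_def)
  obtain D :: "complex set" where D: "countable D" "\<And>z e. 0 < e \<Longrightarrow> \<exists>q\<in>D. (cmod (z - q))\<^sup>2 < e"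
    by (rule countable_dense_complex) blast
  define q where "q L n = (if n < length L then L ! n else 0 :: complex)" for L n
  define U where "U = (\<lambda>(L, k). {u \<in> space M. (\<Sum>n. (cmod (f n u - q L n))\<^sup>2) < 1 / real (Suc k)})"
  have qs: "summable (\<lambda>n. (cmod (q L n))\<^sup>2)" for L
    by (rule summable_finite[of "{..<length L}"]) (auto simp: q_def)
  show ?thesis
  proof (rule that[of "U ` (lists D \<times> UNIV)"])
    show "countable (U ` (lists D \<times> UNIV))" by (intro countable_image countable_SIGMA countable_lists D) auto
    have "U Lk \<in> sets M" for Lk unfolding U_def by (cases Lk) (simp, measurable)
    then show "U ` (lists D \<times> UNIV) \<subseteq> sets M" by blast
    fix s and \<delta> :: real assume s: "s \<in> space M" and \<delta>: "0 < \<delta>"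
    then have "0 < \<delta> / 4" by simp
    then obtain k where k: "1 / real (Suc k) < \<delta> / 4" using nat_approx_posE by blast
    define r where "r = 1 / real (Suc k)"
    have r: "0 < r" by (simp add: r_def)
    then have "0 < r / 2" by simp
    from suminf_exist_split[OF this fs[OF s]] obtain N where
      "norm (\<Sum>i. (cmod (f (i + N) s))\<^sup>2) < r / 2" by blast
    then have N: "(\<Sum>i. (cmod (f (i + N) s))\<^sup>2) < r / 2" unfolding real_norm_def by linarith
    have "\<exists>c\<in>D. (cmod (f n s - c))\<^sup>2 < r / (2 * real (Suc N))" for n by (rule D(2)) (use r in simp)
    then obtain c where c: "\<And>n. c n \<in> D" "\<And>n. (cmod (f n s - c n))\<^sup>2 < r / (2 * real (Suc N))" by metis
    define L where "L = map c [0..<N]"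
    have L: "L \<in> lists D" using c(1) by (auto simp: L_def)
    have close: "(\<Sum>n. (cmod (f n s - q L n))\<^sup>2) < r"
    proof -
      note sd = summable_cmod_square_diff(1)[OF fs[OF s] qs[of L]]
      have "(\<Sum>n. (cmod (f n s - q L n))\<^sup>2) = (\<Sum>n. (cmod (f (n + N) s - q L (n + N)))\<^sup>2) + (\<Sum>n<N. (cmod (f n s - q L n))\<^sup>2)"
        by (rule suminf_split_initial_segment[OF sd])
      also have "(\<Sum>n. (cmod (f (n + N) s - q L (n + N)))\<^sup>2) = (\<Sum>n. (cmod (f (n + N) s))\<^sup>2)"
        by (simp add: q_def L_def)
      also have "(\<Sum>n<N. (cmod (f n s - q L n))\<^sup>2) \<le> (\<Sum>n<N. r / (2 * real (Suc N)))"
        using c(2) by (intro sum_mono) (auto simp: q_def L_def less_imp_le)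
      also have "\<dots> = real N * r / (2 * real (Suc N))" by simp
      also have "\<dots> \<le> r / 2" using r by (simp add: field_simps)
      finally show ?thesis using N by simp
    qed
    have "s \<in> U (L, k)" using close s by (simp add: U_def r_def)
    moreover have "(\<Sum>n. (cmod (f n u - f n s))\<^sup>2) < \<delta>" if u: "u \<in> U (L, k)" for u
    proof -
      have us: "u \<in> space M" and ur: "(\<Sum>n. (cmod (f n u - q L n))\<^sup>2) < r" using u by (auto simp: U_def r_def)
      note a = summable_cmod_square_diff(1)[OF fs[OF us] qs[of L]] and b = summable_cmod_square_diff(1)[OF fs[OF s] qs[of L]]
      have "(\<Sum>n. (cmod (f n u - f n s))\<^sup>2) \<le> 2 * (\<Sum>n. (cmod (f n u - q L n))\<^sup>2) + 2 * (\<Sum>n. (cmod (f n s - q L n))\<^sup>2)"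
        using summable_cmod_square_diff(2)[OF a b] by simp
      also have "\<dots> < 4 * r" using ur close by simp
      also have "\<dots> < \<delta>" using k by (simp add: r_def)
      finally show ?thesis .
    qed
    ultimately show "\<exists>V\<in>U ` (lists D \<times> UNIV). s \<in> V \<and> (\<forall>u\<in>V. (\<Sum>n. (cmod (f n u - f n s))\<^sup>2) < \<delta>)"
      using L by blast
  qed
qed

lemma bounded_square_sums_bmeas:
  assumes f: "bounded_square_sums M f" shows "f n \<in> bmeas M"
proof -
  obtain C where C: "\<And>s. s \<in> space M \<Longrightarrow> (\<Sum>n. (cmod (f n s))\<^sup>2) \<le> C" using f by (auto simp: bounded_square_sums_def)
  show ?thesis
  proof (rule bmeasI)
    show "f n \<in> borel_measurable M" using f by (simp add: bounded_square_sums_def)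
    fix s assume s: "s \<in> space M"
    have sm: "summable (\<lambda>n. (cmod (f n s))\<^sup>2)" using f s by (simp add: bounded_square_sums_def)
    have "(cmod (f n s))\<^sup>2 = (\<Sum>n\<in>{n}. (cmod (f n s))\<^sup>2)" by simp
    also have "\<dots> \<le> (\<Sum>n. (cmod (f n s))\<^sup>2)" by (rule sum_le_suminf[OF sm]) auto
    also have "\<dots> \<le> C" by (rule C[OF s])
    finally show "cmod (f n s) \<le> sqrt C" by (rule real_le_rsqrt)
  qed
qed

context finite_measure
begin

text \<open>The members of the two countable families serve as neighbourhoods. A point where \<open>h\<close> does not
  vanish, and neither of whose coordinates lies in a null neighbourhood, has a rectangular
  neighbourhood of positive measure on which \<open>h\<close> stays within half of its value there, so the
  integral over this rectangle cannot vanish.\<close>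

lemma marginally_null_of_rectangle_integrals:
  fixes h :: "'a \<times> 'a \<Rightarrow> complex"
  assumes h: "h \<in> bmeas MM"
    and zero: "\<And>A C. A \<in> sets M \<Longrightarrow> C \<in> sets M \<Longrightarrow> (\<integral>p. h p * (indicator A (fst p) * indicator C (snd p)) \<partial>MM) = 0"
    and U: "countable \<U>" "\<U> \<subseteq> sets M" and V: "countable \<V>" "\<V> \<subseteq> sets M"
    and near: "\<And>s t d. s \<in> space M \<Longrightarrow> t \<in> space M \<Longrightarrow> 0 < d \<Longrightarrow>
      \<exists>A\<in>\<U>. \<exists>C\<in>\<V>. s \<in> A \<and> t \<in> C \<and> (\<forall>u\<in>A. \<forall>v\<in>C. cmod (h (u, v) - h (s, t)) \<le> d)"
  shows "marginally_null M {p \<in> space M \<times> space M. h p \<noteq> 0}"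
proof -
  obtain N1 where N1: "N1 \<in> null_sets M" "\<And>A s. A \<in> \<U> \<Longrightarrow> s \<in> A \<Longrightarrow> s \<notin> N1 \<Longrightarrow> 0 < measure M A"
    by (rule essential_points[OF U]) blast
  obtain N2 where N2: "N2 \<in> null_sets M" "\<And>A s. A \<in> \<V> \<Longrightarrow> s \<in> A \<Longrightarrow> s \<notin> N2 \<Longrightarrow> 0 < measure M A"
    by (rule essential_points[OF V]) blast
  have "h (s, t) = 0" if s: "s \<in> space M" "s \<notin> N1" and t: "t \<in> space M" "t \<notin> N2" for s t
  proof (rule ccontr)
    assume neq: "h (s, t) \<noteq> 0"
    define z where "z = h (s, t)"
    have z: "0 < cmod z / 2" using neq by (simp add: z_def)
    obtain A C where A: "A \<in> \<U>" "s \<in> A" and C: "C \<in> \<V>" "t \<in> C"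
      and le: "\<And>u v. u \<in> A \<Longrightarrow> v \<in> C \<Longrightarrow> cmod (h (u, v) - z) \<le> cmod z / 2"
      using near[OF s(1) t(1) z] unfolding z_def by blast
    have Am: "A \<in> sets M" and Cm: "C \<in> sets M" using A C U V by auto
    have pA: "0 < measure M A" and pC: "0 < measure M C" using N1(2)[OF A s(2)] N2(2)[OF C t(2)] by auto
    let ?R = "\<lambda>p. indicator A (fst p) * indicator C (snd p) :: complex"
    have iA: "integrable M (indicator A :: _ \<Rightarrow> complex)" and iC: "integrable M (indicator C :: _ \<Rightarrow> complex)"
      by (intro bmeas_integrable bmeas_indicator Am Cm)+
    have iR: "integrable MM ?R" by (rule integrable_product(1)[OF iA iC])
    have rA: "(\<integral>x. indicator A x \<partial>M) = measure M A" and rC: "(\<integral>x. indicator C x \<partial>M) = measure M C"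
      using Am Cm by (simp_all add: sets.Int_space_eq2)
    let ?R' = "\<lambda>p. indicator A (fst p) * indicator C (snd p) :: real"
    have iA': "integrable M (indicator A :: _ \<Rightarrow> real)" and iC': "integrable M (indicator C :: _ \<Rightarrow> real)"
      using Am Cm by (simp_all add: emeasure_eq_measure)
    have iR': "integrable MM ?R'" by (rule integrable_product(1)[OF iA' iC'])
    have mR': "(\<integral>p. ?R' p \<partial>MM) = measure M A * measure M C"
      using integrable_product(2)[OF iA' iC'] by (simp only: rA rC)
    have cplx: "?R p = complex_of_real (?R' p)" for p by (simp add: indicator_def)
    have mR: "(\<integral>p. ?R p \<partial>MM) = complex_of_real (measure M A * measure M C)"
      unfolding cplx integral_complex_of_real mR' ..
    have ih: "integrable MM (\<lambda>p. h p * ?R p)"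
      by (intro finite_measure.bmeas_integrable[OF finite_measure_pair_self] bmeas_mult h
          bmeas_product bmeas_indicator Am Cm)
    have iz: "integrable MM (\<lambda>p. z * ?R p)" using iR by simp
    have "(\<integral>p. z * ?R p \<partial>MM) = (\<integral>p. z * ?R p - h p * ?R p \<partial>MM)"
      using zero[OF Am Cm] ih iz by simp
    then have "cmod (\<integral>p. z * ?R p \<partial>MM) \<le> (\<integral>p. cmod (z * ?R p - h p * ?R p) \<partial>MM)"
      using integral_norm_bound[of "MM" "\<lambda>p. z * ?R p - h p * ?R p"] by simp
    also have "\<dots> \<le> (\<integral>p. (cmod z / 2) * ?R' p \<partial>MM)"
    proof (rule integral_mono)
      show "integrable MM (\<lambda>p. cmod (z * ?R p - h p * ?R p))"
        by (intro integrable_norm Bochner_Integration.integrable_diff ih iz)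
      show "integrable MM (\<lambda>p. (cmod z / 2) * ?R' p)" using iR' by simp
      fix p :: "'a \<times> 'a"
      obtain u v where p: "p = (u, v)" by force
      show "cmod (z * ?R p - h p * ?R p) \<le> (cmod z / 2) * ?R' p"
        using le[of u v] by (auto simp: p indicator_def norm_minus_commute)
    qed
    also have "\<dots> = (cmod z / 2) * (measure M A * measure M C)" using mR' by simp
    finally have "cmod z * (measure M A * measure M C) \<le> (cmod z / 2) * (measure M A * measure M C)"
      using mR pA pC by (simp add: norm_mult)
    moreover have "(cmod z / 2) * (measure M A * measure M C) < cmod z * (measure M A * measure M C)"
      using z pA pC by (intro mult_strict_right_mono mult_pos_pos) auto
    ultimately show False by linarith
  qed
  then have "{p \<in> space M \<times> space M. h p \<noteq> 0} \<subseteq> (N1 \<union> N2) \<times> space M \<union> space M \<times> (N1 \<union> N2)"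
    by auto
  moreover have "N1 \<union> N2 \<in> null_sets M" using N1(1) N2(1) by auto
  ultimately show ?thesis unfolding marginally_null_def by blast
qed

end

context rectangle_idempotent
begin

lemma represents_indicators:
  "represents M (\<lambda>n. indicator (I n)) (\<lambda>n. indicator (J n)) P"
proof -
  have bss: "bounded_square_sums M (\<lambda>n. indicator (A n))" if A: "\<And>n. A n \<in> sets M" and d: "disjoint_family A" for A :: "nat \<Rightarrow> 'a set"
  proof -
    have le: "(\<Sum>n<N. (cmod (indicator (A n) s))\<^sup>2) \<le> 1" for N s
    proof -
      have "(\<Sum>n<N. (cmod (indicator (A n) s))\<^sup>2) = (\<Sum>n<N. indicator (A n) s)"
        by (intro sum.cong) (auto simp: indicator_def)
      also have "\<dots> = indicator (\<Union>n<N. A n) s"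
        by (rule indicator_UN_disjoint[symmetric]) (use d in \<open>auto simp: disjoint_family_on_def\<close>)
      also have "\<dots> \<le> 1" by (simp add: indicator_def)
      finally show ?thesis .
    qed
    have s: "summable (\<lambda>n. (cmod (indicator (A n) s))\<^sup>2)" for s
      by (rule summableI_nonneg_bounded[OF _ le]) simp
    show ?thesis
      unfolding bounded_square_sums_def
      using A s suminf_le_const[OF s le] by (auto intro!: exI[of _ 1])
  qed
  show ?thesis
    unfolding represents_def
    using bss[OF I_meas I_disj] bss[OF J_meas J_disj] block_sum_limitin by (simp add: block_def[abs_def])
qed

text \<open>Evaluate the representation at the integral operator with kernel \<open>1\<close> and the vectors
  \<open>indicator C\<close> and \<open>indicator A\<close>.\<close>

lemma represents_rectangle_integral:
  assumes rep: "represents M f g P" and A: "A \<in> sets M" and C: "C \<in> sets M"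
  shows "(\<lambda>N. \<integral>p. (\<Sum>n<N. f n (fst p) * g n (snd p)) * (indicator A (fst p) * indicator C (snd p)) \<partial>MM)
    \<longlonglongrightarrow> (\<integral>p. indicator (\<Union>m. I m \<times> J m) p * (indicator A (fst p) * indicator C (snd p)) \<partial>MM)"
proof -
  have f: "f n \<in> bmeas M" and g: "g n \<in> bmeas M" for n
    using rep by (auto simp: represents_def intro: bounded_square_sums_bmeas)
  define T where "T = kernel_op M (\<lambda>_. 1)"
  have k1: "(\<lambda>_. 1) \<in> bmeas MM" by (rule bmeas_const)
  have T: "T \<in> BH M" unfolding T_def by (rule kernel_op_BH[OF k1])
  define S where "S n = op_mult M (mult_op M (f n)) (op_mult M T (mult_op M (g n)))" for n
  have lf: "f n \<in> Linfty M" and lg: "g n \<in> Linfty M" for n using f g by (auto intro: bmeas_Linfty)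
  have S: "S n \<in> BH M" for n unfolding S_def by (intro op_mult_BH mult_op_BH lf lg T)
  have lim: "limitin (wstar_topology M) (op_sum M S) (P T) sequentially"
    using rep T by (simp add: represents_def S_def[abs_def])
  have sA: "indicator A \<in> square_integrable M" and sC: "indicator C \<in> square_integrable M"
    by (intro indicator_sqint A C)+
  let ?R = "\<lambda>p. indicator A (fst p) * indicator C (snd p) :: complex"
  have fg: "(\<lambda>p. f n (fst p) * g n (snd p)) \<in> bmeas MM" for n
    by (rule bmeas_product[OF f g])
  have R: "?R \<in> bmeas MM"
    by (intro bmeas_product bmeas_indicator A C)
  have form_S: "form M (S n) (indicator C) (indicator A) = (\<integral>p. f n (fst p) * g n (snd p) * ?R p \<partial>MM)" for n
  proof -
    have "form M (S n) (indicator C) (indicator A) = form M T (\<lambda>x. g n x * indicator C x) (\<lambda>x. cnj (f n x) * indicator A x)"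
      unfolding S_def by (rule form_mult_op_both[OF T lf lg sC sA])
    also have "\<dots> = (\<integral>p. 1 * (cnj (cnj (f n (fst p)) * indicator A (fst p)) * (g n (snd p) * indicator C (snd p))) \<partial>MM)"
      unfolding T_def by (rule form_kernel_op[OF k1]) (intro Linfty_mult_sqint Linfty_cnj lf lg sC sA)+
    also have "\<dots> = (\<integral>p. f n (fst p) * g n (snd p) * ?R p \<partial>MM)"
      by (intro Bochner_Integration.integral_cong) (auto simp: indicator_def)
    finally show ?thesis .
  qed
  have int: "integrable MM (\<lambda>p. f n (fst p) * g n (snd p) * ?R p)" for n
    by (rule finite_measure.bmeas_integrable[OF finite_measure_pair_self bmeas_mult[OF fg R]])
  have "form M (op_sum M S N) (indicator C) (indicator A) = (\<integral>p. (\<Sum>n<N. f n (fst p) * g n (snd p)) * ?R p \<partial>MM)" for N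
    unfolding form_op_sum[OF S sC sA] form_S sum_distrib_right
    by (rule Bochner_Integration.integral_sum[symmetric]) (rule int)
  moreover have "form M (P T) (indicator C) (indicator A) = (\<integral>p. indicator (\<Union>m. I m \<times> J m) p * ?R p \<partial>MM)"
    unfolding T_def P_kernel_op[OF k1]
      form_kernel_op[OF bmeas_mult[OF bmeas_indicator[OF rectangles_measurable] k1] sC sA]
    by (intro Bochner_Integration.integral_cong) (auto simp: indicator_def)
  moreover have "(\<lambda>N. form M (op_sum M S N) (indicator C) (indicator A)) \<longlonglongrightarrow> form M (P T) (indicator C) (indicator A)"
    by (rule limitin_wstar_form[OF lim op_sum_BH[OF S] sC sA])
  ultimately show ?thesis by simp
qed

text \<open>The sets \<open>I m\<close>, together with what they leave over, partition the space.\<close>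

lemma rectangles_locally_constant:
  assumes "s \<in> space M" "t \<in> space M"
  obtains V W where "V \<in> insert (space M - (\<Union>m. I m)) (range I)" "s \<in> V" "W \<in> insert (space M - (\<Union>m. J m)) (range J)" "t \<in> W"
    "\<forall>u\<in>V. \<forall>v\<in>W. (u, v) \<in> (\<Union>m. I m \<times> J m) \<longleftrightarrow> (s, t) \<in> (\<Union>m. I m \<times> J m)"
proof -
  obtain V where V: "V \<in> insert (space M - (\<Union>m. I m)) (range I)" "s \<in> V" using assms(1) by blast
  obtain W where W: "W \<in> insert (space M - (\<Union>m. J m)) (range J)" "t \<in> W" using assms(2) by blast
  have keyI: "x \<in> I m \<longleftrightarrow> m = k" if "x \<in> I k" for x m k
    using I_disj that by (auto simp: disjoint_family_on_def)
  have keyJ: "x \<in> J m \<longleftrightarrow> m = k" if "x \<in> J k" for x m k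
    using J_disj that by (auto simp: disjoint_family_on_def)
  have cV: "u \<in> I m \<longleftrightarrow> s \<in> I m" if u: "u \<in> V" for u m
    using V(1)
  proof
    assume "V = space M - (\<Union>m. I m)"
    then show ?thesis using V(2) u by simp
  next
    assume "V \<in> range I"
    then obtain k where "V = I k" by blast
    then show ?thesis using V(2) u keyI[of u k m] keyI[of s k m] by simp
  qed
  have cW: "v \<in> J m \<longleftrightarrow> t \<in> J m" if v: "v \<in> W" for v m
    using W(1)
  proof
    assume "W = space M - (\<Union>m. J m)"
    then show ?thesis using W(2) v by simp
  next
    assume "W \<in> range J"
    then obtain k where "W = J k" by blast
    then show ?thesis using W(2) v keyJ[of v k m] keyJ[of t k m] by simp
  qed
  show ?thesis by (rule that[OF V W]) (simp add: cV cW)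
qed

text \<open>The difference of the two symbols has vanishing integrals over rectangles. It varies little near a
  point, measured in the coordinate of \<open>\<ell>\<^sup>2\<close> for the series and by membership in the pieces of the
  partitions for the indicator.\<close>

lemma represents_unique:
  assumes rep: "represents M f g P"
  shows "marginally_null M {p \<in> space M \<times> space M. (\<lambda>(s, t). \<Sum>n. f n s * g n t) p \<noteq> indicator (\<Union>m. I m \<times> J m) p}"
    (is "marginally_null M ?X")
proof -
  have f: "bounded_square_sums M f" and g: "bounded_square_sums M g" using rep by (auto simp: represents_def)
  let ?E = "\<Union>m. I m \<times> J m"
  have fs: "summable (\<lambda>n. (cmod (f n s))\<^sup>2)" and gs: "summable (\<lambda>n. (cmod (g n s))\<^sup>2)" if "s \<in> space M" for s
    using f g that by (auto simp: bounded_square_sums_def)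
  obtain Cf0 where "\<And>s. s \<in> space M \<Longrightarrow> (\<Sum>n. (cmod (f n s))\<^sup>2) \<le> Cf0" using f by (auto simp: bounded_square_sums_def)
  then have fb: "s \<in> space M \<Longrightarrow> (\<Sum>n. (cmod (f n s))\<^sup>2) \<le> (sqrt \<bar>Cf0\<bar>)\<^sup>2" for s by (simp add: abs_le_iff) (meson abs_ge_self order_trans)
  obtain Cg0 where "\<And>s. s \<in> space M \<Longrightarrow> (\<Sum>n. (cmod (g n s))\<^sup>2) \<le> Cg0" using g by (auto simp: bounded_square_sums_def)
  then have gb: "s \<in> space M \<Longrightarrow> (\<Sum>n. (cmod (g n s))\<^sup>2) \<le> (sqrt \<bar>Cg0\<bar>)\<^sup>2" for s by (simp add: abs_le_iff) (meson abs_ge_self order_trans)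
  define cf cg where "cf = sqrt \<bar>Cf0\<bar>" and "cg = sqrt \<bar>Cg0\<bar>"
  have c0: "0 \<le> cf" "0 \<le> cg" by (auto simp: cf_def cg_def)
  note fb = fb[folded cf_def] and gb = gb[folded cg_def]
  have [measurable]: "f n \<in> borel_measurable M" "g n \<in> borel_measurable M" for n
    using f g by (auto simp: bounded_square_sums_def)
  note E [measurable] = rectangles_measurable
  define \<psi> where "\<psi> p = (\<Sum>n. f n (fst p) * g n (snd p))" for p
  have psi_m [measurable]: "\<psi> \<in> borel_measurable MM" unfolding \<psi>_def[abs_def] by measurable
  have psi_b: "cmod (\<psi> p) \<le> cf * cg" "cmod (\<Sum>n<N. f n (fst p) * g n (snd p)) \<le> cf * cg" if "p \<in> space MM" for p N
  proof -
    have "fst p \<in> space M" "snd p \<in> space M" using that by (auto simp: space_pair_measure)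
    note cs = complex_series_cauchy_schwarz[OF fs[OF this(1)] gs[OF this(2)] fb[OF this(1)] gb[OF this(2)] c0]
    show "cmod (\<psi> p) \<le> cf * cg" "cmod (\<Sum>n<N. f n (fst p) * g n (snd p)) \<le> cf * cg"
      unfolding \<psi>_def by (rule cs)+
  qed
  have psi: "\<psi> \<in> bmeas MM" by (rule bmeasI[OF psi_m psi_b(1)])
  define h where "h p = \<psi> p - indicator ?E p" for p
  have ind: "(indicator ?E :: _ \<Rightarrow> complex) \<in> bmeas MM" by (rule bmeas_indicator[OF E])
  have h: "h \<in> bmeas MM" unfolding h_def[abs_def] by (rule bmeas_diff[OF psi ind])
  have zero: "(\<integral>p. h p * (indicator A (fst p) * indicator C (snd p)) \<partial>MM) = 0"
    if A [measurable]: "A \<in> sets M" and C [measurable]: "C \<in> sets M" for A C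
  proof -
    let ?R = "\<lambda>p. indicator A (fst p) * indicator C (snd p) :: complex"
    have R: "?R \<in> bmeas MM"
      by (intro bmeas_product bmeas_indicator A C)
    have [measurable]: "?R \<in> borel_measurable MM" by measurable
    note bi = finite_measure.bmeas_integrable[OF finite_measure_pair_self]
    have "(\<lambda>N. \<integral>p. (\<Sum>n<N. f n (fst p) * g n (snd p)) * ?R p \<partial>MM) \<longlonglongrightarrow> (\<integral>p. \<psi> p * ?R p \<partial>MM)"
    proof (rule integral_dominated_convergence[where w = "\<lambda>_. cf * cg"])
      show "integrable MM (\<lambda>_. cf * cg)"
        by (rule finite_measure.integrable_const[OF finite_measure_pair_self])
      show "AE p in MM. (\<lambda>N. (\<Sum>n<N. f n (fst p) * g n (snd p)) * ?R p) \<longlonglongrightarrow> \<psi> p * ?R p"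
      proof (rule AE_I2, rule tendsto_mult[OF _ tendsto_const])
        fix p assume "p \<in> space MM"
        then have "fst p \<in> space M" "snd p \<in> space M" by (auto simp: space_pair_measure)
        then have "summable (\<lambda>n. f n (fst p) * g n (snd p))"
          using complex_series_cauchy_schwarz(1)[OF fs gs fb gb c0] by blast
        then show "(\<lambda>N. \<Sum>n<N. f n (fst p) * g n (snd p)) \<longlonglongrightarrow> \<psi> p" unfolding \<psi>_def by (rule summable_LIMSEQ)
      qed
      show "AE p in MM. norm ((\<Sum>n<N. f n (fst p) * g n (snd p)) * ?R p) \<le> cf * cg" for N
      proof (rule AE_I2)
        fix p assume p: "p \<in> space MM"
        have "norm ((\<Sum>n<N. f n (fst p) * g n (snd p)) * ?R p) \<le> norm (\<Sum>n<N. f n (fst p) * g n (snd p))"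
          by (auto simp: indicator_def)
        also have "\<dots> \<le> cf * cg" by (rule psi_b(2)[OF p])
        finally show "norm ((\<Sum>n<N. f n (fst p) * g n (snd p)) * ?R p) \<le> cf * cg" .
      qed
    qed measurable
    then have "(\<integral>p. \<psi> p * ?R p \<partial>MM) = (\<integral>p. indicator ?E p * ?R p \<partial>MM)"
      using represents_rectangle_integral[OF rep A C] by (rule LIMSEQ_unique)
    then show ?thesis
      unfolding h_def left_diff_distrib
      by (subst Bochner_Integration.integral_diff[OF bi[OF bmeas_mult[OF psi R]] bi[OF bmeas_mult[OF ind R]]]) simp
  qed
  obtain \<U> where U: "countable \<U>" "\<U> \<subseteq> sets M"
    "\<And>s \<delta>. s \<in> space M \<Longrightarrow> 0 < \<delta> \<Longrightarrow> \<exists>U\<in>\<U>. s \<in> U \<and> (\<forall>u\<in>U. (\<Sum>n. (cmod (f n u - f n s))\<^sup>2) < \<delta>)"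
    by (rule square_summable_separable[OF f]) blast
  obtain \<V> where V: "countable \<V>" "\<V> \<subseteq> sets M"
    "\<And>s \<delta>. s \<in> space M \<Longrightarrow> 0 < \<delta> \<Longrightarrow> \<exists>U\<in>\<V>. s \<in> U \<and> (\<forall>u\<in>U. (\<Sum>n. (cmod (g n u - g n s))\<^sup>2) < \<delta>)"
    by (rule square_summable_separable[OF g]) blast
  let ?PI = "insert (space M - (\<Union>m. I m)) (range I)" and ?PJ = "insert (space M - (\<Union>m. J m)) (range J)"
  have PI: "countable ?PI" "?PI \<subseteq> sets M" and PJ: "countable ?PJ" "?PJ \<subseteq> sets M"
    using I_meas J_meas by auto
  let ?\<U> = "(\<lambda>(A, B). A \<inter> B) ` (\<U> \<times> ?PI)" and ?\<V> = "(\<lambda>(A, B). A \<inter> B) ` (\<V> \<times> ?PJ)"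
  have "marginally_null M {p \<in> space M \<times> space M. h p \<noteq> 0}"
  proof (rule marginally_null_of_rectangle_integrals[OF h zero])
    show "countable ?\<U>" "countable ?\<V>" by (intro countable_image countable_SIGMA U V PI PJ)+
    show "?\<U> \<subseteq> sets M" using U(2) PI(2) by (auto simp: image_subset_iff intro!: sets.Int)
    show "?\<V> \<subseteq> sets M" using V(2) PJ(2) by (auto simp: image_subset_iff intro!: sets.Int)
    fix s t and d :: real assume s: "s \<in> space M" and t: "t \<in> space M" and d: "0 < d"
    define e where "e = d / (cf + cg + 1)"
    have e: "0 < e" using d c0 by (simp add: e_def)
    have ed: "e * cg + cf * e \<le> d"
    proof -
      have "e * cg + cf * e \<le> e * (cf + cg + 1)" using e by (simp add: algebra_simps)
      also have "\<dots> = d" using c0 by (simp add: e_def)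
      finally show ?thesis .
    qed
    have e2: "0 < e\<^sup>2" using e by simp
    obtain A where A: "A \<in> \<U>" "s \<in> A" "\<And>u. u \<in> A \<Longrightarrow> (\<Sum>n. (cmod (f n u - f n s))\<^sup>2) < e\<^sup>2" using U(3)[OF s e2] by blast
    obtain C where C: "C \<in> \<V>" "t \<in> C" "\<And>v. v \<in> C \<Longrightarrow> (\<Sum>n. (cmod (g n v - g n t))\<^sup>2) < e\<^sup>2" using V(3)[OF t e2] by blast
    obtain A' C' :: "'a set" where A': "A' \<in> ?PI" "s \<in> A'" and C': "C' \<in> ?PJ" "t \<in> C'"
      and const: "\<forall>u\<in>A'. \<forall>v\<in>C'. (u, v) \<in> ?E \<longleftrightarrow> (s, t) \<in> ?E"
      by (rule rectangles_locally_constant[OF s t])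
    have small: "cmod (h (u, v) - h (s, t)) \<le> d" if u: "u \<in> A \<inter> A'" and v: "v \<in> C \<inter> C'" for u v
    proof -
      have us: "u \<in> space M" and vs: "v \<in> space M"
        using u v A(1) C(1) U(2) V(2) sets.sets_into_space by blast+
      have "(indicator ?E (u, v) :: complex) = indicator ?E (s, t)"
        using const[rule_format, of u v] u v by (simp add: indicator_def)
      then have "h (u, v) - h (s, t) = \<psi> (u, v) - \<psi> (s, t)" by (simp add: h_def)
      also have "\<dots> = (\<Sum>n. f n u * g n v) - (\<Sum>n. f n s * g n t)" by (simp add: \<psi>_def)
      also have "\<dots> = (\<Sum>n. f n u * g n v - f n s * g n t)"
        by (rule suminf_diff[OF complex_series_cauchy_schwarz(1)[OF fs[OF us] gs[OF vs] fb[OF us] gb[OF vs] c0]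
              complex_series_cauchy_schwarz(1)[OF fs[OF s] gs[OF t] fb[OF s] gb[OF t] c0]])
      also have "\<dots> = (\<Sum>n. (f n u - f n s) * g n v + f n s * (g n v - g n t))"
        by (simp add: algebra_simps)
      finally have eq: "h (u, v) - h (s, t) = (\<Sum>n. (f n u - f n s) * g n v + f n s * (g n v - g n t))" .
      have sf: "(\<Sum>n. (cmod (f n u - f n s))\<^sup>2) \<le> e\<^sup>2" and sg: "(\<Sum>n. (cmod (g n v - g n t))\<^sup>2) \<le> e\<^sup>2"
        using A(3)[of u] C(3)[of v] u v by auto
      note c1 = complex_series_cauchy_schwarz[OF summable_cmod_square_diff(1)[OF fs[OF us] fs[OF s]] gs[OF vs] sf gb[OF vs] less_imp_le[OF e] c0(2)]
      note c2 = complex_series_cauchy_schwarz[OF fs[OF s] summable_cmod_square_diff(1)[OF gs[OF vs] gs[OF t]] fb[OF s] sg c0(1) less_imp_le[OF e]]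
      have "cmod (h (u, v) - h (s, t)) \<le> cmod (\<Sum>n. (f n u - f n s) * g n v) + cmod (\<Sum>n. f n s * (g n v - g n t))"
        unfolding eq suminf_add[OF c1(1) c2(1), symmetric] by (rule norm_triangle_ineq)
      also have "\<dots> \<le> d" using c1(3) c2(3) ed by linarith
      finally show ?thesis .
    qed
    have mem: "A \<inter> A' \<in> ?\<U>" "C \<inter> C' \<in> ?\<V>" using A(1) A'(1) C(1) C'(1) by blast+
    show "\<exists>A\<in>?\<U>. \<exists>C\<in>?\<V>. s \<in> A \<and> t \<in> C \<and> (\<forall>u\<in>A. \<forall>v\<in>C. cmod (h (u, v) - h (s, t)) \<le> d)"
      by (intro bexI[OF _ mem(1)] bexI[OF _ mem(2)] conjI ballI small)
        (use A(2) A'(2) C(2) C'(2) in simp_all)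
  qed
  moreover have "{p \<in> space M \<times> space M. h p \<noteq> 0} = ?X"
    by (auto simp: h_def \<psi>_def)
  ultimately show ?thesis by simp
qed

lemma mae_class_cong:
  assumes "marginally_null M {p \<in> space M \<times> space M. \<phi> p \<noteq> \<psi> p}"
  shows "mae_class M \<phi> = mae_class M \<psi>"
proof -
  have Un: "marginally_null M (R \<union> S)" if R: "marginally_null M R" and S: "marginally_null M S" for R S
  proof -
    obtain N1 where N1: "N1 \<in> null_sets M" "R \<subseteq> N1 \<times> space M \<union> space M \<times> N1"
      using R unfolding marginally_null_def by auto
    obtain N2 where N2: "N2 \<in> null_sets M" "S \<subseteq> N2 \<times> space M \<union> space M \<times> N2"
      using S unfolding marginally_null_def by auto
    have "R \<union> S \<subseteq> (N1 \<union> N2) \<times> space M \<union> space M \<times> (N1 \<union> N2)" using N1(2) N2(2) by fast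
    then show ?thesis unfolding marginally_null_def using null_sets.Un[OF N1(1) N2(1)] by (rule bexI)
  qed
  have mono: "marginally_null M S" if "marginally_null M R" "S \<subseteq> R" for R S
    using that unfolding marginally_null_def by (meson order_trans)
  have "marginally_null M {p \<in> space M \<times> space M. \<theta> p \<noteq> \<phi> p} \<longleftrightarrow> marginally_null M {p \<in> space M \<times> space M. \<theta> p \<noteq> \<psi> p}" for \<theta>
  proof
    assume "marginally_null M {p \<in> space M \<times> space M. \<theta> p \<noteq> \<phi> p}"
    from Un[OF this assms] show "marginally_null M {p \<in> space M \<times> space M. \<theta> p \<noteq> \<psi> p}" by (rule mono) auto
  next
    assume "marginally_null M {p \<in> space M \<times> space M. \<theta> p \<noteq> \<psi> p}"
    from Un[OF this assms] show "marginally_null M {p \<in> space M \<times> space M. \<theta> p \<noteq> \<phi> p}" by (rule mono) auto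
  qed
  then show ?thesis by (simp add: mae_class_def)
qed

lemma symbol_eq: "symbol M P = mae_class M (indicator (\<Union>m. I m \<times> J m))"
proof -
  have "mae_class M (\<lambda>(s, t). \<Sum>n. f n s * g n t) = mae_class M (indicator (\<Union>m. I m \<times> J m))"
    if "represents M f g P" for f g
    by (rule mae_class_cong[OF represents_unique[OF that]])
  then show ?thesis unfolding symbol_def using represents_indicators by blast
qed

end

section \<open>The theorem\<close>

text \<open>The supremum over the unit ball becomes an inequality for all operators by scaling.\<close>

lemma (in finite_measure) map_norm_bound:
  assumes lin: "linear_map M P" and bd: "map_norm M P < ereal c"
  obtains K where "0 \<le> K" "K < c" "\<And>T. T \<in> BH M \<Longrightarrow> op_norm M (P T) \<le> K * op_norm M T"
proof -
  have PB: "P T \<in> BH M" and Psc: "P (op_scale M a T) = op_scale M a (P T)" if "T \<in> BH M" for a T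
    using lin that by (auto simp: linear_map_def)
  have le: "ereal (op_norm M (P T)) \<le> map_norm M P" if "T \<in> BH M" "op_norm M T \<le> 1" for T
    unfolding map_norm_def by (rule SUP_upper) (use that in simp)
  have n0: "op_norm M (op_zero M) = 0"
    using op_norm_scale[OF op_zero_BH, of 0] by (simp add: op_scale_0 op_zero_BH)
  have "0 \<le> op_norm M (P (op_zero M))" by (rule op_norm_nonneg[OF PB[OF op_zero_BH]])
  then have nn: "0 \<le> map_norm M P" using le[OF op_zero_BH] by (auto simp: n0 zero_ereal_def intro: order_trans[rotated])
  then obtain K where K: "map_norm M P = ereal K" using bd by (cases "map_norm M P") auto
  show ?thesis
  proof (rule that)
    show "0 \<le> K" "K < c" using nn bd by (auto simp: K)
    fix T assume T: "T \<in> BH M"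
    show "op_norm M (P T) \<le> K * op_norm M T"
    proof (cases "op_norm M T = 0")
      case True
      then have "T = op_scale M 0 T" using op_norm_eq_0[OF T] op_scale_0[OF T] by simp
      then have "P T = op_scale M 0 (P T)" using Psc[OF T, of 0] by simp
      then have "op_norm M (P T) = 0" using op_norm_scale[OF PB[OF T], of 0] by simp
      then show ?thesis using True by simp
    next
      case False
      then have pos: "0 < op_norm M T" using op_norm_nonneg[OF T] by simp
      let ?a = "complex_of_real (1 / op_norm M T)"
      have "op_norm M (op_scale M ?a T) \<le> 1" unfolding op_norm_scale[OF T] using pos by (simp add: norm_divide)
      from le[OF op_scale_BH[OF T] this] have "op_norm M (op_scale M ?a (P T)) \<le> K" by (simp add: K Psc T)
      then show ?thesis unfolding op_norm_scale[OF PB[OF T]] using pos by (simp add: norm_divide divide_le_eq)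
    qed
  qed
qed

theorem theorem10:
  fixes M :: "'a measure" and P :: "'a oper \<Rightarrow> 'a oper"
  assumes "standard_borel M" and "finite_measure M"
    and "linear_map M P" and "bimodule_map M P" and "wstar_continuous M P"
    and idempotent: "\<forall>T\<in>BH M. P (P T) = P T"
    and nonzero: "\<exists>T\<in>BH M. P T \<noteq> op_zero M"
    and norm: "map_norm M P < ereal (2 / sqrt 3)"
  shows "(\<exists>I J :: nat \<Rightarrow> 'a set.
            range I \<subseteq> sets M \<and> range J \<subseteq> sets M \<and> disjoint_family I \<and> disjoint_family J \<and>
            symbol M P = mae_class M (indicator (\<Union>m. I m \<times> J m)) \<and>
            P ` BH M = wstar_topology M closure_of op_span M (\<Union>m. corner M (I m) (J m))) \<and>
         (\<forall>m\<^sub>1\<in>P ` BH M. \<forall>m\<^sub>2\<in>P ` BH M. \<forall>m\<^sub>3\<in>P ` BH M.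
            op_mult M m\<^sub>1 (op_mult M (op_adjoint M m\<^sub>2) m\<^sub>3) \<in> P ` BH M) \<and>
         map_norm M P = 1"
proof -
  interpret finite_measure M by fact
  obtain B :: "nat \<Rightarrow> 'a set" where B: "range B \<subseteq> sets M" "sets M = sigma_sets (space M) (range B)"
    using standard_borel_generator[OF \<open>standard_borel M\<close>] by blast
  obtain K where K: "0 \<le> K" "K < 2 / sqrt 3" "\<And>T. T \<in> BH M \<Longrightarrow> op_norm M (P T) \<le> K * op_norm M T"
    by (rule map_norm_bound[OF \<open>linear_map M P\<close> norm]) blast
  interpret small_idempotent M P K B
    by unfold_locales (use assms B K in auto)
  obtain I J :: "nat \<Rightarrow> 'a set" where IJ: "range I \<subseteq> sets M" "range J \<subseteq> sets M" "disjoint_family I" "disjoint_family J"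
    "\<And>k. k \<in> bmeas MM \<Longrightarrow> P (kernel_op M k) = kernel_op M (\<lambda>p. indicator (\<Union>m. I m \<times> J m) p * k p)"
    by (rule rectangle_structure) blast
  interpret R: rectangle_idempotent M P K B I J
    by unfold_locales (use assms IJ in auto)
  obtain T where T: "T \<in> BH M" "P T \<noteq> op_zero M" using nonzero by blast
  show ?thesis
  proof (intro conjI exI ballI)
    show "range I \<subseteq> sets M" "range J \<subseteq> sets M" "disjoint_family I" "disjoint_family J" by (fact IJ)+
    show "symbol M P = mae_class M (indicator (\<Union>m. I m \<times> J m))" by (rule R.symbol_eq)
    show "P ` BH M = wstar_topology M closure_of op_span M (\<Union>m. corner M (I m) (J m))" by (rule R.range_eq_closure)
    show "op_mult M m\<^sub>1 (op_mult M (op_adjoint M m\<^sub>2) m\<^sub>3) \<in> P ` BH M"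
      if "m\<^sub>1 \<in> P ` BH M" "m\<^sub>2 \<in> P ` BH M" "m\<^sub>3 \<in> P ` BH M" for m\<^sub>1 m\<^sub>2 m\<^sub>3
      using that by (rule R.range_ternary)
    show "map_norm M P = 1" by (rule R.map_norm_eq_1[OF T])
  qed
qed

end
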